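(* Assume: (i) $\|g\|_\infty \le C$ with $C>0$; (ii) $Y_i-g(X_i)$ is $\sigma^2$-subgaussian given $X_i$ for $1\le i\le n$, with $\sigma>0$; (iii) $H$ is a separable RKHS on $S$ whose kernel $k$ is bounded and measurable on $(S\times S,\mathcal S\otimes\mathcal S)$; (iv) $H$ is dense in $C(S)$ and $g\in[C(S),H]_{\beta,\infty}$ with $\|g\|_{\beta,\infty}\le B$, where $\beta\in(0,1)$ and $B>0$. Let $\nu>0$. Assume also that either (R1) $R=[0,\infty)$ and $\hat r$ is a well-defined random variable on $(\Omega,\mathcal F)$, or (R2) $R=\{bi:0\le i\le I-1\}\cup\{an^{1/2}\}$ with $a,b>0$ and $I=\lceil an^{1/2}/b\rceil$. Then there are constants $D_1,D_2>0$, not depending on $n$ or $\tau$, such that the following holds. Let $\tau\ge 80\|k\|_{\mathrm{diag}}^{1/2}\sigma$ and $$t=\left(\frac{\tau}{80\|k\|_{\mathrm{diag}}^{1/2}\sigma}\right)^2\ge 1 .$$ Then $\mathbb P(A_{1,t}\cap A_{2,t})\ge 1-2e^{-t}$, and on the set $A_{1,t}\cap A_{2,t}\in\mathcal F$ we have $$\|V\hat h_{\hat r}-g\|_{L^2(P)}^2\le D_1\tau n^{-\beta/(1+\beta)}+D_2\tau^2 n^{-(1+3\beta)/(2(1+\beta))}.$$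
   Context: Setting. $(S,\mathcal S)$ is a measurable space, with $S$ also a topological space so that $C(S)$, the space of continuous functions on $S$ with the supremum norm, makes sense. $(X_i,Y_i)$, $1\le i\le n$, are i.i.d. $(S\times\mathbb R,\mathcal S\otimes\mathcal B(\mathbb R))$-valued random variables on a probability space $(\Omega,\mathcal F,\mathbb P)$ with $X_i\sim P$ and $\mathbb E(Y_i^2)<\infty$; $g:S\to\mathbb R$ is measurable with $\mathbb E(Y_i\mid X_i)=g(X_i)$ a.s. $P_n$ is the empirical distribution of $X_1,\dots,X_n$, so $\|f\|_{L^2(P_n)}^2=\frac1n\sum_i f(X_i)^2$; $\|\cdot\|_\infty$ is the supremum norm. $U$ is $\sigma^2$-subgaussian given $W$ if $\mathbb E(\exp(sU)\mid W)\le\exp(\sigma^2s^2/2)$ a.s. for all $s\in\mathbb R$. RKHS. $k$ is the reproducing kernel of $H$, $k_x=k(x,\cdot)$, $B_H$ is the closed unit ball of $H$, $\|k\|_{\mathrm{diag}}=\sup_{x\in S}k(x,x)$ (taken positive). Estimators. For $r>0$, $\hat h_r$ is the minimiser of $\frac1n\sum_{i=1}^n(f(X_i)-Y_i)^2$ over $f\in rB_H$, made unique by requiring $\hat h_r\in\mathrm{span}\{k_{X_i}:1\le i\le n\}$; $\hat h_0=0$. $V:\mathbb R\to[-C,C]$ is $V(s)=\max(-C,\min(s,C))$, and $Vf=V\circ f$. For $R\subseteq[0,\infty)$ closed and non-empty and $\tau,\nu>0$, $\hat r$ is the minimiser (the smallest one) over $r\in R$ of $$\sup_{s\in R,\,s\ge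 r}\left(\|\hat h_r-\hat h_s\|_{L^2(P_n)}^2-\frac{\tau(r+s)}{n^{1/2}}\right)+\frac{2(1+\nu)\tau r}{n^{1/2}}.$$ Interpolation space. For a Banach space $(Z,\|\cdot\|_Z)$ with dense subspace $(W,\|\cdot\|_W)$, $K(z,s)=\inf_{w\in W}(\|z-w\|_Z+s\|w\|_W)$ for $s>0$, $\|z\|_{\beta,\infty}=\sup_{s>0}s^{-\beta}K(z,s)$, and $[Z,W]_{\beta,\infty}=\{z\in Z:\|z\|_{\beta,\infty}<\infty\}$. Events. For $t\ge1$, $A_{1,t}$ is the set on which, simultaneously for all $r\ge0$ and all $h_r\in rB_H$, $$\|\hat h_r-h_r\|_{L^2(P_n)}^2\le\frac{20\|k\|_{\mathrm{diag}}^{1/2}\sigma rt^{1/2}}{n^{1/2}}+4\|h_r-g\|_\infty^2 ,$$ and $A_{2,t}$ is the set on which, simultaneously for all $r\ge0$, $$\sup_{f_1,f_2\in rB_H}\left|\|Vf_1-Vf_2\|_{L^2(P_n)}^2-\|Vf_1-Vf_2\|_{L^2(P)}^2\right|\le\frac{97\|k\|_{\mathrm{diag}}^{1/2}Crt^{1/2}}{n^{1/2}}+\frac{8\|k\|_{\mathrm{diag}}^{1/2}Crt}{3n}.$$ *)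

theory Defs
  imports "HOL-Probability.Probability"
begin

section \<open>Reproducing kernel Hilbert spaces\<close>

text \<open>
  A Hilbert space of functions on \<open>S\<close> is given by a Hilbert space type \<open>'h\<close> and an injective map
  \<open>\<iota>\<close> sending an element to the function it stands for.  The functions take values in
  \<open>'s \<Rightarrow>\<^sub>C real\<close>, the bounded continuous functions on \<open>S\<close> with the supremum norm, so \<open>\<iota>\<close> is at the
  same time the inclusion of \<open>H\<close> into \<open>C(S)\<close>.  Linearity of \<open>\<iota>\<close> follows from the reproducing
  property.
\<close>

definition rkhs :: "('h::{real_inner,complete_space} \<Rightarrow> 's::topological_space \<Rightarrow>\<^sub>C real) \<Rightarrow>
    ('s \<Rightarrow> 's \<Rightarrow> real) \<Rightarrow> bool" where
  "rkhs \<iota> k \<longleftrightarrow> inj \<iota> \<and>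
     (\<forall>x. \<exists>kx. apply_bcontfun (\<iota> kx) = k x \<and> (\<forall>f. apply_bcontfun (\<iota> f) x = inner f kx))"

definition diag_norm :: "('s \<Rightarrow> 's \<Rightarrow> real) \<Rightarrow> real" where
  "diag_norm k = (SUP x. k x x)"


section \<open>Interpolation between a space and a subspace\<close>

text \<open>The subspace \<open>W\<close> carries its own norm; \<open>\<iota>\<close> is its inclusion into \<open>Z\<close>.\<close>

definition K_functional :: "('w::real_normed_vector \<Rightarrow> 'z::real_normed_vector) \<Rightarrow> 'z \<Rightarrow> real \<Rightarrow> real"
  where "K_functional \<iota> z s = (INF w. norm (z - \<iota> w) + s * norm w)"

definition interp_norm ::
    "real \<Rightarrow> ('w::real_normed_vector \<Rightarrow> 'z::real_normed_vector) \<Rightarrow> 'z \<Rightarrow> ennreal" where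
  "interp_norm \<beta> \<iota> z = (SUP s\<in>{0<..}. ennreal (s powr (-\<beta>) * K_functional \<iota> z s))"

definition interp_space ::
    "real \<Rightarrow> ('w::real_normed_vector \<Rightarrow> 'z::real_normed_vector) \<Rightarrow> 'z set" where
  "interp_space \<beta> \<iota> = {z. interp_norm \<beta> \<iota> z < \<infinity>}"


section \<open>Regression samples\<close>

definition cond_subgaussian ::
    "'w measure \<Rightarrow> 's measure \<Rightarrow> ('w \<Rightarrow> 's) \<Rightarrow> ('w \<Rightarrow> real) \<Rightarrow> real \<Rightarrow> bool" where
  "cond_subgaussian M N W U v \<longleftrightarrow>
     (\<forall>s::real. AE \<omega> in M.
        nn_cond_exp M (vimage_algebra (space M) W N) (\<lambda>\<omega>. ennreal (exp (s * U \<omega>))) \<omega>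
          \<le> ennreal (exp (v * s\<^sup>2 / 2)))"

text \<open>The measure \<open>P\<close> carries both the \<open>\<sigma>\<close>-algebra of \<open>S\<close> and the law of the covariates.\<close>

definition regression_sample ::
    "'w measure \<Rightarrow> 's measure \<Rightarrow> ('s \<Rightarrow> real) \<Rightarrow> nat \<Rightarrow> (nat \<Rightarrow> 'w \<Rightarrow> 's) \<Rightarrow> (nat \<Rightarrow> 'w \<Rightarrow> real) \<Rightarrow> bool"
  where
  "regression_sample M P g n X Y \<longleftrightarrow>
     prob_space M \<and>
     prob_space.indep_vars M (\<lambda>_. P \<Otimes>\<^sub>M borel) (\<lambda>i \<omega>. (X i \<omega>, Y i \<omega>)) {1..n} \<and>
     (\<forall>i\<in>{1..n}. \<forall>j\<in>{1..n}.
        distr M (P \<Otimes>\<^sub>M borel) (\<lambda>\<omega>. (X i \<omega>, Y i \<omega>)) =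
        distr M (P \<Otimes>\<^sub>M borel) (\<lambda>\<omega>. (X j \<omega>, Y j \<omega>))) \<and>
     (\<forall>i\<in>{1..n}. distr M P (X i) = P \<and>
        integrable M (\<lambda>\<omega>. (Y i \<omega>)\<^sup>2) \<and>
        (AE \<omega> in M. real_cond_exp M (vimage_algebra (space M) (X i) P) (Y i) \<omega> = g (X i \<omega>)))"


section \<open>Estimators\<close>

text \<open>
  The estimators are functions of a realised data set \<open>x 1, \<dots>, x n\<close>, \<open>y 1, \<dots>, y n\<close>.
  \<open>emp_sq n x f\<close> and \<open>pop_sq P f\<close> are the squared norms of \<open>f\<close> in \<open>L\<^sup>2(P\<^sub>n)\<close> and \<open>L\<^sup>2(P)\<close>.
\<close>

definition emp_sq :: "nat \<Rightarrow> (nat \<Rightarrow> 's) \<Rightarrow> ('s \<Rightarrow> real) \<Rightarrow> real" where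
  "emp_sq n x f = (\<Sum>i=1..n. (f (x i))\<^sup>2) / real n"

definition pop_sq :: "'s measure \<Rightarrow> ('s \<Rightarrow> real) \<Rightarrow> real" where
  "pop_sq P f = (\<integral>z. (f z)\<^sup>2 \<partial>P)"

definition emp_risk :: "nat \<Rightarrow> (nat \<Rightarrow> 's) \<Rightarrow> (nat \<Rightarrow> real) \<Rightarrow> ('s \<Rightarrow> real) \<Rightarrow> real" where
  "emp_risk n x y f = (\<Sum>i=1..n. (f (x i) - y i)\<^sup>2) / real n"

definition ls_est :: "('h::{real_inner,complete_space} \<Rightarrow> 's::topological_space \<Rightarrow>\<^sub>C real) \<Rightarrow>
    ('s \<Rightarrow> 's \<Rightarrow> real) \<Rightarrow> nat \<Rightarrow> (nat \<Rightarrow> 's) \<Rightarrow> (nat \<Rightarrow> real) \<Rightarrow> real \<Rightarrow> 'h" where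
  "ls_est \<iota> k n x y r =
     (if r = 0 then 0
      else (THE h. h \<in> cball 0 r \<and>
              (\<forall>f\<in>cball 0 r. emp_risk n x y (\<iota> h) \<le> emp_risk n x y (\<iota> f)) \<and>
              h \<in> span {kx. \<exists>i\<in>{1..n}. apply_bcontfun (\<iota> kx) = k (x i)}))"

definition clip :: "real \<Rightarrow> real \<Rightarrow> real" where
  "clip C s = max (- C) (min s C)"

definition gl_crit :: "('h::{real_inner,complete_space} \<Rightarrow> 's::topological_space \<Rightarrow>\<^sub>C real) \<Rightarrow>
    ('s \<Rightarrow> 's \<Rightarrow> real) \<Rightarrow> real set \<Rightarrow> real \<Rightarrow> real \<Rightarrow> nat \<Rightarrow> (nat \<Rightarrow> 's) \<Rightarrow> (nat \<Rightarrow> real) \<Rightarrow> real \<Rightarrow> real"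
  where
  "gl_crit \<iota> k R \<tau> \<nu> n x y r =
     (SUP s\<in>{s\<in>R. s \<ge> r}.
        emp_sq n x (\<lambda>z. \<iota> (ls_est \<iota> k n x y r) z - \<iota> (ls_est \<iota> k n x y s) z)
        - \<tau> * (r + s) / sqrt (real n))
     + 2 * (1 + \<nu>) * \<tau> * r / sqrt (real n)"

definition gl_minimiser :: "('h::{real_inner,complete_space} \<Rightarrow> 's::topological_space \<Rightarrow>\<^sub>C real) \<Rightarrow>
    ('s \<Rightarrow> 's \<Rightarrow> real) \<Rightarrow> real set \<Rightarrow> real \<Rightarrow> real \<Rightarrow> nat \<Rightarrow> (nat \<Rightarrow> 's) \<Rightarrow> (nat \<Rightarrow> real) \<Rightarrow> real \<Rightarrow> bool"
  where
  "gl_minimiser \<iota> k R \<tau> \<nu> n x y r \<longleftrightarrow>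
     r \<in> R \<and> (\<forall>r'\<in>R. gl_crit \<iota> k R \<tau> \<nu> n x y r \<le> gl_crit \<iota> k R \<tau> \<nu> n x y r')"

definition r_hat :: "('h::{real_inner,complete_space} \<Rightarrow> 's::topological_space \<Rightarrow>\<^sub>C real) \<Rightarrow>
    ('s \<Rightarrow> 's \<Rightarrow> real) \<Rightarrow> real set \<Rightarrow> real \<Rightarrow> real \<Rightarrow> nat \<Rightarrow> (nat \<Rightarrow> 's) \<Rightarrow> (nat \<Rightarrow> real) \<Rightarrow> real"
  where
  "r_hat \<iota> k R \<tau> \<nu> n x y = (LEAST r. gl_minimiser \<iota> k R \<tau> \<nu> n x y r)"

definition r_hat_random_variable ::
    "'w measure \<Rightarrow> ('h::{real_inner,complete_space} \<Rightarrow> 's::topological_space \<Rightarrow>\<^sub>C real) \<Rightarrow>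
     ('s \<Rightarrow> 's \<Rightarrow> real) \<Rightarrow> real set \<Rightarrow> real \<Rightarrow> real \<Rightarrow> nat \<Rightarrow>
     (nat \<Rightarrow> 'w \<Rightarrow> 's) \<Rightarrow> (nat \<Rightarrow> 'w \<Rightarrow> real) \<Rightarrow> bool" where
  "r_hat_random_variable M \<iota> k R \<tau> \<nu> n X Y \<longleftrightarrow>
     (\<forall>\<omega>\<in>space M. \<exists>r. gl_minimiser \<iota> k R \<tau> \<nu> n (\<lambda>i. X i \<omega>) (\<lambda>i. Y i \<omega>) r \<and>
        (\<forall>r'. gl_minimiser \<iota> k R \<tau> \<nu> n (\<lambda>i. X i \<omega>) (\<lambda>i. Y i \<omega>) r' \<longrightarrow> r \<le> r')) \<and>
     (\<lambda>\<omega>. r_hat \<iota> k R \<tau> \<nu> n (\<lambda>i. X i \<omega>) (\<lambda>i. Y i \<omega>)) \<in> borel_measurable M"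

definition radius_grid :: "real \<Rightarrow> real \<Rightarrow> nat \<Rightarrow> real set" where
  "radius_grid a b n =
     {b * real i | i. int i \<le> \<lceil>a * sqrt (real n) / b\<rceil> - 1} \<union> {a * sqrt (real n)}"


section \<open>Events\<close>

definition event_A1 :: "'w measure \<Rightarrow>
    ('h::{real_inner,complete_space} \<Rightarrow> 's::topological_space \<Rightarrow>\<^sub>C real) \<Rightarrow>
    ('s \<Rightarrow> 's \<Rightarrow> real) \<Rightarrow> ('s \<Rightarrow>\<^sub>C real) \<Rightarrow> real \<Rightarrow> nat \<Rightarrow>
    (nat \<Rightarrow> 'w \<Rightarrow> 's) \<Rightarrow> (nat \<Rightarrow> 'w \<Rightarrow> real) \<Rightarrow> real \<Rightarrow> 'w set" where
  "event_A1 M \<iota> k g \<sigma> n X Y t =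
     {\<omega>\<in>space M. \<forall>r\<ge>0. \<forall>h\<in>cball 0 r.
        emp_sq n (\<lambda>i. X i \<omega>)
            (\<lambda>z. \<iota> (ls_est \<iota> k n (\<lambda>i. X i \<omega>) (\<lambda>i. Y i \<omega>) r) z - \<iota> h z)
          \<le> 20 * sqrt (diag_norm k) * \<sigma> * r * sqrt t / sqrt (real n) + 4 * (norm (\<iota> h - g))\<^sup>2}"

definition event_A2 :: "'w measure \<Rightarrow> 's measure \<Rightarrow>
    ('h::{real_inner,complete_space} \<Rightarrow> 's::topological_space \<Rightarrow>\<^sub>C real) \<Rightarrow>
    ('s \<Rightarrow> 's \<Rightarrow> real) \<Rightarrow> real \<Rightarrow> nat \<Rightarrow> (nat \<Rightarrow> 'w \<Rightarrow> 's) \<Rightarrow> real \<Rightarrow> 'w set" where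
  "event_A2 M P \<iota> k C n X t =
     {\<omega>\<in>space M. \<forall>r\<ge>0.
        (SUP (f1, f2)\<in>cball 0 r \<times> cball 0 r.
           \<bar>emp_sq n (\<lambda>i. X i \<omega>) (\<lambda>z. clip C (\<iota> f1 z) - clip C (\<iota> f2 z))
            - pop_sq P (\<lambda>z. clip C (\<iota> f1 z) - clip C (\<iota> f2 z))\<bar>)
          \<le> 97 * sqrt (diag_norm k) * C * r * sqrt t / sqrt (real n)
            + 8 * sqrt (diag_norm k) * C * r * t / (3 * real n)}"

end

theory Submission
  imports Defs
begin

text \<open>
  Both events are reduced to a single random variable each.  For the estimator \<open>h\<^sub>r\<close>, the quantity \<open>\<parallel>h\<^sub>r - h\<parallel>\<^sup>2\<close> is at most
  \<open>4 r \<parallel>S\<parallel> / n + \<parallel>h - g\<parallel>\<^sup>2\<close> with \<open>S = \<Sum>i. (Y\<^sub>i - g X\<^sub>i) k(X\<^sub>i, \<cdot>)\<close>, uniformly in \<open>r\<close>, and the exponential moment of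
  \<open>\<parallel>S\<parallel>\<^sup>2\<close> is bounded one observation at a time.  The deviations of \<open>\<parallel>V f\<^sub>1 - V f\<^sub>2\<parallel>\<^sup>2 / r\<close>, over all radii at once,
  form one empirical process with bounded differences; McDiarmid's inequality concentrates its supremum, and
  symmetrisation with contraction bounds the mean.  The constants leave enough room for no Talagrand
  inequality to be needed.

  On the events, comparing the criterion at its minimiser with its value at a fixed \<open>r\<close> bounds both the
  adaptive radius and the distance of the two estimators by the bias plus \<open>\<tau> r / sqrt n\<close>.  The K-functional bounds the
  squared bias by a multiple of \<open>r\<close> to the power \<open>- 2 \<beta> / (1 - \<beta>)\<close>, and \<open>r\<close> of order \<open>n\<close> to the power
  \<open>(1 - \<beta>) / (2 (1 + \<beta>))\<close> balances the two terms.
\<close>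

section \<open>Normed and Hilbert spaces\<close>

text \<open>The obstacle is that each event speaks of all radii and all functions at once. In
  \<open>event_A1\<close> the variational inequality for a minimiser over a ball removes the
  supremum outright: the noise meets the estimator only through one inner product, whose other
  factor has norm at most 2r. In \<open>event_A2\<close> the deviation must be divided by r before a
  single supremum can be taken, and the quotient has to stay bounded and Lipschitz as r tends to 0:
  of the two factors of the square, one is bounded by the clipping and the other by r, which yields
  a bound linear in r. The process depends nonlinearly on three parameters, a level and two
  functions, hence a contraction with several coordinates. Separability of H and right-continuity of
  the fitted values in r reduce the events to countably many conditions and so make them measurable.
  The number 80 in t serves the selection step: it makes the stochastic error of one estimator
  \<tau> r / (4 sqrt n), so that the squared distance of two estimators has a stochastic part of
  \<tau> (r + s) / (2 sqrt n), half of the penalty in the criterion.\<close>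

lemma closed_subspace_orthogonal_ex:
  fixes L :: "'a::{real_inner,complete_space} set"
  assumes L: "subspace L" "closed L" and x: "x \<notin> L"
  obtains z where "z \<noteq> 0" "\<And>l. l \<in> L \<Longrightarrow> inner z l = 0"
proof -
  have ne: "L \<noteq> {}" using subspace_0[OF L(1)] by blast
  define d where "d = infdist x L"
  have d0: "d \<ge> 0" by (simp add: d_def infdist_nonneg)
  have d_le: "d \<le> norm (x - l)" if "l \<in> L" for l
    using infdist_le[OF that, of x] by (simp add: d_def dist_norm)
  have "\<exists>l\<in>L. norm (x - l) < d + e" if "e > 0" for e
  proof (rule ccontr)
    assume "\<not> ?thesis"
    hence "\<And>l. l \<in> L \<Longrightarrow> d + e \<le> dist x l" by (auto simp: dist_norm not_less)
    hence "d + e \<le> infdist x L"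
      unfolding infdist_def using ne by (auto intro!: cINF_greatest)
    thus False using that by (simp add: d_def)
  qed
  hence "\<forall>n::nat. \<exists>l\<in>L. norm (x - l) < d + 1 / real (Suc n)" by simp
  then obtain l where l: "\<And>n::nat. l n \<in> L" "\<And>n. norm (x - l n) < d + 1 / real (Suc n)"
    by metis
  have sq: "(norm (x - l n))\<^sup>2 \<le> d\<^sup>2 + (2 * d + 1) / real (Suc n)" for n
  proof -
    have "(norm (x - l n))\<^sup>2 \<le> (d + 1 / real (Suc n))\<^sup>2"
      using l(2)[of n] by (intro power_mono) auto
    also have "\<dots> = d\<^sup>2 + 2 * d / real (Suc n) + (1 / real (Suc n)) * (1 / real (Suc n))"
      by (simp add: power2_eq_square algebra_simps)
    also have "(1 / real (Suc n)) * (1 / real (Suc n)) \<le> 1 * (1 / real (Suc n))"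
      by (intro mult_right_mono) auto
    finally show ?thesis by (simp add: add_divide_distrib)
  qed
  \<comment> \<open>The midpoint of two near-minimisers lies in L, hence is no closer to x than d;
    the parallelogram law then forces the two points together.\<close>
  have par: "(norm (l n - l m))\<^sup>2 \<le> 2 * ((2 * d + 1) / real (Suc n)) + 2 * ((2 * d + 1) / real (Suc m))"
    for n m
  proof -
    have "(1/2) *\<^sub>R (l n + l m) \<in> L"
      by (intro subspace_mul subspace_add L l)
    hence "d\<^sup>2 \<le> (norm (x - (1/2) *\<^sub>R (l n + l m)))\<^sup>2"
      using d_le d0 by (intro power_mono) auto
    moreover have "(norm (l n - l m))\<^sup>2 + 4 * (norm (x - (1/2) *\<^sub>R (l n + l m)))\<^sup>2 =
       2 * (norm (x - l n))\<^sup>2 + 2 * (norm (x - l m))\<^sup>2"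
      unfolding power2_norm_eq_inner
      by (simp add: inner_simps inner_commute algebra_simps)
    ultimately show ?thesis using sq[of n] sq[of m] by linarith
  qed
  have "Cauchy l"
    unfolding Cauchy_def
  proof (intro allI impI)
    fix e :: real assume e: "e > 0"
    obtain N :: nat where N: "4 * (2 * d + 1) / e\<^sup>2 < real N" using reals_Archimedean2 by blast
    show "\<exists>M. \<forall>m\<ge>M. \<forall>n\<ge>M. dist (l m) (l n) < e"
    proof (intro exI allI impI)
      fix m n assume mn: "N \<le> m" "N \<le> n"
      have b: "(2 * d + 1) / real (Suc p) < e\<^sup>2 / 4" if "N \<le> p" for p
      proof -
        have "4 * (2 * d + 1) < e\<^sup>2 * real N" using N e by (simp add: field_simps)
        also have "\<dots> \<le> e\<^sup>2 * real (Suc p)" using that by (intro mult_left_mono) auto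
        finally show ?thesis by (simp add: field_simps)
      qed
      have "(norm (l m - l n))\<^sup>2 < e\<^sup>2"
        using par[of m n] b[OF mn(1)] b[OF mn(2)] by linarith
      thus "dist (l m) (l n) < e" using e by (simp add: dist_norm power2_less_imp_less)
    qed
  qed
  then obtain p where p: "l \<longlonglongrightarrow> p" using Cauchy_convergent_iff convergent_def by blast
  have pL: "p \<in> L" using L(2) l(1) p closed_sequentially by blast
  have "norm (x - p) \<le> d"
  proof (rule LIMSEQ_le)
    show "(\<lambda>n. norm (x - l n)) \<longlonglongrightarrow> norm (x - p)" by (intro tendsto_intros p)
    have "(\<lambda>n. d + 1 / real (Suc n)) \<longlonglongrightarrow> d + 0"
      by (intro tendsto_intros LIMSEQ_Suc[OF lim_1_over_n])
    thus "(\<lambda>n. d + 1 / real (Suc n)) \<longlonglongrightarrow> d" by simp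
    show "\<exists>N. \<forall>n\<ge>N. norm (x - l n) \<le> d + 1 / real (Suc n)" using l(2) less_imp_le by blast
  qed
  define z where "z = x - p"
  have "inner z a = 0" if a: "a \<in> L" for a
  proof (cases "a = 0")
    case False
    \<comment> \<open>The step along a that would reduce the distance most; since p is already
      nearest, the reduction (inner z a)^2 / inner a a must vanish.\<close>
    define t where "t = inner z a / inner a a"
    have "p + t *\<^sub>R a \<in> L" by (intro subspace_add subspace_mul L pL a)
    hence "norm z \<le> norm (z - t *\<^sub>R a)"
      using d_le[of "p + t *\<^sub>R a"] \<open>norm (x - p) \<le> d\<close> by (simp add: z_def algebra_simps)
    hence "(norm z)\<^sup>2 \<le> (norm (z - t *\<^sub>R a))\<^sup>2" by (intro power_mono) auto
    hence "(norm z)\<^sup>2 \<le> (norm z)\<^sup>2 - 2 * (t * inner z a) + t * t * inner a a"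
      unfolding power2_norm_eq_inner by (simp add: inner_simps inner_commute algebra_simps)
    moreover have "t * t * inner a a = t * inner z a" using False by (simp add: t_def)
    ultimately have "t * inner z a \<le> 0" by simp
    hence "(inner z a)\<^sup>2 / inner a a \<le> 0" by (simp add: t_def power2_eq_square)
    moreover have "inner a a > 0" using False by simp
    ultimately have "(inner z a)\<^sup>2 \<le> 0" by (simp add: divide_le_0_iff)
    thus ?thesis by simp
  qed simp
  moreover have "z \<noteq> 0" using pL x by (auto simp: z_def)
  ultimately show ?thesis using that by blast
qed

text \<open>The ambient space may be infinite-dimensional, so compactness is obtained in
  coordinates: with respect to an orthogonal spanning set the ball sits inside a finite sum of
  compact segments, of which it is a closed part.\<close>

lemma compact_span_cball:
  fixes S :: "'a::real_inner set"
  assumes "finite S"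
  shows "compact (span S \<inter> cball 0 r)"
proof -
  obtain C where C: "finite C" "span C = span S" "pairwise orthogonal C"
    using basis_orthogonal[OF assms] by blast
  define box where "box D = {\<Sum>c\<in>D. a c *\<^sub>R c | a. \<forall>c\<in>D. \<bar>a c\<bar> \<le> r / norm c}" for D :: "'a set"
  have comp: "compact (box D)" if "finite D" for D
    using that
  proof induction
    case empty thus ?case by (auto simp: box_def)
  next
    case (insert d D)
    have "box (insert d D) = {x + y | x y. x \<in> (\<lambda>s. s *\<^sub>R d) ` {- (r / norm d)..r / norm d} \<and> y \<in> box D}"
      (is "_ = ?B")
    proof (intro equalityI subsetI)
      fix v assume "v \<in> box (insert d D)"
      then obtain a where "v = (\<Sum>c\<in>insert d D. a c *\<^sub>R c)" "\<forall>c\<in>insert d D. \<bar>a c\<bar> \<le> r / norm c"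
        by (auto simp: box_def)
      hence "v = a d *\<^sub>R d + (\<Sum>c\<in>D. a c *\<^sub>R c)" "a d \<in> {- (r / norm d)..r / norm d}"
        "(\<Sum>c\<in>D. a c *\<^sub>R c) \<in> box D" using insert.hyps
        by (auto simp: box_def)
      thus "v \<in> ?B" by blast
    next
      fix v assume "v \<in> ?B"
      then obtain s y where s: "s \<in> {- (r / norm d)..r / norm d}" and y: "y \<in> box D"
        and vy: "v = s *\<^sub>R d + y"
        by blast
      then obtain a where a: "\<forall>c\<in>D. \<bar>a c\<bar> \<le> r / norm c" and v: "v = s *\<^sub>R d + (\<Sum>c\<in>D. a c *\<^sub>R c)"
        by (auto simp: box_def)
      have "(\<Sum>c\<in>D. (a(d := s)) c *\<^sub>R c) = (\<Sum>c\<in>D. a c *\<^sub>R c)"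
        using insert.hyps by (intro sum.cong) auto
      hence "v = (\<Sum>c\<in>insert d D. (a(d := s)) c *\<^sub>R c)"
        using insert.hyps v by simp
      moreover have "\<forall>c\<in>insert d D. \<bar>(a(d := s)) c\<bar> \<le> r / norm c"
        using s a by auto
      ultimately show "v \<in> box (insert d D)" unfolding box_def by blast
    qed
    moreover have "compact ?B"
      by (rule compact_sums[OF compact_continuous_image[OF _ compact_Icc] insert.IH]) (intro continuous_intros)
    ultimately show ?case by simp
  qed
  have sub: "span S \<inter> cball 0 r \<subseteq> box C"
  proof
    fix v assume v: "v \<in> span S \<inter> cball 0 r"
    then obtain a where a: "v = (\<Sum>c\<in>C. a c *\<^sub>R c)"
      using C(2) span_finite[OF C(1)] by auto
    \<comment> \<open>The orthogonal set may contain 0, where the box allows only the coefficient r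
      / norm 0 = 0; the coefficient there is free and is reset to 0.\<close>
    define b where "b c = (if c = 0 then 0 else a c)" for c
    have vb: "v = (\<Sum>c\<in>C. b c *\<^sub>R c)" unfolding a by (intro sum.cong) (auto simp: b_def)
    have "\<bar>b c\<bar> \<le> r / norm c" if c: "c \<in> C" for c
    proof (cases "c = 0")
      case False
      have "inner v c = (\<Sum>d\<in>C. b d * inner d c)" unfolding vb by (simp add: inner_sum_left)
      also have "\<dots> = (\<Sum>d\<in>C. if d = c then b c * inner c c else 0)"
        using C(3) c by (intro sum.cong) (auto simp: pairwise_def orthogonal_def)
      also have "\<dots> = b c * (norm c)\<^sup>2" using C(1) c by (simp add: power2_norm_eq_inner)
      finally have "\<bar>b c\<bar> * (norm c)\<^sup>2 \<le> norm v * norm c"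
        using Cauchy_Schwarz_ineq2[of v c] by (simp add: abs_mult)
      also have "\<dots> \<le> r * norm c" using v by (intro mult_right_mono) auto
      finally show ?thesis using False by (simp add: field_simps power2_eq_square)
    qed (use v in \<open>simp add: b_def\<close>)
    thus "v \<in> box C" unfolding box_def vb by blast
  qed
  have "box C \<subseteq> span S"
  proof
    fix v assume "v \<in> box C"
    then obtain a where v: "v = (\<Sum>c\<in>C. a c *\<^sub>R c)" by (auto simp: box_def)
    show "v \<in> span S" unfolding C(2)[symmetric] v by (intro span_sum span_mul span_base)
  qed
  hence "span S \<inter> cball 0 r = box C \<inter> cball 0 r" using sub by blast
  thus ?thesis using compact_Int_closed[OF comp[OF C(1)] closed_cball] by simp
qed

text \<open>Orthogonal projection by Fourier coefficients; a zero vector in the orthogonal set does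
  no harm, its coefficient being a division by zero, that is 0. It serves to replace any function by
  one in the span of the features at the data, with the same fitted values and no larger
  norm.\<close>

lemma span_orthogonal_decomp:
  fixes S :: "'a::real_inner set"
  assumes "finite S"
  obtains y where "y \<in> span S" "\<And>w. w \<in> span S \<Longrightarrow> inner (x - y) w = 0" "norm y \<le> norm x"
proof -
  obtain C where C: "finite C" "span C = span S" "pairwise orthogonal C"
    using basis_orthogonal[OF assms] by blast
  define y where "y = (\<Sum>c\<in>C. (inner x c / inner c c) *\<^sub>R c)"
  have y: "y \<in> span S" unfolding C(2)[symmetric] y_def by (intro span_sum span_mul span_base)
  have c0: "inner (x - y) c = 0" if c: "c \<in> C" for c
  proof -
    have "inner y c = (\<Sum>d\<in>C. (inner x d / inner d d) * inner d c)"
      unfolding y_def by (simp add: inner_sum_left)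
    also have "\<dots> = (\<Sum>d\<in>C. if d = c then inner x c else 0)"
      using C(3) c by (intro sum.cong) (auto simp: pairwise_def orthogonal_def)
    finally show ?thesis using C(1) c by (simp add: inner_simps)
  qed
  have w0: "inner (x - y) w = 0" if w: "w \<in> span S" for w
  proof -
    obtain a where a: "w = (\<Sum>c\<in>C. a c *\<^sub>R c)"
      using C(2) span_finite[OF C(1)] w by auto
    show ?thesis unfolding a using c0 by (simp add: inner_sum_right)
  qed
  have "(norm x)\<^sup>2 = (norm (x - y))\<^sup>2 + 2 * inner (x - y) y + (norm y)\<^sup>2"
    unfolding power2_norm_eq_inner by (simp add: inner_simps inner_commute)
  hence "(norm y)\<^sup>2 \<le> (norm x)\<^sup>2" using w0[OF y] by simp
  hence "norm y \<le> norm x" by (rule power2_le_imp_le) simp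
  thus ?thesis using that y w0 by blast
qed

text \<open>Points of the dense sequence near h may fall outside the ball. So h is first shrunk
  towards 0, into the open ball, and approximated there with an error smaller than the remaining
  margin.\<close>

lemma ball_sequence:
  fixes d :: "nat \<Rightarrow> 'a::real_normed_vector"
  assumes d: "\<And>h e. e > 0 \<Longrightarrow> \<exists>j. dist (d j) h < e" and r: "r > 0" and h: "h \<in> cball 0 r"
  obtains j :: "nat \<Rightarrow> nat" where "\<And>m. norm (d (j m)) \<le> r" "(\<lambda>m. d (j m)) \<longlonglongrightarrow> h"
proof -
  define u where "u m = (1 - 1 / real (Suc m)) *\<^sub>R h" for m
  have nu: "norm (u m) < r" for m
  proof -
    have c: "0 \<le> 1 - 1 / real (Suc m)" "1 - 1 / real (Suc m) < 1" by auto
    have "norm (u m) = (1 - 1 / real (Suc m)) * norm h" using c by (simp add: u_def)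
    also have "\<dots> \<le> (1 - 1 / real (Suc m)) * r" using h c by (intro mult_left_mono) auto
    also have "\<dots> < 1 * r" using c r by (intro mult_strict_right_mono) auto
    finally show ?thesis by simp
  qed
  have "\<exists>j. dist (d j) (u m) < min (1 / real (Suc m)) (r - norm (u m))" for m
    using nu[of m] by (intro d) auto
  then obtain j where j: "\<And>m. dist (d (j m)) (u m) < min (1 / real (Suc m)) (r - norm (u m))" by metis
  have 1: "norm (d (j m)) \<le> r" for m
  proof -
    have "norm (d (j m)) \<le> norm (u m) + norm (d (j m) - u m)"
      using norm_triangle_ineq[of "u m" "d (j m) - u m"] by simp
    thus ?thesis using j[of m] by (simp add: dist_norm)
  qed
  have z: "(\<lambda>m. 1 / real (Suc m)) \<longlonglongrightarrow> 0" by (rule LIMSEQ_Suc[OF lim_1_over_n])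
  have "(\<lambda>m. d (j m) - u m) \<longlonglongrightarrow> 0"
    by (rule Lim_null_comparison[OF _ z]) (use j in \<open>auto intro!: always_eventually less_imp_le simp: dist_norm\<close>)
  moreover have "u \<longlonglongrightarrow> (1 - 0) *\<^sub>R h" unfolding u_def by (intro tendsto_intros z)
  ultimately have "(\<lambda>m. d (j m)) \<longlonglongrightarrow> h" using tendsto_add by fastforce
  with 1 show ?thesis using that by blast
qed

text \<open>Instead of shrinking h, the radius grows through rationals. This also covers r = 0,
  where there is no interior to shrink into, and one sequence of radii serves all h in the
  ball.\<close>

lemma radius_sequence:
  fixes d :: "nat \<Rightarrow> 'a::real_normed_vector"
  assumes d: "\<And>h e. e > 0 \<Longrightarrow> \<exists>j. dist (d j) h < e" and r: "r \<ge> 0"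
  obtains q :: "nat \<Rightarrow> rat" where "\<And>m. of_rat (q m) > r" "(\<lambda>m. of_rat (q m) :: real) \<longlonglongrightarrow> r"
    "\<And>h. h \<in> cball 0 r \<Longrightarrow> \<exists>j. (\<forall>m. norm (d (j m)) \<le> of_rat (q m)) \<and> (\<lambda>m. d (j m)) \<longlonglongrightarrow> h"
proof -
  have z: "(\<lambda>m. 1 / real (Suc m)) \<longlonglongrightarrow> 0" by (rule LIMSEQ_Suc[OF lim_1_over_n])
  have "\<exists>q. r < of_rat q \<and> of_rat q < r + 1 / real (Suc m)" for m
    by (rule of_rat_dense) simp
  then obtain q where q: "\<And>m. r < of_rat (q m)" "\<And>m. of_rat (q m) < r + 1 / real (Suc m)" by metis
  have "norm (of_rat (q m) - r) \<le> 1 / real (Suc m)" for m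
    using q(1)[of m] q(2)[of m] by (simp del: of_nat_Suc)
  hence "(\<lambda>m. of_rat (q m) - r) \<longlonglongrightarrow> 0"
    by (intro Lim_null_comparison[OF _ z] always_eventually allI)
  hence 2: "(\<lambda>m. of_rat (q m)) \<longlonglongrightarrow> r" by (rule LIM_zero_cancel)
  have 3: "\<exists>j. (\<forall>m. norm (d (j m)) \<le> of_rat (q m)) \<and> (\<lambda>m. d (j m)) \<longlonglongrightarrow> h" if h: "h \<in> cball 0 r" for h
  proof -
    have "\<exists>j. dist (d j) h < min (1 / real (Suc m)) (of_rat (q m) - r)" for m
      using q(1)[of m] by (intro d) auto
    then obtain j where j: "\<And>m. dist (d (j m)) h < min (1 / real (Suc m)) (of_rat (q m) - r)" by metis
    have "norm (d (j m)) \<le> of_rat (q m)" for m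
    proof -
      have "norm (d (j m)) \<le> norm h + norm (d (j m) - h)"
        using norm_triangle_ineq[of h "d (j m) - h"] by simp
      thus ?thesis using j[of m] h by (simp add: dist_norm)
    qed
    moreover have "(\<lambda>m. d (j m) - h) \<longlonglongrightarrow> 0"
      by (rule Lim_null_comparison[OF _ z]) (use j in \<open>auto intro!: always_eventually less_imp_le simp: dist_norm\<close>)
    hence "(\<lambda>m. d (j m)) \<longlonglongrightarrow> h" by (rule LIM_zero_cancel)
    ultimately show ?thesis by blast
  qed
  show ?thesis using that[OF q(1) 2 3] .
qed

section \<open>Clipping\<close>

lemma abs_clip_le: "c \<ge> 0 \<Longrightarrow> \<bar>clip c a\<bar> \<le> c"
  by (auto simp: clip_def)

lemma abs_clip_diff_le: "\<bar>clip c a - clip c b\<bar> \<le> \<bar>a - b\<bar>"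
  by (auto simp: clip_def max_def min_def)

lemma clip_eq: "\<bar>a\<bar> \<le> c \<Longrightarrow> clip c a = a"
  by (auto simp: clip_def)

lemma clip_scale: "r > 0 \<Longrightarrow> clip (r * c) (r * a) = r * clip c a"
  by (simp add: clip_def max_mult_distrib_left min_mult_distrib_left)

lemma abs_clip_clip_le: "C \<ge> 0 \<Longrightarrow> \<bar>clip C a - clip C b\<bar> \<le> 2 * C"
  using abs_clip_le[of C a] abs_clip_le[of C b] by linarith

lemma clip_sq_le: "C \<ge> 0 \<Longrightarrow> (clip C a - clip C b)\<^sup>2 \<le> 4 * C\<^sup>2"
  using power_mono[OF abs_clip_clip_le[of C a b], of 2] by (simp add: power_mult_distrib)

lemma tendsto_clip [tendsto_intros]: "(f \<longlongrightarrow> l) F \<Longrightarrow> ((\<lambda>z. clip C (f z)) \<longlongrightarrow> clip C l) F"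
  unfolding clip_def by (intro tendsto_intros)

lemma clip_measurable [measurable]: "clip c \<in> borel_measurable borel"
  unfolding clip_def by measurable

text \<open>
  With \<open>c = C / r\<close> the quotient \<open>C * clip_quot c (f\<^sub>1 / r) (f\<^sub>2 / r)\<close> equals
  \<open>(V f\<^sub>1 - V f\<^sub>2)\<^sup>2 / r\<close>.  It is Lipschitz in the clipping level as well, so that the supremum over
  all radii becomes a supremum over bounded parameters.
\<close>

definition clip_quot :: "real \<Rightarrow> real \<Rightarrow> real \<Rightarrow> real" where
  "clip_quot c a b = (clip c a - clip c b)\<^sup>2 / c"

lemma clip_quot_nonneg: "c > 0 \<Longrightarrow> clip_quot c a b \<ge> 0"
  by (simp add: clip_quot_def)

text \<open>One factor of the square is bounded by 2c, which cancels the denominator, the other by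
  2m; hence the bound is uniform in the level c.\<close>

lemma clip_quot_le:
  assumes "c > 0" "\<bar>a\<bar> \<le> m" "\<bar>b\<bar> \<le> m"
  shows "clip_quot c a b \<le> 4 * m"
proof -
  have "\<bar>clip c a - clip c b\<bar> \<le> 2 * c"
    using abs_clip_le[of c a] abs_clip_le[of c b] assms by linarith
  moreover have "\<bar>clip c a - clip c b\<bar> \<le> 2 * m"
    using abs_clip_diff_le[of c a b] assms by linarith
  ultimately have "\<bar>clip c a - clip c b\<bar> * \<bar>clip c a - clip c b\<bar> \<le> (2 * c) * (2 * m)"
    by (intro mult_mono) auto
  thus ?thesis using assms by (simp add: clip_quot_def power2_eq_square abs_mult_self_eq field_simps)
qed

text \<open>In u^2 - v^2 = (u + v)(u - v) the sum is at most 4c by clipping and cancels the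
  denominator.\<close>

lemma clip_quot_lipschitz_arg:
  assumes "c > 0"
  shows "\<bar>clip_quot c a b - clip_quot c a' b'\<bar> \<le> 4 * (\<bar>a - a'\<bar> + \<bar>b - b'\<bar>)"
proof -
  let ?u = "clip c a - clip c b" and ?v = "clip c a' - clip c b'"
  have s: "\<bar>?u + ?v\<bar> \<le> 4 * c"
    using abs_clip_le[of c a] abs_clip_le[of c b] abs_clip_le[of c a'] abs_clip_le[of c b'] assms
    by linarith
  have d: "\<bar>?u - ?v\<bar> \<le> \<bar>a - a'\<bar> + \<bar>b - b'\<bar>"
    using abs_clip_diff_le[of c a a'] abs_clip_diff_le[of c b b'] by linarith
  have "\<bar>?u\<^sup>2 - ?v\<^sup>2\<bar> = \<bar>?u + ?v\<bar> * \<bar>?u - ?v\<bar>"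
    by (simp add: abs_mult[symmetric] power2_eq_square algebra_simps)
  also have "\<dots> \<le> (4 * c) * (\<bar>a - a'\<bar> + \<bar>b - b'\<bar>)" using s d by (intro mult_mono) auto
  finally have "\<bar>?u\<^sup>2 - ?v\<^sup>2\<bar> / c \<le> 4 * (\<bar>a - a'\<bar> + \<bar>b - b'\<bar>)"
    using assms by (simp add: field_simps)
  moreover have "\<bar>?u\<^sup>2 - ?v\<^sup>2\<bar> / c = \<bar>clip_quot c a b - clip_quot c a' b'\<bar>"
    using assms by (simp add: clip_quot_def diff_divide_distrib[symmetric])
  ultimately show ?thesis by simp
qed

text \<open>By symmetry in the levels and in the arguments it suffices to treat c \<le> c' and b
  \<le> a. Raising the level by d then increases the clipped difference by between 0 and 2d.\<close>

lemma clip_quot_lipschitz_level: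
  assumes "c > 0" "c' > 0"
  shows "\<bar>clip_quot c a b - clip_quot c' a b\<bar> \<le> 4 * \<bar>c - c'\<bar>"
proof -
  have *: "\<bar>clip_quot c a b - clip_quot c' a b\<bar> \<le> 4 * \<bar>c - c'\<bar>"
    if c: "0 < c" "c \<le> c'" and ab: "b \<le> a" for c c' a b :: real
  proof -
    define u v d where "u = clip c a - clip c b" and "v = clip c' a - clip c' b" and "d = c' - c"
    have u0: "0 \<le> u" using ab by (auto simp: clip_def u_def)
    have u2: "u \<le> 2 * c" using abs_clip_le[of c a] abs_clip_le[of c b] c unfolding u_def by linarith
    have uv: "u \<le> v" using ab c by (auto simp: clip_def max_def min_def u_def v_def)
    have vu: "v \<le> u + 2 * d" using ab c by (auto simp: clip_def max_def min_def u_def v_def d_def)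
    have d: "d \<ge> 0" "c' = c + d" using c by (auto simp: d_def)
    have "v\<^sup>2 / c' \<le> (u + 2 * d)\<^sup>2 / c'" using u0 uv vu c by (intro divide_right_mono power_mono) auto
    also have "\<dots> \<le> u\<^sup>2 / c + 4 * d"
    proof -
      \<comment> \<open>This is exactly the difference of the two sides of the next
        inequality.\<close>
      have "0 \<le> d * (u - 2 * c)\<^sup>2" using d by simp
      hence "(u + 2 * d)\<^sup>2 * c \<le> (u\<^sup>2 + 4 * d * c) * (c + d)"
        by (simp add: power2_eq_square algebra_simps)
      thus ?thesis using c d by (simp add: field_simps)
    qed
    finally have 1: "v\<^sup>2 / c' - u\<^sup>2 / c \<le> 4 * d" by simp
    have "u\<^sup>2 / c - v\<^sup>2 / c' \<le> u\<^sup>2 / c - u\<^sup>2 / c'"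
      using u0 uv c by (intro diff_left_mono divide_right_mono power_mono) auto
    also have "\<dots> = (u\<^sup>2 / c) * (d / c')" using c d by (simp add: field_simps)
    also have "\<dots> \<le> ((2 * c)\<^sup>2 / c) * (d / c')"
      using u0 u2 c d by (intro mult_right_mono divide_right_mono power_mono) auto
    also have "(2 * c)\<^sup>2 / c * (d / c') = 4 * d * (c / c')" using c by (simp add: power2_eq_square)
    also have "\<dots> \<le> 4 * d * 1" using c d by (intro mult_left_mono) auto
    finally have 2: "u\<^sup>2 / c - v\<^sup>2 / c' \<le> 4 * d" by simp
    have eq: "clip_quot c a b = u\<^sup>2 / c" "clip_quot c' a b = v\<^sup>2 / c'" "\<bar>c - c'\<bar> = d"
      using d by (auto simp: clip_quot_def u_def v_def)
    show ?thesis unfolding eq using 1 2 by (intro abs_leI) auto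
  qed
  have sym: "clip_quot c a b = clip_quot c b a" for c a b
    by (simp add: clip_quot_def power2_commute)
  show ?thesis
    using *[of c c' a b] *[of c c' b a] *[of c' c a b] *[of c' c b a] assms
    by (cases "c \<le> c'"; cases "b \<le> a") (auto simp: sym[of _ b a] abs_minus_commute)
qed

section \<open>Kernels\<close>

locale bounded_rkhs =
  fixes \<iota> :: "'h::{real_inner,complete_space} \<Rightarrow> 's::topological_space \<Rightarrow>\<^sub>C real"
    and k :: "'s \<Rightarrow> 's \<Rightarrow> real"
  assumes rkhs: "rkhs \<iota> k" and bdd: "bounded (range (case_prod k))" and diag_pos: "diag_norm k > 0"
begin

text \<open>The canonical feature map, x to k_x as an element of \<open>'h\<close>. The choice is
  unambiguous because \<open>\<iota>\<close> is injective.\<close>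

definition feat :: "'s \<Rightarrow> 'h" where
  "feat x = (SOME h. apply_bcontfun (\<iota> h) = k x \<and> (\<forall>f. apply_bcontfun (\<iota> f) x = inner f h))"

lemma feat: "apply_bcontfun (\<iota> (feat x)) = k x" "apply_bcontfun (\<iota> f) x = inner f (feat x)"
proof -
  have "\<exists>h. apply_bcontfun (\<iota> h) = k x \<and> (\<forall>f. apply_bcontfun (\<iota> f) x = inner f h)"
    using rkhs by (auto simp: rkhs_def)
  from someI_ex[OF this, folded feat_def]
  show "apply_bcontfun (\<iota> (feat x)) = k x" "apply_bcontfun (\<iota> f) x = inner f (feat x)"
    by blast+
qed

lemma inner_feat: "inner (feat x) (feat y) = k x y"
  using feat(2)[of "feat x" y] by (simp add: feat(1))

lemma \<iota>_eqI: "apply_bcontfun (\<iota> f) = apply_bcontfun (\<iota> h) \<Longrightarrow> f = h"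
  using rkhs unfolding rkhs_def apply_bcontfun_inject by (blast dest: injD)

lemma eq_feat_iff: "apply_bcontfun (\<iota> h) = k x \<longleftrightarrow> h = feat x"
  using \<iota>_eqI[of h "feat x"] feat(1)[of x] by auto

lemma feat_separating:
  assumes "\<And>x. inner h (feat x) = 0" shows "h = 0"
  by (rule \<iota>_eqI) (simp add: fun_eq_iff feat(2) assms)

lemma diag_le: "k x x \<le> diag_norm k"
proof -
  obtain c where c: "\<And>x y. norm (k x y) \<le> c"
    using bdd unfolding bounded_iff by fast
  have "k x x \<le> c" for x using c[of x x] by simp
  hence "bdd_above (range (\<lambda>x. k x x))" by (rule bdd_aboveI2)
  thus ?thesis unfolding diag_norm_def by (rule cSUP_upper[OF UNIV_I])
qed

lemma norm_feat_sq: "(norm (feat x))\<^sup>2 = k x x"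
  by (simp add: power2_norm_eq_inner inner_feat)

lemma norm_feat_sq_le: "(norm (feat x))\<^sup>2 \<le> diag_norm k"
  using diag_le by (simp add: norm_feat_sq)

lemma norm_feat_le: "norm (feat x) \<le> sqrt (diag_norm k)"
  using norm_feat_sq_le by (rule real_le_rsqrt)

lemma abs_eval_le: "\<bar>\<iota> h x\<bar> \<le> norm h * sqrt (diag_norm k)"
  unfolding feat(2)
  by (rule order_trans[OF Cauchy_Schwarz_ineq2 mult_left_mono[OF norm_feat_le norm_ge_zero]])

lemma eval_diff: "\<iota> (f - h) x = \<iota> f x - \<iota> h x" by (simp add: feat(2) inner_simps)
lemma eval_add: "\<iota> (f + h) x = \<iota> f x + \<iota> h x" by (simp add: feat(2) inner_simps)
lemma eval_scale: "\<iota> (c *\<^sub>R h) x = c * \<iota> h x" by (simp add: feat(2))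
lemma eval_zero [simp]: "\<iota> 0 x = 0" by (simp add: feat(2))

lemma abs_eval_diff_le: "\<bar>\<iota> f x - \<iota> h x\<bar> \<le> norm (f - h) * sqrt (diag_norm k)"
  using abs_eval_le[of "f - h" x] by (simp add: eval_diff)

lemma continuous_eval [continuous_intros]:
  "continuous_on A f \<Longrightarrow> continuous_on A (\<lambda>z. \<iota> (f z) x)"
  unfolding feat(2) by (intro continuous_intros)

lemma tendsto_eval [tendsto_intros]: "(f \<longlongrightarrow> l) F \<Longrightarrow> ((\<lambda>z. \<iota> (f z) x) \<longlongrightarrow> \<iota> l x) F"
  unfolding feat(2) by (intro tendsto_intros)

lemma norm_\<iota>_diff_le: "norm (\<iota> f - \<iota> h) \<le> norm (f - h) * sqrt (diag_norm k)"
  by (rule norm_bound) (simp add: abs_eval_diff_le)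

lemma tendsto_\<iota> [tendsto_intros]:
  assumes "(f \<longlongrightarrow> l) F" shows "((\<lambda>z. \<iota> (f z)) \<longlongrightarrow> \<iota> l) F"
proof -
  have "((\<lambda>z. norm (f z - l) * sqrt (diag_norm k)) \<longlongrightarrow> norm (l - l) * sqrt (diag_norm k)) F"
    by (intro tendsto_intros assms)
  hence "((\<lambda>z. norm (f z - l) * sqrt (diag_norm k)) \<longlongrightarrow> 0) F" by simp
  from Lim_null_comparison[OF _ this, of "\<lambda>z. \<iota> (f z) - \<iota> l"]
  have "((\<lambda>z. \<iota> (f z) - \<iota> l) \<longlongrightarrow> 0) F" using norm_\<iota>_diff_le by (simp add: eventuallyI)
  thus ?thesis by (rule LIM_zero_cancel)
qed

end

section \<open>Measurable kernels on a probability space\<close>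

locale measurable_rkhs = bounded_rkhs \<iota> k + prob_space P
  for \<iota> :: "'h::{real_inner,complete_space} \<Rightarrow> 's::topological_space \<Rightarrow>\<^sub>C real" and k
    and P :: "'s measure" +
  assumes k_meas: "case_prod k \<in> borel_measurable (P \<Otimes>\<^sub>M P)"
    and space_P: "space P = UNIV"
    and sep: "separable_space (euclidean :: 'h topology)"
begin

text \<open>The elements with measurable functions form a closed subspace that contains every
  feature, since sections of k are measurable. If it were proper, a nonzero element orthogonal to it
  would vanish at every point.\<close>

lemma eval_measurable [measurable]: "apply_bcontfun (\<iota> h) \<in> borel_measurable P"
proof -
  define L where "L = {h. apply_bcontfun (\<iota> h) \<in> borel_measurable P}"
  have "apply_bcontfun (\<iota> 0) = (\<lambda>x. 0)"
    "\<And>f h. apply_bcontfun (\<iota> (f + h)) = (\<lambda>x. \<iota> f x + \<iota> h x)"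
    "\<And>c h. apply_bcontfun (\<iota> (c *\<^sub>R h)) = (\<lambda>x. c * \<iota> h x)"
    by (simp_all add: fun_eq_iff eval_add eval_scale)
  hence sub: "subspace L"
    unfolding subspace_def L_def by auto
  have cl: "closed L"
  proof (rule closed_sequential_limits[THEN iffD2, rule_format])
    fix f l assume fl: "(\<forall>n. f n \<in> L) \<and> f \<longlonglongrightarrow> l"
    show "l \<in> L" unfolding L_def mem_Collect_eq
    proof (rule borel_measurable_LIMSEQ_real)
      show "(\<lambda>n. \<iota> (f n) x) \<longlonglongrightarrow> \<iota> l x" for x using fl by (intro tendsto_eval) blast
      show "apply_bcontfun (\<iota> (f n)) \<in> borel_measurable P" for n using fl by (simp add: L_def)
    qed
  qed
  have fL: "feat x \<in> L" for x
    using k_meas measurable_Pair2[of "case_prod k" P P borel x]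
    by (simp add: L_def feat(1) space_P)
  have "h \<in> L"
  proof (rule ccontr)
    assume "h \<notin> L"
    then obtain z where "z \<noteq> 0" "\<And>l. l \<in> L \<Longrightarrow> inner z l = 0"
      using closed_subspace_orthogonal_ex[OF sub cl] by blast
    thus False using feat_separating[of z] fL by simp
  qed
  thus ?thesis by (simp add: L_def)
qed

lemma dense_sequence: obtains d :: "nat \<Rightarrow> 'h" where "\<And>h e. e > 0 \<Longrightarrow> \<exists>j. dist (d j) h < e"
proof -
  obtain D :: "'h set" where D: "countable D" "closure D = UNIV"
    using sep by (auto simp: separable_space_def)
  hence "D \<noteq> {}" by auto
  have "\<exists>j. dist (from_nat_into D j) h < e" if e: "e > 0" for h e
  proof -
    obtain y where "y \<in> D" "dist y h < e" using e D(2) closure_approachable[of h D] by auto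
    thus ?thesis using from_nat_into_surj[OF D(1)] by blast
  qed
  thus ?thesis using that by blast
qed

end

section \<open>Concentration and symmetrisation\<close>

text \<open>Hoeffding's lemma depends only on the width of an interval containing the values;
  bounded oscillation supplies the interval from the infimum of f to that infimum plus b.\<close>

lemma (in prob_space) hoeffding_oscillation:
  assumes f [measurable]: "f \<in> borel_measurable M" and l: "l > 0" and b: "b \<ge> 0"
    and osc: "\<And>x y. x \<in> space M \<Longrightarrow> y \<in> space M \<Longrightarrow> f x - f y \<le> b"
  shows "(\<integral>\<^sup>+x. ennreal (exp (l * (f x - expectation f))) \<partial>M) \<le> ennreal (exp (l\<^sup>2 * b\<^sup>2 / 8))"
proof -
  obtain x0 where x0: "x0 \<in> space M" using not_empty by blast
  define a where "a = (INF x\<in>space M. f x)"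
  have bdd: "bdd_below (f ` space M)"
    by (rule bdd_belowI2[of _ "f x0 - b"]) (use osc[OF x0] in \<open>force simp: algebra_simps\<close>)
  have "f x \<in> {a..a + b}" if x: "x \<in> space M" for x
  proof -
    have "a \<le> f x" unfolding a_def by (rule cINF_lower[OF bdd x])
    moreover have "f x - b \<le> a" unfolding a_def
      by (rule cINF_greatest) (use x osc in \<open>force simp: algebra_simps\<close>)+
    ultimately show ?thesis by simp
  qed
  then interpret interval_bounded_random_variable M f a "a + b"
    by unfold_locales auto
  show ?thesis using Hoeffdings_lemma_nn_integral[OF l] by simp
qed

text \<open>The martingale argument as an induction over coordinates: one coordinate is integrated
  out by Hoeffding's lemma, and the resulting average is again a bounded function with bounded
  differences of the remaining ones.\<close>

lemma mcdiarmid_exp: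
  fixes f :: "('i \<Rightarrow> 'a) \<Rightarrow> real" and b c l s :: real
  assumes P: "prob_space P" and I: "finite I" and l: "l > 0" and b: "b \<ge> 0"
    and f: "f \<in> borel_measurable (PiM I (\<lambda>_. P))"
    and bd: "\<And>x. x \<in> space (PiM I (\<lambda>_. P)) \<Longrightarrow> \<bar>f x\<bar> \<le> c"
    and osc: "\<And>x i y. x \<in> space (PiM I (\<lambda>_. P)) \<Longrightarrow> i \<in> I \<Longrightarrow> y \<in> space P \<Longrightarrow>
      f (x(i := y)) - f x \<le> b"
  shows "(\<integral>\<^sup>+x. ennreal (exp (l * (f x - (\<integral>x. f x \<partial>PiM I (\<lambda>_. P))))) \<partial>PiM I (\<lambda>_. P))
    \<le> ennreal (exp (l\<^sup>2 * b\<^sup>2 * card I / 8))"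
  using I f bd osc
proof (induction I arbitrary: f)
  case empty
  show ?case by (simp add: PiM_empty lebesgue_integral_count_space_finite nn_integral_count_space_finite)
next
  case (insert i I)
  interpret P0: prob_space P by (rule P)
  interpret pp: product_prob_space "\<lambda>_. P" I by unfold_locales
  interpret PI: prob_space "PiM I (\<lambda>_. P)" by (rule prob_space_PiM) (rule P)
  interpret PJ: prob_space "PiM (insert i I) (\<lambda>_. P)" by (rule prob_space_PiM) (rule P)
  let ?Q = "PiM I (\<lambda>_. P)"
  note [measurable] = insert.prems(1)
  have sp: "x(i := y) \<in> space (PiM (insert i I) (\<lambda>_. P))" if "x \<in> space ?Q" "y \<in> space P" for x y
    using that by (auto simp: space_PiM PiE_iff extensional_def)
  have m2 [measurable]: "(\<lambda>(x, y). f (x(i := y))) \<in> borel_measurable (?Q \<Otimes>\<^sub>M P)"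
    using measurable_compose[OF measurable_add_dim insert.prems(1)]
    by (simp add: comp_def case_prod_beta)
  \<comment> \<open>The conditional mean of f given all coordinates but i; f - h is the martingale
    increment.\<close>
  define h where "h x = (\<integral>y. f (x(i := y)) \<partial>P)" for x
  have [measurable]: "h \<in> borel_measurable ?Q"
    unfolding h_def using m2 by (intro P0.borel_measurable_lebesgue_integral) auto
  have fy: "(\<lambda>y. f (x(i := y))) \<in> borel_measurable P" if "x \<in> space ?Q" for x
    using measurable_Pair2[OF m2 that] by simp
  have intf: "integrable P (\<lambda>y. f (x(i := y)))" if x: "x \<in> space ?Q" for x
    by (rule P0.integrable_const_bound[of _ c, OF AE_I2 fy[OF x]])
       (metis insert.prems(2)[OF sp[OF x]] real_norm_def)
  have Ef: "(\<integral>x. f x \<partial>PiM (insert i I) (\<lambda>_. P)) = (\<integral>x. h x \<partial>?Q)"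
    unfolding h_def using insert.hyps
    by (intro pp.product_integral_insert PJ.integrable_const_bound[of _ c]) (auto simp: insert.prems(2))
  have hb: "\<bar>h x\<bar> \<le> c" if x: "x \<in> space ?Q" for x
  proof -
    have "\<bar>h x\<bar> \<le> (\<integral>y. \<bar>f (x(i := y))\<bar> \<partial>P)" unfolding h_def by (rule integral_abs_bound)
    also have "\<dots> \<le> (\<integral>y. c \<partial>P)"
      using intf[OF x] insert.prems(2)[OF sp[OF x]]
      by (intro integral_mono) (simp_all del: fun_upd_apply)
    finally show ?thesis by (simp add: P0.prob_space)
  qed
  have hosc: "h (x(j := y)) - h x \<le> b" if x: "x \<in> space ?Q" and j: "j \<in> I" and y: "y \<in> space P" for x j y
  proof -
    have x': "x(j := y) \<in> space ?Q" using x j y by (auto simp: space_PiM PiE_iff extensional_def)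
    have "h (x(j := y)) - h x = (\<integral>z. f ((x(j := y))(i := z)) - f (x(i := z)) \<partial>P)"
      unfolding h_def by (rule Bochner_Integration.integral_diff[symmetric]) (use intf x x' in auto)
    also have "\<dots> \<le> (\<integral>z. b \<partial>P)"
    proof (rule integral_mono)
      fix z assume z: "z \<in> space P"
      have "i \<noteq> j" using j insert.hyps by auto
      thus "f ((x(j := y))(i := z)) - f (x(i := z)) \<le> b"
        using insert.prems(3)[OF sp[OF x z], of j y] j y
        by (simp add: fun_upd_twist del: fun_upd_apply)
    qed (use intf x x' in auto)
    finally show ?thesis by (simp add: P0.prob_space)
  qed
  have "(\<integral>\<^sup>+x. ennreal (exp (l * (f x - (\<integral>x. h x \<partial>?Q)))) \<partial>PiM (insert i I) (\<lambda>_. P)) =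
    (\<integral>\<^sup>+x. \<integral>\<^sup>+y. ennreal (exp (l * (f (x(i := y)) - (\<integral>x. h x \<partial>?Q)))) \<partial>P \<partial>?Q)"
    using insert.hyps by (intro pp.product_nn_integral_insert) auto
  also have "\<dots> \<le> (\<integral>\<^sup>+x. ennreal (exp (l * (h x - (\<integral>x. h x \<partial>?Q)))) * ennreal (exp (l\<^sup>2 * b\<^sup>2 / 8)) \<partial>?Q)"
  proof (rule nn_integral_mono)
    fix x assume x: "x \<in> space ?Q"
    have [measurable]: "(\<lambda>y. f (x(i := y))) \<in> borel_measurable P" by (rule fy[OF x])
    have "(\<integral>\<^sup>+y. ennreal (exp (l * (f (x(i := y)) - (\<integral>x. h x \<partial>?Q)))) \<partial>P) =
      (\<integral>\<^sup>+y. ennreal (exp (l * (h x - (\<integral>x. h x \<partial>?Q)))) * ennreal (exp (l * (f (x(i := y)) - h x))) \<partial>P)"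
      by (intro nn_integral_cong) (simp add: ennreal_mult[symmetric] exp_add[symmetric] algebra_simps)
    also have "\<dots> = ennreal (exp (l * (h x - (\<integral>x. h x \<partial>?Q)))) *
       (\<integral>\<^sup>+y. ennreal (exp (l * (f (x(i := y)) - h x))) \<partial>P)"
      by (rule nn_integral_cmult) measurable
    also have "(\<integral>\<^sup>+y. ennreal (exp (l * (f (x(i := y)) - h x))) \<partial>P) \<le> ennreal (exp (l\<^sup>2 * b\<^sup>2 / 8))"
      unfolding h_def
    proof (rule P0.hoeffding_oscillation[OF _ l b])
      fix y y' assume y: "y \<in> space P" "y' \<in> space P"
      \<comment> \<open>The one-sided hypothesis bounds differences in both directions, because its
        base point may be chosen as x(i := y').\<close>
      show "f (x(i := y)) - f (x(i := y')) \<le> b"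
        using insert.prems(3)[OF sp[OF x y(2)], of i y] y by (simp del: fun_upd_apply)
    qed measurable
    finally show "(\<integral>\<^sup>+y. ennreal (exp (l * (f (x(i := y)) - (\<integral>x. h x \<partial>?Q)))) \<partial>P) \<le>
      ennreal (exp (l * (h x - (\<integral>x. h x \<partial>?Q)))) * ennreal (exp (l\<^sup>2 * b\<^sup>2 / 8))"
      by (simp add: mult_left_mono)
  qed
  also have "\<dots> = (\<integral>\<^sup>+x. ennreal (exp (l * (h x - (\<integral>x. h x \<partial>?Q)))) \<partial>?Q) * ennreal (exp (l\<^sup>2 * b\<^sup>2 / 8))"
    by (rule nn_integral_multc) measurable
  also have "\<dots> \<le> ennreal (exp (l\<^sup>2 * b\<^sup>2 * card I / 8)) * ennreal (exp (l\<^sup>2 * b\<^sup>2 / 8))"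
    by (intro mult_right_mono insert.IH hb hosc) auto
  also have "\<dots> = ennreal (exp (l\<^sup>2 * b\<^sup>2 * card (insert i I) / 8))"
    using insert.hyps by (simp add: ennreal_mult[symmetric] exp_add[symmetric] field_simps)
  finally show ?case unfolding Ef .
qed

lemma mcdiarmid:
  fixes f :: "('i \<Rightarrow> 'a) \<Rightarrow> real" and b c l s :: real
  assumes P: "prob_space P" and I: "finite I" "I \<noteq> {}" and b: "b > 0" and s: "s > 0"
    and f: "f \<in> borel_measurable (PiM I (\<lambda>_. P))"
    and bd: "\<And>x. x \<in> space (PiM I (\<lambda>_. P)) \<Longrightarrow> \<bar>f x\<bar> \<le> c"
    and osc: "\<And>x i y. x \<in> space (PiM I (\<lambda>_. P)) \<Longrightarrow> i \<in> I \<Longrightarrow> y \<in> space P \<Longrightarrow>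
      f (x(i := y)) - f x \<le> b"
  shows "measure (PiM I (\<lambda>_. P)) {x \<in> space (PiM I (\<lambda>_. P)).
      f x - (\<integral>x. f x \<partial>PiM I (\<lambda>_. P)) \<ge> s} \<le> exp (- 2 * s\<^sup>2 / (card I * b\<^sup>2))"
proof -
  interpret prob_space "PiM I (\<lambda>_. P)" by (rule prob_space_PiM) (rule P)
  let ?Q = "PiM I (\<lambda>_. P)"
  note [measurable] = f
  define n :: real where "n = card I"
  have n: "n > 0" using I by (simp add: n_def card_gt_0_iff)
  \<comment> \<open>The minimiser of the Chernoff exponent - l s + l^2 b^2 n / 8.\<close>
  define l where "l = 4 * s / (n * b\<^sup>2)"
  have l: "l > 0" using n b s by (simp add: l_def)
  let ?E = "\<integral>x. f x \<partial>?Q"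
  have "emeasure ?Q {x \<in> space ?Q. f x - ?E \<ge> s} =
    emeasure ?Q {x \<in> space ?Q. 1 \<le> ennreal (exp (- l * s)) * ennreal (exp (l * (f x - ?E)))}"
  proof -
    have "s \<le> z \<longleftrightarrow> 1 \<le> ennreal (exp (- l * s)) * ennreal (exp (l * z))" for z
    proof -
      have "ennreal (exp (- l * s)) * ennreal (exp (l * z)) = ennreal (exp (l * (z - s)))"
        by (simp add: ennreal_mult[symmetric] exp_add[symmetric] algebra_simps)
      thus ?thesis using l by (simp add: ennreal_1[symmetric] zero_le_mult_iff del: ennreal_1)
    qed
    thus ?thesis by simp
  qed
  also have "\<dots> \<le> ennreal (exp (- l * s)) * (\<integral>\<^sup>+x. ennreal (exp (l * (f x - ?E))) * indicator (space ?Q) x \<partial>?Q)"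
    by (rule nn_integral_Markov_inequality) measurable
  also have "(\<integral>\<^sup>+x. ennreal (exp (l * (f x - ?E))) * indicator (space ?Q) x \<partial>?Q) =
    (\<integral>\<^sup>+x. ennreal (exp (l * (f x - ?E))) \<partial>?Q)"
    by (intro nn_integral_cong) simp
  also have "\<dots> \<le> ennreal (exp (l\<^sup>2 * b\<^sup>2 * card I / 8))"
    using b by (intro mcdiarmid_exp[OF P I(1) l _ f bd osc]) auto
  also have "ennreal (exp (- l * s)) * \<dots> = ennreal (exp (- 2 * s\<^sup>2 / (card I * b\<^sup>2)))"
  proof -
    have "- l * s + l\<^sup>2 * b\<^sup>2 * n / 8 = - 2 * s\<^sup>2 / (n * b\<^sup>2)"
      using n b by (simp add: l_def field_simps power2_eq_square)
    thus ?thesis by (simp add: ennreal_mult[symmetric] exp_add[symmetric] n_def)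
  qed
  finally show ?thesis by (simp add: emeasure_eq_measure mult_left_mono)
qed

section \<open>Mean of a supremum by symmetrisation and contraction\<close>

lemma abs_cSUP_le:
  fixes f :: "'a \<Rightarrow> real"
  assumes "T \<noteq> {}" "\<And>t. t \<in> T \<Longrightarrow> \<bar>f t\<bar> \<le> c"
  shows "\<bar>SUP t\<in>T. f t\<bar> \<le> c" "bdd_above (f ` T)"
proof -
  show b: "bdd_above (f ` T)" by (rule bdd_aboveI2[of _ _ c]) (use assms(2) abs_le_D1 in blast)
  obtain t where t: "t \<in> T" using assms(1) by blast
  have "(SUP t\<in>T. f t) \<le> c" by (rule cSUP_least[OF assms(1)]) (use assms(2) abs_le_D1 in blast)
  moreover have "- c \<le> f t" using assms(2)[OF t] by simp
  hence "- c \<le> (SUP t\<in>T. f t)" using cSUP_upper[OF t b] by simp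
  ultimately show "\<bar>SUP t\<in>T. f t\<bar> \<le> c" by simp
qed

text \<open>The increments of \<psi> in \<theta> are dominated by an average of increments of linear
  functionals. An average rather than a sum lets an offset \<rho> be copied into every coordinate
  and still be counted once in total. Countability of T makes the suprema measurable.\<close>

locale contraction_process = prob_space P for P :: "'s measure" +
  fixes T :: "'e::real_inner set" and \<psi> :: "'e \<Rightarrow> 's \<Rightarrow> real"
    and J :: "'j set" and w :: "'j \<Rightarrow> 's \<Rightarrow> 'e" and M K c :: real
  assumes T: "countable T" "T \<noteq> {}" and T_bound: "\<And>\<theta>. \<theta> \<in> T \<Longrightarrow> norm \<theta> \<le> M"
    and \<psi>_meas [measurable]: "\<And>\<theta>. \<theta> \<in> T \<Longrightarrow> \<psi> \<theta> \<in> borel_measurable P"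
    and \<psi>_bound: "\<And>\<theta> x. \<theta> \<in> T \<Longrightarrow> \<bar>\<psi> \<theta> x\<bar> \<le> c"
    and J: "finite J" "J \<noteq> {}"
    and w_meas [measurable]: "\<And>\<theta> j. (\<lambda>x. inner (w j x) \<theta>) \<in> borel_measurable P"
    and w_bound: "\<And>j x. (norm (w j x))\<^sup>2 \<le> K"
    and contraction: "\<And>\<theta> \<theta>' x. \<theta> \<in> T \<Longrightarrow> \<theta>' \<in> T \<Longrightarrow>
      \<bar>\<psi> \<theta> x - \<psi> \<theta>' x\<bar> \<le> (\<Sum>j\<in>J. \<bar>inner (w j x) (\<theta> - \<theta>')\<bar>) / card J"
begin

text \<open>The mean over one Rademacher sign of the supremum of the doubled linear functional plus
  offset, with the two signs written out.\<close>

definition lin :: "('e \<Rightarrow> real) \<Rightarrow> 'j \<Rightarrow> 's \<Rightarrow> real" where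
  "lin \<rho> j x = ((SUP \<theta>\<in>T. 2 * inner (w j x) \<theta> + \<rho> \<theta>) + (SUP \<theta>\<in>T. - 2 * inner (w j x) \<theta> + \<rho> \<theta>)) / 2"

lemma M_nonneg: "M \<ge> 0"
  using T(2) T_bound norm_ge_zero by (meson all_not_in_conv order_trans)

lemma K_nonneg: "K \<ge> 0"
  using order_trans[OF zero_le_power2 w_bound] .

lemma inner_w_bound: "\<theta> \<in> T \<Longrightarrow> \<bar>inner (w j x) \<theta>\<bar> \<le> sqrt K * M"
proof -
  assume "\<theta> \<in> T"
  have "norm (w j x) \<le> sqrt K" using w_bound by (rule real_le_rsqrt)
  thus ?thesis using Cauchy_Schwarz_ineq2[of "w j x" \<theta>] T_bound[OF \<open>\<theta> \<in> T\<close>] K_nonneg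
    mult_mono[of "norm (w j x)" "sqrt K" "norm \<theta>" M] by simp
qed

lemma integrable_\<psi>: "\<theta> \<in> T \<Longrightarrow> integrable P (\<psi> \<theta>)"
  using \<psi>_bound by (intro integrable_const_bound[of _ c] AE_I2) auto

lemma abs_mean_le: "\<theta> \<in> T \<Longrightarrow> \<bar>expectation (\<psi> \<theta>)\<bar> \<le> c"
proof -
  assume t: "\<theta> \<in> T"
  have "\<bar>expectation (\<psi> \<theta>)\<bar> \<le> expectation (\<lambda>x. \<bar>\<psi> \<theta> x\<bar>)" by (rule integral_abs_bound)
  also have "\<dots> \<le> expectation (\<lambda>_. c)"
    using integrable_\<psi>[OF t] \<psi>_bound[OF t] by (intro integral_mono) auto
  finally show ?thesis by (simp add: prob_space)
qed

lemma lin_aux: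
  assumes "\<And>\<theta>. \<theta> \<in> T \<Longrightarrow> \<bar>\<rho> \<theta>\<bar> \<le> r"
  shows "\<bar>SUP \<theta>\<in>T. 2 * inner (w j x) \<theta> + \<rho> \<theta>\<bar> \<le> 2 * (sqrt K * M) + r"
    "\<bar>SUP \<theta>\<in>T. - 2 * inner (w j x) \<theta> + \<rho> \<theta>\<bar> \<le> 2 * (sqrt K * M) + r"
    "bdd_above ((\<lambda>\<theta>. 2 * inner (w j x) \<theta> + \<rho> \<theta>) ` T)"
    "bdd_above ((\<lambda>\<theta>. - 2 * inner (w j x) \<theta> + \<rho> \<theta>) ` T)"
proof -
  have *: "\<bar>2 * inner (w j x) \<theta> + \<rho> \<theta>\<bar> \<le> 2 * (sqrt K * M) + r"
    "\<bar>- 2 * inner (w j x) \<theta> + \<rho> \<theta>\<bar> \<le> 2 * (sqrt K * M) + r" if "\<theta> \<in> T" for \<theta>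
    using inner_w_bound[OF that, of j x] assms[OF that] by linarith+
  show "\<bar>SUP \<theta>\<in>T. 2 * inner (w j x) \<theta> + \<rho> \<theta>\<bar> \<le> 2 * (sqrt K * M) + r"
    "\<bar>SUP \<theta>\<in>T. - 2 * inner (w j x) \<theta> + \<rho> \<theta>\<bar> \<le> 2 * (sqrt K * M) + r"
    by (rule abs_cSUP_le(1)[OF T(2)], erule *)+
  show "bdd_above ((\<lambda>\<theta>. 2 * inner (w j x) \<theta> + \<rho> \<theta>) ` T)"
    "bdd_above ((\<lambda>\<theta>. - 2 * inner (w j x) \<theta> + \<rho> \<theta>) ` T)"
    by (rule abs_cSUP_le(2)[OF T(2)], erule *)+
qed

lemma lin_measurable [measurable]:
  assumes "\<And>\<theta>. \<theta> \<in> T \<Longrightarrow> \<bar>\<rho> \<theta>\<bar> \<le> r"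
  shows "lin \<rho> j \<in> borel_measurable P"
proof -
  show ?thesis unfolding lin_def[abs_def]
    using T(1) lin_aux(3,4)[where \<rho>=\<rho>, OF assms] by (intro borel_measurable_divide borel_measurable_add borel_measurable_cSUP) auto
qed

lemma lin_bound:
  assumes "\<And>\<theta>. \<theta> \<in> T \<Longrightarrow> \<bar>\<rho> \<theta>\<bar> \<le> r"
  shows "\<bar>lin \<rho> j x\<bar> \<le> 2 * (sqrt K * M) + r"
proof -
  have "\<bar>SUP \<theta>\<in>T. 2 * inner (w j x) \<theta> + \<rho> \<theta>\<bar> \<le> 2 * (sqrt K * M) + r"
    "\<bar>SUP \<theta>\<in>T. - 2 * inner (w j x) \<theta> + \<rho> \<theta>\<bar> \<le> 2 * (sqrt K * M) + r"
    using lin_aux(1,2)[where j=j and x=x and \<rho>=\<rho>, OF assms] by auto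
  moreover have "\<bar>(a + b) / 2\<bar> \<le> e" if "\<bar>a\<bar> \<le> e" "\<bar>b\<bar> \<le> e" for a b e :: real
    using that by (auto simp: abs_le_iff add_divide_distrib)
  ultimately show ?thesis unfolding lin_def by blast
qed

text \<open>
  For an independent copy \<open>y\<close> of \<open>x\<close>, adding the suprema of \<open>\<psi> \<theta> x - \<psi> \<theta> y\<close> and of
  \<open>\<psi> \<theta>' y - \<psi> \<theta>' x\<close> and regrouping leaves only differences \<open>\<psi> \<theta> - \<psi> \<theta>'\<close> at one point, to which the
  contraction applies.  This works with several coordinates at a time, unlike the usual contraction
  principle.
\<close>

lemma symmetrise_contract:
  assumes \<rho>: "\<And>\<theta>. \<theta> \<in> T \<Longrightarrow> \<bar>\<rho> \<theta>\<bar> \<le> r"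
  shows "(\<integral>x. (SUP \<theta>\<in>T. \<psi> \<theta> x - expectation (\<psi> \<theta>) + \<rho> \<theta>) \<partial>P)
    \<le> (\<integral>x. (\<Sum>j\<in>J. lin \<rho> j x) / card J \<partial>P)"
proof -
  interpret PP: pair_prob_space P P by unfold_locales
  define A where "A x = (SUP \<theta>\<in>T. \<psi> \<theta> x - expectation (\<psi> \<theta>) + \<rho> \<theta>)" for x
  define D where "D x y = (SUP \<theta>\<in>T. \<psi> \<theta> x - \<psi> \<theta> y + \<rho> \<theta>)" for x y
  define L where "L x = (\<Sum>j\<in>J. lin \<rho> j x) / card J" for x
  have Ab: "\<bar>A x\<bar> \<le> 2 * c + r" "bdd_above ((\<lambda>\<theta>. \<psi> \<theta> x - expectation (\<psi> \<theta>) + \<rho> \<theta>) ` T)" for x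
  proof -
    have "\<bar>\<psi> \<theta> x - expectation (\<psi> \<theta>) + \<rho> \<theta>\<bar> \<le> 2 * c + r" if "\<theta> \<in> T" for \<theta>
      using \<psi>_bound[OF that, of x] abs_mean_le[OF that] \<rho>[OF that] by linarith
    note * = this
    show "\<bar>A x\<bar> \<le> 2 * c + r" unfolding A_def
      by (rule abs_cSUP_le(1)[OF T(2)]) (erule *)
    show "bdd_above ((\<lambda>\<theta>. \<psi> \<theta> x - expectation (\<psi> \<theta>) + \<rho> \<theta>) ` T)"
      by (rule abs_cSUP_le(2)[OF T(2)]) (erule *)
  qed
  have Db: "\<bar>D x y\<bar> \<le> 2 * c + r" "bdd_above ((\<lambda>\<theta>. \<psi> \<theta> x - \<psi> \<theta> y + \<rho> \<theta>) ` T)" for x y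
  proof -
    have "\<bar>\<psi> \<theta> x - \<psi> \<theta> y + \<rho> \<theta>\<bar> \<le> 2 * c + r" if "\<theta> \<in> T" for \<theta>
      using \<psi>_bound[OF that, of x] \<psi>_bound[OF that, of y] \<rho>[OF that] by linarith
    note * = this
    show "\<bar>D x y\<bar> \<le> 2 * c + r" unfolding D_def
      by (rule abs_cSUP_le(1)[OF T(2)]) (erule *)
    show "bdd_above ((\<lambda>\<theta>. \<psi> \<theta> x - \<psi> \<theta> y + \<rho> \<theta>) ` T)"
      by (rule abs_cSUP_le(2)[OF T(2)]) (erule *)
  qed
  have [measurable]: "A \<in> borel_measurable P"
    unfolding A_def using T(1) Ab(2) by (intro borel_measurable_cSUP) auto
  have Dm [measurable]: "(\<lambda>(x, y). D x y) \<in> borel_measurable (P \<Otimes>\<^sub>M P)"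
    unfolding D_def case_prod_unfold using T(1) Db(2) by (intro borel_measurable_cSUP) auto
  have [measurable]: "L \<in> borel_measurable P"
    unfolding L_def using lin_measurable[OF \<rho>] by auto
  have Lb: "\<bar>L x\<bar> \<le> 2 * (sqrt K * M) + r" for x
  proof -
    have "\<bar>\<Sum>j\<in>J. lin \<rho> j x\<bar> \<le> (\<Sum>j\<in>J. 2 * (sqrt K * M) + r)"
      by (rule order_trans[OF sum_abs sum_mono]) (rule lin_bound[OF \<rho>])
    thus ?thesis using J by (simp add: L_def field_simps card_gt_0_iff)
  qed
  have iA: "integrable P A" using Ab by (intro integrable_const_bound[of _ "2 * c + r"] AE_I2) auto
  have iL: "integrable P L" using Lb by (intro integrable_const_bound[of _ "2 * (sqrt K * M) + r"] AE_I2) auto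
  have iD: "integrable (P \<Otimes>\<^sub>M P) (\<lambda>(x, y). D x y)"
    using Db by (intro PP.integrable_const_bound[of _ "2 * c + r"] AE_I2) auto
  have Dy: "D x \<in> borel_measurable P" if "x \<in> space P" for x
    using measurable_Pair2[OF Dm that] by simp
  have iDx: "integrable P (D x)" if "x \<in> space P" for x
    using Db Dy[OF that] by (intro integrable_const_bound[of _ "2 * c + r"] AE_I2) auto
  \<comment> \<open>Jensen: the centring constant is the mean over an independent copy y, and a
    supremum of integrals is at most the integral of the supremum.\<close>
  have AD: "A x \<le> (\<integral>y. D x y \<partial>P)" if x: "x \<in> space P" for x
    unfolding A_def
  proof (rule cSUP_least[OF T(2)])
    fix \<theta> assume t: "\<theta> \<in> T"
    have "\<psi> \<theta> x - expectation (\<psi> \<theta>) + \<rho> \<theta> = (\<integral>y. \<psi> \<theta> x - \<psi> \<theta> y + \<rho> \<theta> \<partial>P)"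
      using integrable_\<psi>[OF t] by (simp add: prob_space)
    also have "\<dots> \<le> (\<integral>y. D x y \<partial>P)"
    proof (rule integral_mono)
      fix y show "\<psi> \<theta> x - \<psi> \<theta> y + \<rho> \<theta> \<le> D x y"
        unfolding D_def by (rule cSUP_upper[OF t Db(2)])
    qed (use integrable_\<psi>[OF t] iDx[OF x] in auto)
    finally show "\<psi> \<theta> x - expectation (\<psi> \<theta>) + \<rho> \<theta> \<le> (\<integral>y. D x y \<partial>P)" .
  qed
  have DD: "D x y + D y x \<le> L x + L y" for x y
  proof -
    have pt: "(\<psi> \<theta> x - \<psi> \<theta> y + \<rho> \<theta>) + (\<psi> \<theta>' y - \<psi> \<theta>' x + \<rho> \<theta>') \<le> L x + L y"
      if t: "\<theta> \<in> T" "\<theta>' \<in> T" for \<theta> \<theta>'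
    proof -
      have z: "\<bar>\<psi> \<theta> z - \<psi> \<theta>' z\<bar> + (\<rho> \<theta> + \<rho> \<theta>') / 2 \<le> L z" for z
      proof -
        have "(\<Sum>j\<in>J. \<bar>inner (w j z) (\<theta> - \<theta>')\<bar> + (\<rho> \<theta> + \<rho> \<theta>') / 2) \<le> (\<Sum>j\<in>J. lin \<rho> j z)"
        proof (rule sum_mono)
          fix j assume "j \<in> J"
          note b = lin_aux(3,4)[where j=j and x=z and \<rho>=\<rho>, OF \<rho>]
          \<comment> \<open>The larger of p and q is tested in the supremum with sign +, the smaller
            in the one with sign -; half the sum of the two tests is the left-hand side.\<close>
          have arith: "\<bar>p - q\<bar> + (e + f) / 2 \<le> (s + t) / 2"
            if "2 * p + e \<le> s" "2 * q + f \<le> s" "- 2 * p + e \<le> t" "- 2 * q + f \<le> t"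
            for p q e f s t :: real
            using that by (auto simp: abs_if add_divide_distrib)
          show "\<bar>inner (w j z) (\<theta> - \<theta>')\<bar> + (\<rho> \<theta> + \<rho> \<theta>') / 2 \<le> lin \<rho> j z"
            unfolding lin_def inner_diff_right
            by (rule arith[OF cSUP_upper[OF t(1) b(1)] cSUP_upper[OF t(2) b(1)]
              cSUP_upper[OF t(1) b(2)] cSUP_upper[OF t(2) b(2)]])
        qed
        hence "(\<Sum>j\<in>J. \<bar>inner (w j z) (\<theta> - \<theta>')\<bar>) + card J * ((\<rho> \<theta> + \<rho> \<theta>') / 2) \<le> (\<Sum>j\<in>J. lin \<rho> j z)"
          by (simp add: sum.distrib)
        hence "((\<Sum>j\<in>J. \<bar>inner (w j z) (\<theta> - \<theta>')\<bar>) + card J * ((\<rho> \<theta> + \<rho> \<theta>') / 2)) / card J \<le> L z"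
          unfolding L_def by (rule divide_right_mono) simp
        hence "(\<Sum>j\<in>J. \<bar>inner (w j z) (\<theta> - \<theta>')\<bar>) / card J + (\<rho> \<theta> + \<rho> \<theta>') / 2 \<le> L z"
          using J by (simp add: add_divide_distrib)
        thus ?thesis using contraction[OF t, of z] by linarith
      qed
      show ?thesis using z[of x] z[of y] by (simp add: abs_if add_divide_distrib split: if_splits)
    qed
    \<comment> \<open>The two suprema are taken one after the other, each with the other index
      fixed.\<close>
    have "D x y \<le> L x + L y - (\<psi> \<theta>' y - \<psi> \<theta>' x + \<rho> \<theta>')" if "\<theta>' \<in> T" for \<theta>'
      unfolding D_def by (rule cSUP_least[OF T(2)]) (use pt[OF _ that] in \<open>simp add: algebra_simps\<close>)
    hence "\<psi> \<theta>' y - \<psi> \<theta>' x + \<rho> \<theta>' \<le> L x + L y - D x y" if "\<theta>' \<in> T" for \<theta>'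
      using that by (simp add: algebra_simps)
    hence "D y x \<le> L x + L y - D x y"
      unfolding D_def[of y x] by (intro cSUP_least[OF T(2)])
    thus ?thesis by simp
  qed
  have iDs: "integrable (P \<Otimes>\<^sub>M P) (\<lambda>(x, y). D y x)"
    using PP.integrable_product_swap[OF iD] by simp
  have iL1: "integrable (P \<Otimes>\<^sub>M P) (\<lambda>z. L (fst z))" "integrable (P \<Otimes>\<^sub>M P) (\<lambda>z. L (snd z))"
    using Lb by (auto intro!: PP.integrable_const_bound[of _ "2 * (sqrt K * M) + r"] AE_I2)
  have "expectation A \<le> (\<integral>x. \<integral>y. D x y \<partial>P \<partial>P)"
    using AD by (intro integral_mono iA PP.integrable_fst[OF iD]) auto
  also have "\<dots> = (\<integral>z. D (fst z) (snd z) \<partial>(P \<Otimes>\<^sub>M P))"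
    using PP.integral_fst[OF iD] by (simp add: case_prod_unfold)
  finally have 1: "expectation A \<le> (\<integral>z. D (fst z) (snd z) \<partial>(P \<Otimes>\<^sub>M P))" .
  \<comment> \<open>The product law is invariant under exchange of the copies, so the symmetric sum
    has twice the mean of D.\<close>
  have 2: "(\<integral>z. D (snd z) (fst z) \<partial>(P \<Otimes>\<^sub>M P)) = (\<integral>z. D (fst z) (snd z) \<partial>(P \<Otimes>\<^sub>M P))"
    using PP.integral_product_swap[OF Dm] by (simp add: case_prod_unfold)
  have iD': "integrable (P \<Otimes>\<^sub>M P) (\<lambda>z. D (fst z) (snd z))" "integrable (P \<Otimes>\<^sub>M P) (\<lambda>z. D (snd z) (fst z))"
    using iD iDs by (simp_all add: case_prod_unfold)
  have "2 * (\<integral>z. D (fst z) (snd z) \<partial>(P \<Otimes>\<^sub>M P)) =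
    (\<integral>z. D (fst z) (snd z) + D (snd z) (fst z) \<partial>(P \<Otimes>\<^sub>M P))"
    using iD' 2 by (subst Bochner_Integration.integral_add) auto
  also have "\<dots> \<le> (\<integral>z. L (fst z) + L (snd z) \<partial>(P \<Otimes>\<^sub>M P))"
    using DD iD' iL1 by (intro integral_mono) auto
  also have "\<dots> = (\<integral>z. L (fst z) \<partial>(P \<Otimes>\<^sub>M P)) + (\<integral>z. L (snd z) \<partial>(P \<Otimes>\<^sub>M P))"
    using iL1 by (rule Bochner_Integration.integral_add)
  also have "(\<integral>z. L (fst z) \<partial>(P \<Otimes>\<^sub>M P)) = expectation L"
    using PP.integral_fst[of "\<lambda>x y. L x"] iL1(1) by (simp add: prob_space case_prod_unfold)
  also have "(\<integral>z. L (snd z) \<partial>(P \<Otimes>\<^sub>M P)) = expectation L"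
    using PP.integral_fst[of "\<lambda>x y. L y"] iL1(2) by (simp add: prob_space case_prod_unfold)
  finally have "expectation A \<le> expectation L" using 1 by simp
  thus ?thesis unfolding A_def L_def .
qed

text \<open>The supremum of the centred empirical process, tilted by a linear functional v. The case
  v = 0 is the one finally wanted; v collects the linear terms that replace observations already
  treated.\<close>

definition gap :: "'i set \<Rightarrow> 'e \<Rightarrow> ('i \<Rightarrow> 's) \<Rightarrow> real" where
  "gap I v x = (SUP \<theta>\<in>T. (\<Sum>i\<in>I. \<psi> \<theta> (x i) - expectation (\<psi> \<theta>)) + inner v \<theta>)"

lemma gap_term_bound:
  "\<theta> \<in> T \<Longrightarrow> \<bar>(\<Sum>i\<in>I. \<psi> \<theta> (x i) - expectation (\<psi> \<theta>)) + inner v \<theta>\<bar> \<le> 2 * c * card I + norm v * M"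
proof -
  assume t: "\<theta> \<in> T"
  have "\<bar>\<Sum>i\<in>I. \<psi> \<theta> (x i) - expectation (\<psi> \<theta>)\<bar> \<le> (\<Sum>i\<in>I. 2 * c)"
  proof (rule order_trans[OF sum_abs sum_mono])
    fix i show "\<bar>\<psi> \<theta> (x i) - expectation (\<psi> \<theta>)\<bar> \<le> 2 * c"
      using \<psi>_bound[OF t, of "x i"] abs_mean_le[OF t] by linarith
  qed
  moreover have "\<bar>inner v \<theta>\<bar> \<le> norm v * M"
    using Cauchy_Schwarz_ineq2[of v \<theta>] T_bound[OF t] mult_left_mono[of "norm \<theta>" M "norm v"] by simp
  ultimately show ?thesis
    using abs_triangle_ineq[of "\<Sum>i\<in>I. \<psi> \<theta> (x i) - expectation (\<psi> \<theta>)" "inner v \<theta>"]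
    by (simp add: mult.commute)
qed

lemma gap_bound: "\<bar>gap I v x\<bar> \<le> 2 * c * card I + norm v * M"
  unfolding gap_def by (rule abs_cSUP_le(1)[OF T(2)]) (erule gap_term_bound)

lemma gap_bdd:
  "bdd_above ((\<lambda>\<theta>. (\<Sum>i\<in>I. \<psi> \<theta> (x i) - expectation (\<psi> \<theta>)) + inner v \<theta>) ` T)"
  by (rule abs_cSUP_le(2)[OF T(2)]) (erule gap_term_bound)

lemma gap_measurable [measurable]: "gap I v \<in> borel_measurable (PiM I (\<lambda>_. P))"
  unfolding gap_def[abs_def]
proof (intro borel_measurable_cSUP[OF T(1)] gap_bdd)
  fix \<theta> assume "\<theta> \<in> T"
  note [measurable] = \<psi>_meas[OF this]
  show "(\<lambda>x. (\<Sum>i\<in>I. \<psi> \<theta> (x i) - expectation (\<psi> \<theta>)) + inner v \<theta>)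
    \<in> borel_measurable (PiM I (\<lambda>_. P))" by measurable
qed

lemma integrable_gap: "integrable (PiM I (\<lambda>_. P)) (gap I v)"
proof -
  interpret PI: prob_space "PiM I (\<lambda>_. P)" by (rule prob_space_PiM) (rule prob_space_axioms)
  show ?thesis
    by (rule PI.integrable_const_bound[of _ "2 * c * card I + norm v * M", OF AE_I2 gap_measurable])
       (simp add: gap_bound)
qed

text \<open>The induction over the sample keeps the linear functional \<open>v\<close> built so far as a parameter.\<close>

lemma expectation_gap_le:
  assumes "finite I"
  shows "(\<integral>x. gap I v x \<partial>PiM I (\<lambda>_. P)) \<le> M * sqrt ((norm v)\<^sup>2 + 4 * K * card I)"
  using assms
proof (induction I arbitrary: v)
  case empty
  have "inner v \<theta> \<le> M * norm v" if "\<theta> \<in> T" for \<theta>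
    using Cauchy_Schwarz_ineq2[of v \<theta>] T_bound[OF that] mult_left_mono[of "norm \<theta>" M "norm v"]
    by (simp add: mult.commute)
  hence "gap {} v x \<le> M * norm v" for x :: "'a \<Rightarrow> 's"
    unfolding gap_def using T(2) by (auto intro!: cSUP_least)
  thus ?case by (simp add: PiM_empty lebesgue_integral_count_space_finite)
next
  case (insert i I)
  interpret pp: product_prob_space "\<lambda>_. P" I by unfold_locales
  interpret PI: prob_space "PiM I (\<lambda>_. P)" by (rule prob_space_PiM) (rule prob_space_axioms)
  interpret PQ: pair_prob_space "PiM I (\<lambda>_. P)" P by unfold_locales
  let ?Q = "PiM I (\<lambda>_. P)"
  define \<rho> where "\<rho> x \<theta> = (\<Sum>i\<in>I. \<psi> \<theta> (x i) - expectation (\<psi> \<theta>)) + inner v \<theta>" for x \<theta>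
  have \<rho>b: "\<theta> \<in> T \<Longrightarrow> \<bar>\<rho> x \<theta>\<bar> \<le> 2 * c * card I + norm v * M" for x \<theta>
    unfolding \<rho>_def by (rule gap_term_bound)
  \<comment> \<open>The two signs shift the tilt v by plus or minus 2 w, so the contracted
    observation is absorbed into the induction parameter.\<close>
  have lin_gap: "lin (\<rho> x) j y = (gap I (v + 2 *\<^sub>R w j y) x + gap I (v - 2 *\<^sub>R w j y) x) / 2" for x j y
    unfolding lin_def gap_def \<rho>_def by (simp add: inner_simps algebra_simps)
  have gap_insert: "gap (insert i I) v (x(i := y)) = (SUP \<theta>\<in>T. \<psi> \<theta> y - expectation (\<psi> \<theta>) + \<rho> x \<theta>)" for x y
  proof -
    have "(\<Sum>j\<in>I. \<psi> \<theta> ((x(i := y)) j) - expectation (\<psi> \<theta>)) = (\<Sum>j\<in>I. \<psi> \<theta> (x j) - expectation (\<psi> \<theta>))" for \<theta>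
      using insert.hyps by (intro sum.cong) auto
    thus ?thesis using insert.hyps unfolding gap_def \<rho>_def by (simp add: add.assoc)
  qed
  define L where "L x y = (\<Sum>j\<in>J. lin (\<rho> x) j y) / card J" for x y
  have gm: "(\<lambda>z. gap I (v + s *\<^sub>R w j (snd z)) (fst z)) \<in> borel_measurable (?Q \<Otimes>\<^sub>M P)" for j s
    unfolding gap_def[abs_def]
  proof (intro borel_measurable_cSUP[OF T(1)] gap_bdd)
    fix \<theta> assume "\<theta> \<in> T"
    note [measurable] = \<psi>_meas[OF this]
    show "(\<lambda>z. (\<Sum>i\<in>I. \<psi> \<theta> (fst z i) - expectation (\<psi> \<theta>)) + inner (v + s *\<^sub>R w j (snd z)) \<theta>)
      \<in> borel_measurable (?Q \<Otimes>\<^sub>M P)" unfolding inner_add_left inner_scaleR_left by measurable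
  qed
  have gm2: "(\<lambda>z. gap I (v - 2 *\<^sub>R w j (snd z)) (fst z)) \<in> borel_measurable (?Q \<Otimes>\<^sub>M P)" for j
    using gm[of "-2" j] by simp
  have Lm: "(\<lambda>z. L (fst z) (snd z)) \<in> borel_measurable (?Q \<Otimes>\<^sub>M P)"
    unfolding L_def lin_gap using gm[of 2] gm2
    by (intro borel_measurable_divide borel_measurable_sum borel_measurable_add) auto
  have Lb: "\<bar>L x y\<bar> \<le> 2 * (sqrt K * M) + (2 * c * card I + norm v * M)" for x y
  proof -
    have "\<bar>\<Sum>j\<in>J. lin (\<rho> x) j y\<bar> \<le> (\<Sum>j\<in>J. 2 * (sqrt K * M) + (2 * c * card I + norm v * M))"
      by (rule order_trans[OF sum_abs sum_mono]) (rule lin_bound[OF \<rho>b])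
    thus ?thesis using J by (simp add: L_def field_simps card_gt_0_iff)
  qed
  have iL: "integrable (?Q \<Otimes>\<^sub>M P) (\<lambda>z. L (fst z) (snd z))"
    by (rule PQ.integrable_const_bound[of _ "2 * (sqrt K * M) + (2 * c * card I + norm v * M)", OF AE_I2 Lm])
       (simp only: real_norm_def Lb)
  have iL': "integrable (?Q \<Otimes>\<^sub>M P) (\<lambda>(x, y). L x y)"
    using iL by (simp add: case_prod_unfold)
  have step: "(\<integral>x. L x y \<partial>?Q) \<le> M * sqrt ((norm v)\<^sup>2 + 4 * K * card (insert i I))" for y
  proof -
    have "(\<integral>x. L x y \<partial>?Q) = (\<Sum>j\<in>J. ((\<integral>x. gap I (v + 2 *\<^sub>R w j y) x \<partial>?Q) +
        (\<integral>x. gap I (v - 2 *\<^sub>R w j y) x \<partial>?Q)) / 2) / card J"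
      unfolding L_def lin_gap by (simp add: integrable_gap)
    also have "\<dots> \<le> (\<Sum>j\<in>J. M * sqrt ((norm v)\<^sup>2 + 4 * K * card (insert i I))) / card J"
    proof (intro divide_right_mono sum_mono)
      fix j assume "j \<in> J"
      let ?a = "(norm (v + 2 *\<^sub>R w j y))\<^sup>2 + 4 * K * card I"
      let ?b = "(norm (v - 2 *\<^sub>R w j y))\<^sup>2 + 4 * K * card I"
      \<comment> \<open>Concavity of the square root, applied to the two signs.\<close>
      have sq: "(sqrt a + sqrt b) / 2 \<le> sqrt ((a + b) / 2)" if "a \<ge> 0" "b \<ge> 0" for a b
      proof (rule real_le_rsqrt)
        have "0 \<le> (sqrt a - sqrt b)\<^sup>2" by simp
        thus "((sqrt a + sqrt b) / 2)\<^sup>2 \<le> (a + b) / 2"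
          using that by (simp add: power2_eq_square field_simps)
      qed
      have ab: "?a \<ge> 0" "?b \<ge> 0" using K_nonneg by simp_all
      \<comment> \<open>The cross terms of the two signs cancel, so every observation adds at most
        4K under the root; this is why the bound is carried as a root of a sum of squares.\<close>
      have "(?a + ?b) / 2 = (norm v)\<^sup>2 + 4 * (norm (w j y))\<^sup>2 + 4 * K * card I"
        unfolding power2_norm_eq_inner by (simp add: inner_simps algebra_simps inner_commute)
      also have "\<dots> \<le> (norm v)\<^sup>2 + 4 * K * card (insert i I)"
        using w_bound[of j y] insert.hyps by (simp add: algebra_simps)
      finally have "sqrt ((?a + ?b) / 2) \<le> sqrt ((norm v)\<^sup>2 + 4 * K * card (insert i I))" by simp
      hence "(sqrt ?a + sqrt ?b) / 2 \<le> sqrt ((norm v)\<^sup>2 + 4 * K * card (insert i I))"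
        using sq[OF ab] by linarith
      hence "M * ((sqrt ?a + sqrt ?b) / 2) \<le> M * sqrt ((norm v)\<^sup>2 + 4 * K * card (insert i I))"
        using M_nonneg by (rule mult_left_mono)
      moreover have "((\<integral>x. gap I (v + 2 *\<^sub>R w j y) x \<partial>?Q) + (\<integral>x. gap I (v - 2 *\<^sub>R w j y) x \<partial>?Q)) / 2
        \<le> M * ((sqrt ?a + sqrt ?b) / 2)"
        using insert.IH[of "v + 2 *\<^sub>R w j y"] insert.IH[of "v - 2 *\<^sub>R w j y"]
        by (simp add: distrib_left)
      ultimately show "((\<integral>x. gap I (v + 2 *\<^sub>R w j y) x \<partial>?Q) + (\<integral>x. gap I (v - 2 *\<^sub>R w j y) x \<partial>?Q)) / 2
        \<le> M * sqrt ((norm v)\<^sup>2 + 4 * K * card (insert i I))" by linarith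
    qed simp
    also have "\<dots> = M * sqrt ((norm v)\<^sup>2 + 4 * K * card (insert i I))"
      using J by simp
    finally show ?thesis .
  qed
  have "(\<integral>x. gap (insert i I) v x \<partial>PiM (insert i I) (\<lambda>_. P)) =
    (\<integral>x. \<integral>y. gap (insert i I) v (x(i := y)) \<partial>P \<partial>?Q)"
    using insert.hyps by (intro pp.product_integral_insert integrable_gap) auto
  also have "\<dots> = (\<integral>x. \<integral>y. (SUP \<theta>\<in>T. \<psi> \<theta> y - expectation (\<psi> \<theta>) + \<rho> x \<theta>) \<partial>P \<partial>?Q)"
    unfolding gap_insert ..
  also have "\<dots> \<le> (\<integral>x. \<integral>y. L x y \<partial>P \<partial>?Q)"
  proof (rule integral_mono)
    have "(\<lambda>(x, y). gap (insert i I) v (x(i := y))) \<in> borel_measurable (?Q \<Otimes>\<^sub>M P)"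
      using measurable_compose[OF measurable_add_dim gap_measurable] by (simp add: comp_def case_prod_unfold)
    hence "integrable (?Q \<Otimes>\<^sub>M P) (\<lambda>(x, y). gap (insert i I) v (x(i := y)))"
      by (intro PQ.integrable_const_bound[of _ "2 * c * card (insert i I) + norm v * M"] AE_I2)
         (auto simp only: real_norm_def split: prod.split intro: gap_bound)
    from PQ.integrable_fst[OF this]
    show "integrable ?Q (\<lambda>x. \<integral>y. (SUP \<theta>\<in>T. \<psi> \<theta> y - expectation (\<psi> \<theta>) + \<rho> x \<theta>) \<partial>P)"
      unfolding gap_insert .
    show "integrable ?Q (\<lambda>x. \<integral>y. L x y \<partial>P)" using PQ.integrable_fst[OF iL'] .
    show "(\<integral>y. (SUP \<theta>\<in>T. \<psi> \<theta> y - expectation (\<psi> \<theta>) + \<rho> x \<theta>) \<partial>P) \<le> (\<integral>y. L x y \<partial>P)" for x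
      unfolding L_def by (rule symmetrise_contract) (rule \<rho>b)
  qed
  \<comment> \<open>The order is exchanged because the induction hypothesis integrates over the old
    sample with the new observation y, and so the tilt, held fixed.\<close>
  also have "\<dots> = (\<integral>y. \<integral>x. L x y \<partial>?Q \<partial>P)"
    using PQ.Fubini_integral[OF iL'] by simp
  also have "\<dots> \<le> (\<integral>y. M * sqrt ((norm v)\<^sup>2 + 4 * K * card (insert i I)) \<partial>P)"
    using step PQ.integrable_snd[OF iL'] by (intro integral_mono) auto
  finally show ?case by (simp add: prob_space)
qed

end

section \<open>Subgaussian noise\<close>

text \<open>Completing the square turns the integrand into a constant times the normal density with
  variance 1 / p and mean \<mu>, where p = 1 - v B^2 is the remaining precision, positive by
  assumption.\<close>

lemma nn_integral_gaussian_quadratic: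
  fixes v A B :: real
  assumes "v * B\<^sup>2 < 1"
  shows "(\<integral>\<^sup>+z. ennreal (std_normal_density z * exp (v * (A + B * z)\<^sup>2 / 2)) \<partial>lborel) =
    ennreal (exp (v * A\<^sup>2 / (2 * (1 - v * B\<^sup>2))) / sqrt (1 - v * B\<^sup>2))"
proof -
  define p where "p = 1 - v * B\<^sup>2"
  define s where "s = 1 / sqrt p"
  define \<mu> where "\<mu> = v * A * B / p"
  have p: "p > 0" using assms by (simp add: p_def)
  have s: "s > 0" "s\<^sup>2 = 1 / p" using p by (simp_all add: s_def power_divide)
  have "std_normal_density z * exp (v * (A + B * z)\<^sup>2 / 2) =
     (exp (v * A\<^sup>2 / (2 * p)) * s) * normal_density \<mu> s z" for z
  proof -
    have "- z\<^sup>2 / 2 + v * (A + B * z)\<^sup>2 / 2 = v * A\<^sup>2 / (2 * p) - (z - \<mu>)\<^sup>2 / (2 * s\<^sup>2)"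
    proof -
      have vB: "v * B\<^sup>2 = 1 - p" by (simp add: p_def)
      have "p * (- z\<^sup>2 + v * (A + B * z)\<^sup>2) = v * A\<^sup>2 - (p * z - v * A * B)\<^sup>2"
      proof -
        have "v * (A + B * z)\<^sup>2 = v * A\<^sup>2 + 2 * v * A * B * z + (v * B\<^sup>2) * z\<^sup>2"
          by (simp add: power2_eq_square algebra_simps)
        also have "\<dots> = v * A\<^sup>2 + 2 * v * A * B * z + (1 - p) * z\<^sup>2" by (simp only: vB)
        finally have "v * (A + B * z)\<^sup>2 = v * A\<^sup>2 + 2 * v * A * B * z + (1 - p) * z\<^sup>2" .
        hence 1: "p * (- z\<^sup>2 + v * (A + B * z)\<^sup>2) = p * (v * A\<^sup>2) + 2 * p * z * (v * A * B) - (p * z)\<^sup>2"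
          by (simp only:) (simp add: power2_eq_square algebra_simps)
        have "(v * A * B)\<^sup>2 = v * A\<^sup>2 * (v * B\<^sup>2)" by (simp add: power2_eq_square algebra_simps)
        hence "p * (v * A\<^sup>2) = v * A\<^sup>2 - (v * A * B)\<^sup>2" by (simp add: vB algebra_simps)
        thus ?thesis using 1 by (simp add: power2_eq_square algebra_simps)
      qed
      moreover have "p * z - v * A * B = p * (z - \<mu>)" using p by (simp add: \<mu>_def algebra_simps)
      moreover have "(p * (z - \<mu>))\<^sup>2 = p * (p * (z - \<mu>)\<^sup>2)" by (simp add: power2_eq_square)
      ultimately have "p * (- z\<^sup>2 + v * (A + B * z)\<^sup>2) = v * A\<^sup>2 - p * (p * (z - \<mu>)\<^sup>2)"
        by (simp only:)
      hence "- z\<^sup>2 + v * (A + B * z)\<^sup>2 = v * A\<^sup>2 / p - p * (z - \<mu>)\<^sup>2"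
        using p by (simp add: field_simps)
      hence "(- z\<^sup>2 + v * (A + B * z)\<^sup>2) / 2 = (v * A\<^sup>2 / p - p * (z - \<mu>)\<^sup>2) / 2" by simp
      thus ?thesis unfolding s(2) using p
        by (simp add: add_divide_distrib diff_divide_distrib mult.commute)
    qed
    hence "exp (- z\<^sup>2 / 2) * exp (v * (A + B * z)\<^sup>2 / 2) =
      exp (v * A\<^sup>2 / (2 * p)) * exp (- (z - \<mu>)\<^sup>2 / (2 * s\<^sup>2))"
      by (simp add: exp_add[symmetric])
    thus ?thesis using s(1)
      by (simp add: std_normal_density_def normal_density_def real_sqrt_mult field_simps)
  qed
  hence "(\<integral>\<^sup>+z. ennreal (std_normal_density z * exp (v * (A + B * z)\<^sup>2 / 2)) \<partial>lborel) =
     (\<integral>\<^sup>+z. ennreal (exp (v * A\<^sup>2 / (2 * p)) * s) * ennreal (normal_density \<mu> s z) \<partial>lborel)"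
    using s by (simp add: ennreal_mult)
  also have "\<dots> = ennreal (exp (v * A\<^sup>2 / (2 * p)) * s) * (\<integral>\<^sup>+z. ennreal (normal_density \<mu> s z) \<partial>lborel)"
    by (rule nn_integral_cmult) simp
  also have "(\<integral>\<^sup>+z. ennreal (normal_density \<mu> s z) \<partial>lborel) = 1"
    using s(1) by (subst nn_integral_eq_integral) auto
  finally show ?thesis by (simp add: p_def s_def)
qed

lemma nn_integral_gaussian_mgf:
  "(\<integral>\<^sup>+z. ennreal (std_normal_density z) * ennreal (exp (b * z)) \<partial>lborel) = ennreal (exp (b\<^sup>2 / 2))"
proof -
  have "std_normal_density z * exp (b * z) = exp (b\<^sup>2 / 2) * normal_density b 1 z" for z
  proof -
    have "- z\<^sup>2 / 2 + b * z = b\<^sup>2 / 2 + - (z - b)\<^sup>2 / 2" by (simp add: power2_eq_square field_simps)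
    hence "exp (- z\<^sup>2 / 2) * exp (b * z) = exp (b\<^sup>2 / 2) * exp (- (z - b)\<^sup>2 / 2)"
      by (simp only: exp_add[symmetric])
    thus ?thesis by (simp add: normal_density_def)
  qed
  hence "(\<integral>\<^sup>+z. ennreal (std_normal_density z) * ennreal (exp (b * z)) \<partial>lborel) =
     (\<integral>\<^sup>+z. ennreal (exp (b\<^sup>2 / 2)) * ennreal (normal_density b 1 z) \<partial>lborel)"
    by (simp add: ennreal_mult[symmetric])
  also have "\<dots> = ennreal (exp (b\<^sup>2 / 2)) * (\<integral>\<^sup>+z. ennreal (normal_density b 1 z) \<partial>lborel)"
    by (rule nn_integral_cmult) simp
  also have "(\<integral>\<^sup>+z. ennreal (normal_density b 1 z) \<partial>lborel) = 1"
    by (subst nn_integral_eq_integral) auto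
  finally show ?thesis by simp
qed

text \<open>The subgaussian bound holds outside a null set that depends on s, so a random s = a(X)
  cannot be inserted directly. A simple a takes finitely many values, and the indicators of its
  level sets are measurable for the \<sigma>-algebra of X, so the conditional bound is used once per
  value.\<close>

lemma cond_subgaussian_simple:
  assumes M: "prob_space M" and X: "X \<in> measurable M N" and U: "U \<in> borel_measurable M"
    and sg: "cond_subgaussian M N X U v" and a: "simple_function N a"
  shows "(\<integral>\<^sup>+\<omega>. ennreal (exp (a (X \<omega>) * U \<omega>)) \<partial>M) \<le> (\<integral>\<^sup>+\<omega>. ennreal (exp (v * (a (X \<omega>))\<^sup>2 / 2)) \<partial>M)"
proof -
  interpret prob_space M by (rule M)
  note [measurable] = X U
  let ?F = "vimage_algebra (space M) X N"
  have XF: "X \<in> measurable ?F N"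
    using measurable_space[OF X] by (intro measurable_vimage_algebra1) auto
  have "subalgebra M ?F"
    unfolding subalgebra_def using measurable_space[OF X] X
    by (auto simp: sets_vimage_algebra2)
  then interpret finite_measure_subalgebra M ?F by unfold_locales
  have fin: "finite (a ` space N)" using a by (simp add: simple_function_def)
  have ms: "a -` {y} \<inter> space N \<in> sets N" if "y \<in> a ` space N" for y
    using a that unfolding simple_function_def by blast
  define D where "D y = (\<lambda>\<omega>. indicator (a -` {y} \<inter> space N) (X \<omega>) :: ennreal)" for y
  have DF: "D y \<in> borel_measurable ?F" if "y \<in> a ` space N" for y
    unfolding D_def by (rule measurable_compose[OF XF borel_measurable_indicator[OF ms[OF that]]])
  have DM: "D y \<in> borel_measurable M" if "y \<in> a ` space N" for y
    unfolding D_def by (rule measurable_compose[OF X borel_measurable_indicator[OF ms[OF that]]])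
  have split: "(\<Sum>y\<in>a ` space N. D y \<omega> * f y) = f (a (X \<omega>))" if w: "\<omega> \<in> space M" for \<omega> and f :: "real \<Rightarrow> ennreal"
  proof -
    have Xw: "X \<omega> \<in> space N" using measurable_space[OF X w] .
    have "(\<Sum>y\<in>a ` space N. D y \<omega> * f y) = (\<Sum>y\<in>a ` space N. if y = a (X \<omega>) then f y else 0)"
      using Xw by (intro sum.cong) (auto simp: D_def indicator_def)
    also have "\<dots> = f (a (X \<omega>))" using fin Xw by simp
    finally show ?thesis .
  qed
  have "(\<integral>\<^sup>+\<omega>. ennreal (exp (a (X \<omega>) * U \<omega>)) \<partial>M) =
    (\<integral>\<^sup>+\<omega>. (\<Sum>y\<in>a ` space N. D y \<omega> * ennreal (exp (y * U \<omega>))) \<partial>M)"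
  proof (rule nn_integral_cong)
    fix \<omega> assume "\<omega> \<in> space M"
    from split[OF this, of "\<lambda>y. ennreal (exp (y * U \<omega>))"]
    show "ennreal (exp (a (X \<omega>) * U \<omega>)) = (\<Sum>y\<in>a ` space N. D y \<omega> * ennreal (exp (y * U \<omega>)))" by simp
  qed
  also have "\<dots> = (\<Sum>y\<in>a ` space N. \<integral>\<^sup>+\<omega>. D y \<omega> * ennreal (exp (y * U \<omega>)) \<partial>M)"
    using DM by (intro nn_integral_sum) auto
  also have "\<dots> = (\<Sum>y\<in>a ` space N. \<integral>\<^sup>+\<omega>. D y \<omega> * nn_cond_exp M ?F (\<lambda>\<omega>. ennreal (exp (y * U \<omega>))) \<omega> \<partial>M)"
    using DF by (intro sum.cong refl nn_cond_exp_intg[symmetric]) auto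
  also have "\<dots> \<le> (\<Sum>y\<in>a ` space N. \<integral>\<^sup>+\<omega>. D y \<omega> * ennreal (exp (v * y\<^sup>2 / 2)) \<partial>M)"
  proof (intro sum_mono nn_integral_mono_AE)
    fix y
    have "AE \<omega> in M. nn_cond_exp M ?F (\<lambda>\<omega>. ennreal (exp (y * U \<omega>))) \<omega> \<le> ennreal (exp (v * y\<^sup>2 / 2))"
      using sg by (simp add: cond_subgaussian_def)
    thus "AE \<omega> in M. D y \<omega> * nn_cond_exp M ?F (\<lambda>\<omega>. ennreal (exp (y * U \<omega>))) \<omega> \<le>
      D y \<omega> * ennreal (exp (v * y\<^sup>2 / 2))"
      by eventually_elim (rule mult_left_mono, simp_all)
  qed
  also have "\<dots> = (\<integral>\<^sup>+\<omega>. (\<Sum>y\<in>a ` space N. D y \<omega> * ennreal (exp (v * y\<^sup>2 / 2))) \<partial>M)"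
    using DM by (intro nn_integral_sum[symmetric]) auto
  also have "\<dots> = (\<integral>\<^sup>+\<omega>. ennreal (exp (v * (a (X \<omega>))\<^sup>2 / 2)) \<partial>M)"
    using split by (intro nn_integral_cong)
  finally show ?thesis .
qed

text \<open>Passage from simple functions: Fatou on the left, where the integrand involves the
  unbounded U, and dominated convergence on the right, where it is bounded because a is.\<close>

lemma cond_subgaussian_bounded:
  assumes M: "prob_space M" and X: "X \<in> measurable M N" and U: "U \<in> borel_measurable M"
    and v: "v \<ge> 0" and sg: "cond_subgaussian M N X U v"
    and a: "a \<in> borel_measurable N" and c: "\<And>x. x \<in> space N \<Longrightarrow> \<bar>a x\<bar> \<le> c"
  shows "(\<integral>\<^sup>+\<omega>. ennreal (exp (a (X \<omega>) * U \<omega>)) \<partial>M) \<le> (\<integral>\<^sup>+\<omega>. ennreal (exp (v * (a (X \<omega>))\<^sup>2 / 2)) \<partial>M)"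
proof -
  interpret prob_space M by (rule M)
  note [measurable] = X U a
  obtain F where F: "\<And>i. simple_function N (F i)" "\<And>x. x \<in> space N \<Longrightarrow> (\<lambda>i. F i x) \<longlonglongrightarrow> a x"
    "\<And>i x. x \<in> space N \<Longrightarrow> dist (F i x) 0 \<le> 2 * dist (a x) 0"
    using borel_measurable_implies_sequence_metric[OF a, of 0] by blast
  have Fm [measurable]: "F i \<in> borel_measurable N" for i
    using F(1) by (rule borel_measurable_simple_function)
  have XN: "X \<omega> \<in> space N" if "\<omega> \<in> space M" for \<omega> using measurable_space[OF X that] .
  have "(\<integral>\<^sup>+\<omega>. ennreal (exp (a (X \<omega>) * U \<omega>)) \<partial>M) = (\<integral>\<^sup>+\<omega>. liminf (\<lambda>i. ennreal (exp (F i (X \<omega>) * U \<omega>))) \<partial>M)"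
  proof (rule nn_integral_cong)
    fix \<omega> assume w: "\<omega> \<in> space M"
    have "(\<lambda>i. ennreal (exp (F i (X \<omega>) * U \<omega>))) \<longlonglongrightarrow> ennreal (exp (a (X \<omega>) * U \<omega>))"
      by (intro tendsto_ennrealI tendsto_intros F(2) XN w)
    thus "ennreal (exp (a (X \<omega>) * U \<omega>)) = liminf (\<lambda>i. ennreal (exp (F i (X \<omega>) * U \<omega>)))"
      by (rule lim_imp_Liminf[OF sequentially_bot, symmetric])
  qed
  also have "\<dots> \<le> liminf (\<lambda>i. \<integral>\<^sup>+\<omega>. ennreal (exp (F i (X \<omega>) * U \<omega>)) \<partial>M)"
    by (rule nn_integral_liminf) measurable
  also have "\<dots> \<le> liminf (\<lambda>i. \<integral>\<^sup>+\<omega>. ennreal (exp (v * (F i (X \<omega>))\<^sup>2 / 2)) \<partial>M)"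
    by (intro Liminf_mono always_eventually allI cond_subgaussian_simple[OF M X U sg F(1)])
  also have "\<dots> = (\<integral>\<^sup>+\<omega>. ennreal (exp (v * (a (X \<omega>))\<^sup>2 / 2)) \<partial>M)"
  proof (rule lim_imp_Liminf[OF sequentially_bot nn_integral_dominated_convergence])
    \<comment> \<open>The approximating sequence is only known to satisfy |F i| \<le> 2 |a|, whence
      2c.\<close>
    show "AE \<omega> in M. ennreal (exp (v * (F i (X \<omega>))\<^sup>2 / 2)) \<le> ennreal (exp (v * (2 * c)\<^sup>2 / 2))" for i
    proof (rule AE_I2)
      fix \<omega> assume w: "\<omega> \<in> space M"
      have "\<bar>F i (X \<omega>)\<bar> \<le> 2 * c" using F(3)[OF XN[OF w], of i] c[OF XN[OF w]] by simp
      hence "(F i (X \<omega>))\<^sup>2 \<le> (2 * c)\<^sup>2" by (rule abs_le_square_iff[THEN iffD1, OF order_trans]) simp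
      thus "ennreal (exp (v * (F i (X \<omega>))\<^sup>2 / 2)) \<le> ennreal (exp (v * (2 * c)\<^sup>2 / 2))"
        using v by (intro ennreal_leI exp_le_cancel_iff[THEN iffD2] divide_right_mono mult_left_mono) auto
    qed
    show "AE \<omega> in M. (\<lambda>i. ennreal (exp (v * (F i (X \<omega>))\<^sup>2 / 2))) \<longlonglongrightarrow> ennreal (exp (v * (a (X \<omega>))\<^sup>2 / 2))"
      by (rule AE_I2) (intro tendsto_ennrealI tendsto_intros F(2) XN; simp)
  qed (auto simp: emeasure_space_1)
  finally show ?thesis .
qed

section \<open>Exponential moments of noise sums in the feature space\<close>

context measurable_rkhs
begin

lemma k_diag_measurable [measurable]: "(\<lambda>x. k x x) \<in> borel_measurable P"
  using measurable_compose[OF measurable_Pair[OF measurable_ident measurable_ident] k_meas] by simp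

lemma k_pair_measurable:
  assumes "f \<in> measurable N P" "h \<in> measurable N P"
  shows "(\<lambda>z. k (f z) (h z)) \<in> borel_measurable N"
  using measurable_compose[OF measurable_Pair[OF assms] k_meas] by simp

text \<open>
  The square \<open>exp (l * e\<^sup>2 * k x x)\<close> is linearised as the expectation of \<open>exp (B * e * y)\<close> over a standard
  normal \<open>y\<close>, after which the subgaussian bound applies for each fixed \<open>y\<close>.
\<close>

lemma subgaussian_feat_step:
  fixes e :: "'s \<times> real \<Rightarrow> real"
  assumes Q: "prob_space Q" and sets_Q: "sets Q = sets (P \<Otimes>\<^sub>M borel)"
    and e [measurable]: "e \<in> borel_measurable Q" and v: "v > 0" and l: "l > 0"
    and q: "2 * l * v * diag_norm k < 1"
    and sg: "\<And>a c. a \<in> borel_measurable P \<Longrightarrow> (\<And>x. \<bar>a x\<bar> \<le> c) \<Longrightarrow>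
      (\<integral>\<^sup>+z. ennreal (exp (a (fst z) * e z)) \<partial>Q) \<le> (\<integral>\<^sup>+z. ennreal (exp (v * (a (fst z))\<^sup>2 / 2)) \<partial>Q)"
  shows "(\<integral>\<^sup>+z. ennreal (exp (l * (norm (u + e z *\<^sub>R feat (fst z)))\<^sup>2)) \<partial>Q) \<le>
    ennreal (exp (l / (1 - 2 * l * v * diag_norm k) * (norm u)\<^sup>2) / sqrt (1 - 2 * l * v * diag_norm k))"
proof -
  interpret Q: prob_space Q by (rule Q)
  have fst_m [measurable]: "fst \<in> measurable Q P"
    using measurable_cong_sets[OF sets_Q refl] measurable_fst by blast
  \<comment> \<open>Chosen so that l times the squared norm of u + e k_x equals l times that of u,
    plus A e + (B e)^2 / 2; the last term is the Gaussian cumulant of B e y.\<close>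
  define A where "A x = 2 * l * \<iota> u x" for x
  define B where "B x = sqrt (2 * l * k x x)" for x
  have k0: "k x x \<ge> 0" for x using norm_feat_sq[of x] zero_le_power2 by metis
  have Am [measurable]: "A \<in> borel_measurable P" unfolding A_def by measurable
  have Bm [measurable]: "B \<in> borel_measurable P" unfolding B_def by measurable
  have Bsq: "(B x)\<^sup>2 = 2 * l * k x x" for x using k0 l by (simp add: B_def)
  have Ab: "\<bar>A x\<bar> \<le> 2 * l * (norm u * sqrt (diag_norm k))" for x
    using abs_eval_le[of u x] l by (simp add: A_def abs_mult)
  have Bb: "\<bar>B x\<bar> \<le> sqrt (2 * l * diag_norm k)" for x
    using diag_le[of x] k0[of x] l by (simp add: B_def)
  define p where "p = 1 - 2 * l * v * diag_norm k"
  have p: "p > 0" using q by (simp add: p_def)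
  interpret QL: pair_sigma_finite lborel Q by unfold_locales
  have pt: "ennreal (exp (l * (norm (u + e z *\<^sub>R feat (fst z)))\<^sup>2)) = ennreal (exp (l * (norm u)\<^sup>2)) *
     (\<integral>\<^sup>+y. ennreal (std_normal_density y) * ennreal (exp ((A (fst z) + B (fst z) * y) * e z)) \<partial>lborel)" for z
  proof -
    have "(\<integral>\<^sup>+y. ennreal (std_normal_density y) * ennreal (exp ((A (fst z) + B (fst z) * y) * e z)) \<partial>lborel) =
      (\<integral>\<^sup>+y. ennreal (exp (A (fst z) * e z)) * (ennreal (std_normal_density y) * ennreal (exp ((B (fst z) * e z) * y))) \<partial>lborel)"
      by (intro nn_integral_cong) (simp add: ennreal_mult[symmetric] exp_add[symmetric] algebra_simps)
    also have "\<dots> = ennreal (exp (A (fst z) * e z)) * ennreal (exp ((B (fst z) * e z)\<^sup>2 / 2))"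
      by (subst nn_integral_cmult) (auto simp: nn_integral_gaussian_mgf)
    finally have 1: "(\<integral>\<^sup>+y. ennreal (std_normal_density y) * ennreal (exp ((A (fst z) + B (fst z) * y) * e z)) \<partial>lborel) =
      ennreal (exp (A (fst z) * e z + (B (fst z) * e z)\<^sup>2 / 2))"
      by (simp add: ennreal_mult[symmetric] exp_add[symmetric])
    have "(norm (u + e z *\<^sub>R feat (fst z)))\<^sup>2 = (norm u)\<^sup>2 + 2 * e z * \<iota> u (fst z) + (e z)\<^sup>2 * k (fst z) (fst z)"
      unfolding power2_norm_eq_inner inner_add_left inner_add_right inner_scaleR_left inner_scaleR_right feat(2)
      by (simp add: inner_feat inner_commute[of "feat _" u] power2_eq_square distrib_left mult.assoc)
    hence "l * (norm (u + e z *\<^sub>R feat (fst z)))\<^sup>2 = l * (norm u)\<^sup>2 + (A (fst z) * e z + (B (fst z) * e z)\<^sup>2 / 2)"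
      by (simp add: A_def power_mult_distrib Bsq algebra_simps)
    thus ?thesis unfolding 1 by (simp add: ennreal_mult[symmetric] exp_add[symmetric])
  qed
  have "(\<integral>\<^sup>+z. ennreal (exp (l * (norm (u + e z *\<^sub>R feat (fst z)))\<^sup>2)) \<partial>Q) =
    ennreal (exp (l * (norm u)\<^sup>2)) * (\<integral>\<^sup>+z. \<integral>\<^sup>+y. ennreal (std_normal_density y) *
      ennreal (exp ((A (fst z) + B (fst z) * y) * e z)) \<partial>lborel \<partial>Q)"
    unfolding pt by (rule nn_integral_cmult) measurable
  also have "(\<integral>\<^sup>+z. \<integral>\<^sup>+y. ennreal (std_normal_density y) *
      ennreal (exp ((A (fst z) + B (fst z) * y) * e z)) \<partial>lborel \<partial>Q) =
     (\<integral>\<^sup>+y. \<integral>\<^sup>+z. ennreal (std_normal_density y) *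
      ennreal (exp ((A (fst z) + B (fst z) * y) * e z)) \<partial>Q \<partial>lborel)"
    by (rule QL.Fubini') measurable
  also have "\<dots> \<le> (\<integral>\<^sup>+y. \<integral>\<^sup>+z. ennreal (std_normal_density y) *
      ennreal (exp (v * (A (fst z) + B (fst z) * y)\<^sup>2 / 2)) \<partial>Q \<partial>lborel)"
  proof (rule nn_integral_mono)
    fix y :: real
    \<comment> \<open>For fixed y the coefficient of e is a bounded function of x, as
      \<open>sg\<close> requires, because the kernel is bounded.\<close>
    have "\<bar>A x + B x * y\<bar> \<le> 2 * l * (norm u * sqrt (diag_norm k)) + sqrt (2 * l * diag_norm k) * \<bar>y\<bar>" for x
      using Ab[of x] mult_right_mono[OF Bb[of x], of "\<bar>y\<bar>"] abs_triangle_ineq[of "A x" "B x * y"]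
      by (simp add: abs_mult)
    hence "(\<integral>\<^sup>+z. ennreal (exp ((A (fst z) + B (fst z) * y) * e z)) \<partial>Q) \<le>
      (\<integral>\<^sup>+z. ennreal (exp (v * (A (fst z) + B (fst z) * y)\<^sup>2 / 2)) \<partial>Q)"
      by (intro sg[of "\<lambda>x. A x + B x * y"]) auto
    thus "(\<integral>\<^sup>+z. ennreal (std_normal_density y) * ennreal (exp ((A (fst z) + B (fst z) * y) * e z)) \<partial>Q) \<le>
      (\<integral>\<^sup>+z. ennreal (std_normal_density y) * ennreal (exp (v * (A (fst z) + B (fst z) * y)\<^sup>2 / 2)) \<partial>Q)"
      by (subst (1 2) nn_integral_cmult) (auto intro: mult_left_mono)
  qed
  also have "\<dots> = (\<integral>\<^sup>+z. \<integral>\<^sup>+y. ennreal (std_normal_density y) *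
      ennreal (exp (v * (A (fst z) + B (fst z) * y)\<^sup>2 / 2)) \<partial>lborel \<partial>Q)"
    by (rule QL.Fubini'[symmetric]) measurable
  also have "\<dots> \<le> (\<integral>\<^sup>+z. ennreal (exp (l * (1 / p - 1) * (norm u)\<^sup>2) / sqrt p) \<partial>Q)"
  proof (rule nn_integral_mono)
    fix z :: "'s \<times> real"
    let ?x = "fst z"
    have vB: "v * (B ?x)\<^sup>2 \<le> 1 - p"
      unfolding Bsq p_def using mult_left_mono[OF diag_le[of ?x], of "2 * l * v"] l v by (simp add: algebra_simps)
    have p_le1: "p \<le> 1" using l v diag_pos by (simp add: p_def)
    \<comment> \<open>p is the worst case of 1 - v (B x)^2 over x; with it the Gaussian integral is
      bounded independently of the covariate.\<close>
    have pB: "p \<le> 1 - v * (B ?x)\<^sup>2" using vB by simp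
    have "(\<integral>\<^sup>+y. ennreal (std_normal_density y) * ennreal (exp (v * (A ?x + B ?x * y)\<^sup>2 / 2)) \<partial>lborel) =
      ennreal (exp (v * (A ?x)\<^sup>2 / (2 * (1 - v * (B ?x)\<^sup>2))) / sqrt (1 - v * (B ?x)\<^sup>2))"
      using nn_integral_gaussian_quadratic[of v "B ?x" "A ?x"] pB p by (simp add: ennreal_mult)
    also have "\<dots> \<le> ennreal (exp (l * (1 / p - 1) * (norm u)\<^sup>2) / sqrt p)"
    proof (intro ennreal_leI frac_le)
      have "(A ?x)\<^sup>2 \<le> (2 * l * (norm u * sqrt (diag_norm k)))\<^sup>2"
        using Ab[of ?x] by (rule abs_le_square_iff[THEN iffD1, OF order_trans]) simp
      also have "\<dots> = 4 * l\<^sup>2 * (norm u)\<^sup>2 * diag_norm k"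
        using diag_pos by (simp add: power_mult_distrib)
      finally have "v * (A ?x)\<^sup>2 \<le> v * (4 * l\<^sup>2 * (norm u)\<^sup>2 * diag_norm k)" using v by (intro mult_left_mono) auto
      also have "\<dots> = 2 * l * (1 - p) * (norm u)\<^sup>2" by (simp add: p_def power2_eq_square)
      finally have "v * (A ?x)\<^sup>2 / (2 * (1 - v * (B ?x)\<^sup>2)) \<le> 2 * l * (1 - p) * (norm u)\<^sup>2 / (2 * p)"
        using pB p l p_le1
        by (intro frac_le) auto
      also have "\<dots> = l * (1 / p - 1) * (norm u)\<^sup>2" using p by (simp add: field_simps)
      finally show "exp (v * (A ?x)\<^sup>2 / (2 * (1 - v * (B ?x)\<^sup>2))) \<le> exp (l * (1 / p - 1) * (norm u)\<^sup>2)" by simp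
    qed (use pB p in auto)
    finally show "(\<integral>\<^sup>+y. ennreal (std_normal_density y) * ennreal (exp (v * (A ?x + B ?x * y)\<^sup>2 / 2)) \<partial>lborel)
      \<le> ennreal (exp (l * (1 / p - 1) * (norm u)\<^sup>2) / sqrt p)" .
  qed
  also have "\<dots> = ennreal (exp (l * (1 / p - 1) * (norm u)\<^sup>2) / sqrt p)"
    by (simp add: Q.emeasure_space_1)
  also have "ennreal (exp (l * (norm u)\<^sup>2)) * \<dots> = ennreal (exp (l / p * (norm u)\<^sup>2) / sqrt p)"
    using p by (simp add: ennreal_mult[symmetric] exp_add[symmetric] algebra_simps)
  finally show ?thesis by (simp add: p_def mult_left_mono)
qed

text \<open>Only kernel values and point evaluations occur on the right, so measurability of the
  norm follows from that of k, with no need to treat \<open>feat\<close> as a measurable map into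
  H.\<close>

lemma norm_sum_feat_sq:
  "(norm (u + (\<Sum>i\<in>I. e i *\<^sub>R feat (x i))))\<^sup>2 =
    (norm u)\<^sup>2 + 2 * (\<Sum>i\<in>I. e i * \<iota> u (x i)) + (\<Sum>i\<in>I. \<Sum>j\<in>I. e i * e j * k (x i) (x j))"
proof -
  define s where "s = (\<Sum>i\<in>I. e i *\<^sub>R feat (x i))"
  have "(norm (u + s))\<^sup>2 = (norm u)\<^sup>2 + 2 * inner u s + inner s s"
    unfolding power2_norm_eq_inner inner_add_left inner_add_right by (simp add: inner_commute[of s u])
  moreover have "inner u s = (\<Sum>i\<in>I. e i * \<iota> u (x i))"
    unfolding s_def inner_sum_right feat(2) by simp
  moreover have "inner s s = (\<Sum>i\<in>I. e i * inner (feat (x i)) s)"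
    unfolding s_def inner_sum_left by simp
  hence "inner s s = (\<Sum>i\<in>I. \<Sum>j\<in>I. e i * e j * k (x i) (x j))"
    unfolding s_def inner_sum_right by (simp add: inner_feat sum_distrib_left mult.assoc)
  ultimately show ?thesis unfolding s_def by simp
qed

lemma norm_sum_feat_sq_measurable:
  assumes "\<And>i. i \<in> I \<Longrightarrow> (\<lambda>z. e z i) \<in> borel_measurable N" "\<And>i. i \<in> I \<Longrightarrow> (\<lambda>z. x z i) \<in> measurable N P"
  shows "(\<lambda>z. (norm (u + (\<Sum>i\<in>I. e z i *\<^sub>R feat (x z i))))\<^sup>2) \<in> borel_measurable N"
  unfolding norm_sum_feat_sq
  by (intro borel_measurable_add borel_measurable_times borel_measurable_sum borel_measurable_const
    assms k_pair_measurable measurable_compose[OF assms(2) eval_measurable])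

text \<open>
  The map \<open>l \<mapsto> l / (1 - m * l)\<close> of the one-step bound adds \<open>- m\<close> to \<open>1 / l\<close>, so its iterates and the product of the
  normalising factors telescope.
\<close>

lemma subgaussian_feat_sum:
  fixes e :: "'s \<times> real \<Rightarrow> real"
  assumes Q: "prob_space Q" and sets_Q: "sets Q = sets (P \<Otimes>\<^sub>M borel)"
    and e: "e \<in> borel_measurable Q" and v: "v > 0" and l: "l > 0"
    and I: "finite I" and q: "2 * l * v * diag_norm k * card I < 1"
    and sg: "\<And>a c. a \<in> borel_measurable P \<Longrightarrow> (\<And>x. \<bar>a x\<bar> \<le> c) \<Longrightarrow>
      (\<integral>\<^sup>+z. ennreal (exp (a (fst z) * e z)) \<partial>Q) \<le> (\<integral>\<^sup>+z. ennreal (exp (v * (a (fst z))\<^sup>2 / 2)) \<partial>Q)"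
  shows "(\<integral>\<^sup>+z. ennreal (exp (l * (norm (u + (\<Sum>i\<in>I. e (z i) *\<^sub>R feat (fst (z i)))))\<^sup>2)) \<partial>PiM I (\<lambda>_. Q)) \<le>
    ennreal (exp (l / (1 - 2 * l * v * diag_norm k * card I) * (norm u)\<^sup>2) / sqrt (1 - 2 * l * v * diag_norm k * card I))"
  using I l q
proof (induction I arbitrary: l u)
  case empty
  show ?case by (simp add: PiM_empty nn_integral_count_space_finite)
next
  case (insert i I)
  interpret Q: prob_space Q by (rule Q)
  interpret pp: product_prob_space "\<lambda>_. Q" I by unfold_locales
  have fst_m [measurable]: "fst \<in> measurable Q P"
    using measurable_cong_sets[OF sets_Q refl] measurable_fst by blast
  note [measurable] = e
  define m where "m = 2 * v * diag_norm k"
  have m: "m > 0" using v diag_pos by (simp add: m_def)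
  have c: "real (card (insert i I)) = card I + 1" using insert.hyps by simp
  have lm: "l * m * card I + l * m < 1"
    using insert.prems(2) unfolding c by (simp add: m_def algebra_simps)
  have "0 \<le> l * m * card I" using insert.prems m by simp
  hence lm1: "l * m < 1" using lm by linarith
  define l' where "l' = l / (1 - l * m)"
  have l': "l' > 0" using insert.prems lm1 by (simp add: l'_def)
  have lmI: "1 - l' * m * card I = (1 - l * m * card (insert i I)) / (1 - l * m)"
    using lm1 unfolding c by (simp add: l'_def field_simps)
  have pos: "1 - l * m * card (insert i I) > 0"
    using lm unfolding c by (simp add: algebra_simps)
  have meas: "(\<lambda>z. ennreal (exp (l * (norm (u + (\<Sum>j\<in>I. e (z j) *\<^sub>R feat (fst (z j)))))\<^sup>2))) \<in> borel_measurable (PiM I (\<lambda>_. Q))"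
    for I :: "'a set" and l u
  proof -
    have [measurable]: "(\<lambda>z. (norm (u + (\<Sum>j\<in>I. e (z j) *\<^sub>R feat (fst (z j)))))\<^sup>2) \<in> borel_measurable (PiM I (\<lambda>_. Q))"
      by (rule norm_sum_feat_sq_measurable) measurable
    show ?thesis by measurable
  qed
  have "(\<integral>\<^sup>+z. ennreal (exp (l * (norm (u + (\<Sum>j\<in>insert i I. e (z j) *\<^sub>R feat (fst (z j)))))\<^sup>2)) \<partial>PiM (insert i I) (\<lambda>_. Q)) =
    (\<integral>\<^sup>+z. \<integral>\<^sup>+y. ennreal (exp (l * (norm (u + (\<Sum>j\<in>insert i I. e ((z(i := y)) j) *\<^sub>R feat (fst ((z(i := y)) j)))))\<^sup>2)) \<partial>Q \<partial>PiM I (\<lambda>_. Q))"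
    using insert.hyps by (intro pp.product_nn_integral_insert meas) auto
  \<comment> \<open>The observations not yet integrated are absorbed into the offset u, and the
    one-step bound replaces l by l'.\<close>
  also have "\<dots> \<le> (\<integral>\<^sup>+z. ennreal (1 / sqrt (1 - l * m)) * ennreal (exp (l' * (norm (u + (\<Sum>j\<in>I. e (z j) *\<^sub>R feat (fst (z j)))))\<^sup>2)) \<partial>PiM I (\<lambda>_. Q))"
  proof (rule nn_integral_mono)
    fix z
    let ?u = "u + (\<Sum>j\<in>I. e (z j) *\<^sub>R feat (fst (z j)))"
    have "u + (\<Sum>j\<in>insert i I. e ((z(i := y)) j) *\<^sub>R feat (fst ((z(i := y)) j))) = ?u + e y *\<^sub>R feat (fst y)" for y
    proof -
      have "(\<Sum>j\<in>I. e ((z(i := y)) j) *\<^sub>R feat (fst ((z(i := y)) j))) = (\<Sum>j\<in>I. e (z j) *\<^sub>R feat (fst (z j)))"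
        using insert.hyps by (intro sum.cong) auto
      thus ?thesis using insert.hyps by (simp add: algebra_simps)
    qed
    hence "(\<integral>\<^sup>+y. ennreal (exp (l * (norm (u + (\<Sum>j\<in>insert i I. e ((z(i := y)) j) *\<^sub>R feat (fst ((z(i := y)) j)))))\<^sup>2)) \<partial>Q) =
      (\<integral>\<^sup>+y. ennreal (exp (l * (norm (?u + e y *\<^sub>R feat (fst y)))\<^sup>2)) \<partial>Q)" by (simp only:)
    also have "\<dots> \<le> ennreal (exp (l / (1 - 2 * l * v * diag_norm k) * (norm ?u)\<^sup>2) / sqrt (1 - 2 * l * v * diag_norm k))"
      using lm1 by (intro subgaussian_feat_step[OF Q sets_Q e v insert.prems(1) _ sg]) (auto simp: m_def algebra_simps)
    also have "2 * l * v * diag_norm k = l * m" by (simp add: m_def)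
    also have "ennreal (exp (l / (1 - l * m) * (norm ?u)\<^sup>2) / sqrt (1 - l * m)) =
      ennreal (1 / sqrt (1 - l * m)) * ennreal (exp (l' * (norm ?u)\<^sup>2))"
      using lm1 by (subst ennreal_mult[symmetric]) (auto simp: l'_def)
    finally show "(\<integral>\<^sup>+y. ennreal (exp (l * (norm (u + (\<Sum>j\<in>insert i I. e ((z(i := y)) j) *\<^sub>R feat (fst ((z(i := y)) j)))))\<^sup>2)) \<partial>Q)
      \<le> ennreal (1 / sqrt (1 - l * m)) * ennreal (exp (l' * (norm ?u)\<^sup>2))" .
  qed
  also have "\<dots> = ennreal (1 / sqrt (1 - l * m)) * (\<integral>\<^sup>+z. ennreal (exp (l' * (norm (u + (\<Sum>j\<in>I. e (z j) *\<^sub>R feat (fst (z j)))))\<^sup>2)) \<partial>PiM I (\<lambda>_. Q))"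
    by (rule nn_integral_cmult) (rule meas)
  also have "\<dots> \<le> ennreal (1 / sqrt (1 - l * m)) *
    ennreal (exp (l' / (1 - 2 * l' * v * diag_norm k * card I) * (norm u)\<^sup>2) / sqrt (1 - 2 * l' * v * diag_norm k * card I))"
  proof (intro mult_left_mono insert.IH l')
    have "0 < 1 - l' * m * card I" unfolding lmI using pos lm1 by simp
    thus "2 * l' * v * diag_norm k * card I < 1" by (simp add: m_def algebra_simps)
  qed simp
  also have "2 * l' * v * diag_norm k * card I = l' * m * card I" by (simp add: m_def)
  also have "ennreal (1 / sqrt (1 - l * m)) * ennreal (exp (l' / (1 - l' * m * card I) * (norm u)\<^sup>2) / sqrt (1 - l' * m * card I)) =
    ennreal (exp (l / (1 - l * m * card (insert i I)) * (norm u)\<^sup>2) / sqrt (1 - l * m * card (insert i I)))"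
  proof -
    have 1: "l' / (1 - l' * m * card I) = l / (1 - l * m * card (insert i I))"
      unfolding lmI using lm1 by (simp add: l'_def)
    have 2: "sqrt (1 - l * m) * sqrt (1 - l' * m * card I) = sqrt (1 - l * m * card (insert i I))"
      unfolding lmI real_sqrt_mult[symmetric] using lm1 by simp
    have 3: "1 - l' * m * card I > 0" unfolding lmI using pos lm1 by simp
    have "ennreal (1 / sqrt (1 - l * m)) * ennreal (exp E / sqrt (1 - l' * m * card I)) =
      ennreal (exp E / (sqrt (1 - l * m) * sqrt (1 - l' * m * card I)))" for E
      using lm1 3 by (subst ennreal_mult[symmetric]) auto
    thus ?thesis unfolding 1 2 .
  qed
  finally show ?case by (simp add: m_def algebra_simps)
qed

end

section \<open>Constrained least squares\<close>

text \<open>The risk is quadratic in the fitted values, so its second-order expansion is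
  exact.\<close>

lemma emp_risk_expand:
  "emp_risk n x y f = emp_risk n x y h + 2 * ((\<Sum>i=1..n. (h (x i) - y i) * (f (x i) - h (x i))) / real n)
    + emp_sq n x (\<lambda>z. f z - h z)"
proof -
  have "(\<Sum>i=1..n. (f (x i) - y i)\<^sup>2) = (\<Sum>i=1..n. (h (x i) - y i)\<^sup>2 +
    2 * ((h (x i) - y i) * (f (x i) - h (x i))) + (f (x i) - h (x i))\<^sup>2)"
    by (intro sum.cong) (auto simp: power2_eq_square algebra_simps)
  thus ?thesis
    by (simp add: emp_risk_def emp_sq_def sum.distrib add_divide_distrib sum_distrib_left)
qed

lemma emp_sq_nonneg: "emp_sq n x f \<ge> 0"
  by (simp add: emp_sq_def sum_nonneg)

lemma emp_sq_mono:
  assumes "\<And>i. i \<in> {1..n} \<Longrightarrow> \<bar>f (x i)\<bar> \<le> \<bar>h (x i)\<bar>"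
  shows "emp_sq n x f \<le> emp_sq n x h"
  unfolding emp_sq_def using assms by (intro divide_right_mono sum_mono) (auto simp: abs_le_square_iff)

lemma emp_sq_le_const:
  assumes "\<And>i. i \<in> {1..n} \<Longrightarrow> \<bar>f (x i)\<bar> \<le> c"
  shows "emp_sq n x f \<le> c\<^sup>2"
proof -
  have "(\<Sum>i=1..n. (f (x i))\<^sup>2) \<le> (\<Sum>i=1..n. c\<^sup>2)"
    using assms by (intro sum_mono) (simp add: abs_le_square_iff[symmetric] order_trans[OF _ abs_ge_self])
  hence "emp_sq n x f \<le> (\<Sum>i=1..n. c\<^sup>2) / real n" unfolding emp_sq_def by (rule divide_right_mono) simp
  also have "\<dots> \<le> c\<^sup>2" by simp
  finally show ?thesis .
qed

lemma emp_sq_sum_le: "emp_sq n x (\<lambda>z. f z + h z) \<le> 2 * emp_sq n x f + 2 * emp_sq n x h"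
proof -
  have "(f (x i) + h (x i))\<^sup>2 \<le> 2 * (f (x i))\<^sup>2 + 2 * (h (x i))\<^sup>2" for i
    using zero_le_power2[of "f (x i) - h (x i)"] by (simp add: power2_eq_square algebra_simps)
  hence "(\<Sum>i=1..n. (f (x i) + h (x i))\<^sup>2) \<le> 2 * (\<Sum>i=1..n. (f (x i))\<^sup>2) + 2 * (\<Sum>i=1..n. (h (x i))\<^sup>2)"
    unfolding sum_distrib_left sum.distrib[symmetric] by (intro sum_mono)
  from divide_right_mono[OF this, of "real n"] show ?thesis
    by (simp add: emp_sq_def add_divide_distrib)
qed

lemma emp_sq_term_le:
  assumes "i \<in> {1..n}" shows "(f (x i))\<^sup>2 \<le> real n * emp_sq n x f"
proof -
  have "(f (x i))\<^sup>2 \<le> (\<Sum>i=1..n. (f (x i))\<^sup>2)" using assms by (intro member_le_sum) auto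
  thus ?thesis using assms by (simp add: emp_sq_def)
qed

locale ls_data = bounded_rkhs \<iota> k
  for \<iota> :: "'h::{real_inner,complete_space} \<Rightarrow> 's::topological_space \<Rightarrow>\<^sub>C real" and k +
  fixes n :: nat and x :: "nat \<Rightarrow> 's" and y :: "nat \<Rightarrow> real"
  assumes n: "n \<ge> 1"
begin

abbreviation "risk h \<equiv> emp_risk n x y (apply_bcontfun (\<iota> h))"
abbreviation "esq f h \<equiv> emp_sq n x (\<lambda>z. \<iota> f z - \<iota> h z)"
abbreviation "lse \<equiv> ls_est \<iota> k n x y"

text \<open>First-order optimality over a convex set: moving from h a short way towards f stays in
  the ball and so cannot lower the risk.\<close>

lemma minimiser_inner:
  assumes h: "h \<in> cball 0 r" and min: "\<And>f. f \<in> cball 0 r \<Longrightarrow> risk h \<le> risk f" and f: "f \<in> cball 0 r"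
  shows "(\<Sum>i=1..n. (\<iota> h (x i) - y i) * (\<iota> f (x i) - \<iota> h (x i))) / real n \<ge> 0"
proof (rule ccontr)
  let ?c = "(\<Sum>i=1..n. (\<iota> h (x i) - y i) * (\<iota> f (x i) - \<iota> h (x i))) / real n"
  assume "\<not> ?thesis"
  hence c: "?c < 0" by simp
  define q where "q = esq f h"
  have q: "q \<ge> 0" by (simp add: q_def emp_sq_nonneg)
  \<comment> \<open>Small enough for the quadratic term t^2 q to lose against the linear term 2 t c;
    q + 1 avoids division by zero.\<close>
  define t where "t = min 1 (- ?c / (q + 1))"
  have t: "0 < t" "t \<le> 1" "t * (q + 1) \<le> - ?c"
  proof -
    have "- ?c / (q + 1) > 0" using c q by (intro divide_pos_pos) auto
    thus "0 < t" "t \<le> 1" unfolding t_def by auto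
    have "t \<le> - ?c / (q + 1)" unfolding t_def by (rule min.cobounded2)
    thus "t * (q + 1) \<le> - ?c" using q by (simp only: pos_le_divide_eq)
  qed
  have "(1 - t) *\<^sub>R h + t *\<^sub>R f \<in> cball 0 r"
    using h f t by (intro convexD[OF convex_cball]) auto
  hence "risk h \<le> risk ((1 - t) *\<^sub>R h + t *\<^sub>R f)" by (rule min)
  also have "\<dots> = risk h + 2 * (t * ?c) + t\<^sup>2 * q"
  proof -
    have d: "\<iota> ((1 - t) *\<^sub>R h + t *\<^sub>R f) z - \<iota> h z = t * (\<iota> f z - \<iota> h z)" for z
      unfolding eval_add eval_scale by (simp add: algebra_simps)
    show ?thesis
      unfolding emp_risk_expand[of n x y "apply_bcontfun (\<iota> ((1 - t) *\<^sub>R h + t *\<^sub>R f))" "apply_bcontfun (\<iota> h)"] d q_def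
      by (simp add: emp_sq_def power_mult_distrib sum_distrib_left mult.left_commute)
  qed
  finally have "0 \<le> t * (2 * ?c + t * q)" by (simp add: power2_eq_square algebra_simps)
  hence "0 \<le> 2 * ?c + t * q" using t by (simp add: zero_le_mult_iff)
  moreover have "t * q \<le> - ?c" using t by (simp add: algebra_simps)
  ultimately show False using c by linarith
qed

text \<open>Strong convexity in the fitted values: excess risk dominates the empirical distance to a
  minimiser. It gives uniqueness, measurability and continuity in the radius.\<close>

lemma minimiser_gap:
  assumes "h \<in> cball 0 r" "\<And>f. f \<in> cball 0 r \<Longrightarrow> risk h \<le> risk f" "f \<in> cball 0 r"
  shows "risk h + esq f h \<le> risk f"
  using minimiser_inner[OF assms] emp_risk_expand[of n x y "apply_bcontfun (\<iota> f)" "apply_bcontfun (\<iota> h)"]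
  by simp

lemma emp_risk_cong: "(\<And>i. i \<in> {1..n} \<Longrightarrow> f (x i) = h (x i)) \<Longrightarrow> emp_risk n x y f = emp_risk n x y h"
  by (simp add: emp_risk_def)

text \<open>The representer theorem, which makes the \<open>THE\<close> in \<open>ls_est\<close>
  meaningful. A minimiser over the compact part of the ball in the span exists; projecting onto the
  span shows that it is optimal in the whole ball.\<close>

lemma ls_est_span_ex1:
  assumes r: "r > 0"
  shows "\<exists>!h. h \<in> cball 0 r \<and> (\<forall>f\<in>cball 0 r. risk h \<le> risk f) \<and>
    h \<in> span {kx. \<exists>i\<in>{1..n}. apply_bcontfun (\<iota> kx) = k (x i)}"
proof -
  have S: "{kx. \<exists>i\<in>{1..n}. apply_bcontfun (\<iota> kx) = k (x i)} = feat ` x ` {1..n}"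
    by (auto simp: eq_feat_iff)
  let ?S = "feat ` x ` {1..n}"
  have fin: "finite ?S" by simp
  have "compact (span ?S \<inter> cball 0 r)" by (rule compact_span_cball[OF fin])
  moreover have "0 \<in> span ?S \<inter> cball 0 r" using r by (simp add: span_zero)
  moreover have "continuous_on (span ?S \<inter> cball 0 r) (\<lambda>h. risk h)"
    unfolding emp_risk_def using n by (intro continuous_intros continuous_on_id) auto
  ultimately obtain h where h: "h \<in> span ?S" "h \<in> cball 0 r"
    and hm: "\<And>f. f \<in> span ?S \<inter> cball 0 r \<Longrightarrow> risk h \<le> risk f"
    using continuous_attains_inf[of "span ?S \<inter> cball 0 r" "\<lambda>h. risk h"] by blast
  have hmin: "risk h \<le> risk f" if f: "f \<in> cball 0 r" for f
  proof -
    obtain p where p: "p \<in> span ?S" "\<And>w. w \<in> span ?S \<Longrightarrow> inner (f - p) w = 0" "norm p \<le> norm f"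
      using span_orthogonal_decomp[OF fin] by blast
    have "\<iota> p (x i) = \<iota> f (x i)" if "i \<in> {1..n}" for i
      using p(2)[of "feat (x i)"] that by (simp add: span_base feat(2) inner_diff_left)
    hence "risk p = risk f" by (rule emp_risk_cong)
    moreover have "risk h \<le> risk p" using p f by (intro hm) auto
    ultimately show ?thesis by simp
  qed
  show ?thesis unfolding S
  proof (rule ex1I[of _ h])
    fix h' assume h': "h' \<in> cball 0 r \<and> (\<forall>f\<in>cball 0 r. risk h' \<le> risk f) \<and> h' \<in> span ?S"
    have "risk h' \<le> risk h" using h' h by blast
    moreover have "risk h + esq h' h \<le> risk h'" using minimiser_gap[OF h(2) hmin] h' by blast
    ultimately have e: "esq h' h \<le> 0" by simp
    \<comment> \<open>Equal risk forces equal fitted values, so h' - h is orthogonal to the span in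
      which it lies.\<close>
    have "inner (h' - h) (feat (x i)) = 0" if i: "i \<in> {1..n}" for i
    proof -
      have "(\<iota> h' (x i) - \<iota> h (x i))\<^sup>2 \<le> real n * esq h' h"
        using emp_sq_term_le[OF i, of "\<lambda>z. \<iota> h' z - \<iota> h z" x] .
      also have "\<dots> \<le> 0" using e by (simp add: mult_le_0_iff)
      finally show ?thesis by (simp add: feat(2) inner_diff_left)
    qed
    hence "orthogonal (h' - h) w" if "w \<in> ?S" for w using that by (auto simp: orthogonal_def)
    moreover have "h' - h \<in> span ?S" using h' h by (simp add: span_diff)
    ultimately have "orthogonal (h' - h) (h' - h)" by (rule orthogonal_to_span[rotated])
    thus "h' = h" by (simp add: orthogonal_self)
  qed (use h hmin in auto)
qed

lemma lse:
  assumes "r \<ge> 0"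
  shows lse_mem: "lse r \<in> cball 0 r" and lse_min: "f \<in> cball 0 r \<Longrightarrow> risk (lse r) \<le> risk f"
proof -
  have "lse r \<in> cball 0 r \<and> (\<forall>f\<in>cball 0 r. risk (lse r) \<le> risk f)"
  proof (cases "r = 0")
    case False
    hence r: "r > 0" using assms by simp
    show ?thesis using theI'[OF ls_est_span_ex1[OF r]] False unfolding ls_est_def by simp
  qed (simp add: ls_est_def)
  thus "lse r \<in> cball 0 r" "f \<in> cball 0 r \<Longrightarrow> risk (lse r) \<le> risk f" by blast+
qed

lemma lse_gap: "r \<ge> 0 \<Longrightarrow> f \<in> cball 0 r \<Longrightarrow> risk (lse r) + esq f (lse r) \<le> risk f"
  using minimiser_gap[OF lse_mem lse_min] by blast

text \<open>First-order optimality in the direction of h discards the residual term, and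
  Cauchy-Schwarz isolates the noise sum. The factor 4 is 2 from completing squares times the
  diameter factor 2 of the ball; the bias keeps factor 1.\<close>

lemma lse_oracle:
  fixes g :: "'s \<Rightarrow>\<^sub>C real"
  assumes r: "r \<ge> 0" and h: "h \<in> cball 0 r"
  shows "esq (lse r) h \<le> 4 * r * norm (\<Sum>i=1..n. (y i - g (x i)) *\<^sub>R feat (x i)) / real n + (norm (\<iota> h - g))\<^sup>2"
proof -
  let ?l = "lse r"
  define a where "a i = \<iota> ?l (x i) - \<iota> h (x i)" for i
  have "0 \<le> (\<Sum>i=1..n. (\<iota> ?l (x i) - y i) * (\<iota> h (x i) - \<iota> ?l (x i))) / real n"
    by (rule minimiser_inner[OF lse_mem[OF r] lse_min[OF r] h])
  hence "0 \<le> (\<Sum>i=1..n. (\<iota> ?l (x i) - y i) * (- a i))" using n by (simp add: a_def zero_le_divide_iff)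
  hence 1: "(\<Sum>i=1..n. (\<iota> ?l (x i) - y i) * a i) \<le> 0" by (simp add: sum_negf)
  \<comment> \<open>The cross term with the bias is split by 2pq \<le> p^2 + q^2, and the resulting
    (a i)^2 is absorbed on the left.\<close>
  have "(\<Sum>i=1..n. (a i)\<^sup>2) \<le> (\<Sum>i=1..n. 2 * ((\<iota> ?l (x i) - y i) * a i) + 2 * ((y i - g (x i)) * a i) + (norm (\<iota> h - g))\<^sup>2)"
  proof (rule sum_mono)
    fix i
    have "\<bar>\<iota> h (x i) - g (x i)\<bar> \<le> norm (\<iota> h - g)"
      using norm_bounded[of "\<iota> h - g" "x i"] by simp
    hence "(g (x i) - \<iota> h (x i))\<^sup>2 \<le> (norm (\<iota> h - g))\<^sup>2"
      by (simp add: abs_le_square_iff[symmetric] abs_minus_commute)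
    moreover have "2 * ((g (x i) - \<iota> h (x i)) * a i) \<le> (g (x i) - \<iota> h (x i))\<^sup>2 + (a i)\<^sup>2"
      using zero_le_power2[of "g (x i) - \<iota> h (x i) - a i"] by (simp add: power2_eq_square algebra_simps)
    moreover have "(a i)\<^sup>2 = (\<iota> ?l (x i) - y i) * a i + (y i - g (x i)) * a i + (g (x i) - \<iota> h (x i)) * a i"
      by (simp add: a_def power2_eq_square algebra_simps)
    ultimately show "(a i)\<^sup>2 \<le> 2 * ((\<iota> ?l (x i) - y i) * a i) + 2 * ((y i - g (x i)) * a i) + (norm (\<iota> h - g))\<^sup>2"
      by linarith
  qed
  also have "\<dots> = 2 * (\<Sum>i=1..n. (\<iota> ?l (x i) - y i) * a i) + 2 * (\<Sum>i=1..n. (y i - g (x i)) * a i) + real n * (norm (\<iota> h - g))\<^sup>2"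
    by (simp add: sum.distrib sum_distrib_left)
  also have "\<dots> \<le> 2 * (\<Sum>i=1..n. (y i - g (x i)) * a i) + real n * (norm (\<iota> h - g))\<^sup>2" using 1 by simp
  also have "(\<Sum>i=1..n. (y i - g (x i)) * a i) = inner (?l - h) (\<Sum>i=1..n. (y i - g (x i)) *\<^sub>R feat (x i))"
    by (simp add: inner_sum_right a_def feat(2) inner_diff_left)
  also have "\<dots> = inner (\<Sum>i=1..n. (y i - g (x i)) *\<^sub>R feat (x i)) (?l - h)"
    by (rule inner_commute)
  also have "\<dots> \<le> norm (\<Sum>i=1..n. (y i - g (x i)) *\<^sub>R feat (x i)) * norm (?l - h)"
    by (rule norm_cauchy_schwarz)
  also have "\<dots> \<le> norm (\<Sum>i=1..n. (y i - g (x i)) *\<^sub>R feat (x i)) * (2 * r)"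
    using lse_mem[OF r] h norm_triangle_ineq4[of ?l h] by (intro mult_left_mono) auto
  finally have "(\<Sum>i=1..n. (a i)\<^sup>2) \<le> 4 * r * norm (\<Sum>i=1..n. (y i - g (x i)) *\<^sub>R feat (x i)) + real n * (norm (\<iota> h - g))\<^sup>2"
    by (simp add: mult_ac)
  from divide_right_mono[OF this, of "real n"] show ?thesis
    using n by (simp add: emp_sq_def a_def add_divide_distrib)
qed

text \<open>The estimator at r, scaled by s / r, competes at radius s. Hence the risks at s and r
  differ by O(r - s), and strong convexity at r turns this into a distance.\<close>

lemma lse_radius_continuity:
  assumes "0 \<le> s" "s < r"
  shows "esq (lse s) (lse r) \<le> (r - s) * sqrt (diag_norm k) * (2 * (\<Sum>i=1..n. r * sqrt (diag_norm k) + \<bar>y i\<bar>) / real n)"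
proof -
  define m where "m = sqrt (diag_norm k)"
  have m: "m > 0" using diag_pos by (simp add: m_def)
  have r: "r \<ge> 0" "r > 0" using assms by auto
  define c where "c = s / r"
  have c: "0 \<le> c" "c \<le> 1" "(1 - c) * r = r - s" using assms by (auto simp: c_def field_simps)
  define a where "a i = \<iota> (lse r) (x i)" for i
  have nr: "norm (lse r) \<le> r" using lse_mem[OF r(1)] by simp
  have ab: "\<bar>a i\<bar> \<le> r * m" for i
    unfolding a_def m_def by (rule order_trans[OF abs_eval_le mult_right_mono[OF nr]]) (simp add: diag_pos less_imp_le)
  have "risk (lse r) + esq (lse s) (lse r) \<le> risk (lse s)"
    using lse_mem[OF assms(1)] assms by (intro lse_gap) auto
  also have "risk (lse s) \<le> risk (c *\<^sub>R lse r)"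
  proof (rule lse_min[OF assms(1)])
    have "c * norm (lse r) \<le> c * r" using nr c by (intro mult_left_mono) auto
    thus "c *\<^sub>R lse r \<in> cball 0 s" using c(1) r assms(1) by (simp add: c_def)
  qed
  finally have "esq (lse s) (lse r) \<le> (\<Sum>i=1..n. (c * a i - y i)\<^sup>2 - (a i - y i)\<^sup>2) / real n"
    by (simp add: emp_risk_def eval_scale a_def sum_subtractf diff_divide_distrib)
  also have "\<dots> \<le> (\<Sum>i=1..n. (r - s) * m * (2 * (r * m + \<bar>y i\<bar>))) / real n"
  proof (intro divide_right_mono sum_mono)
    fix i
    have "(c * a i - y i)\<^sup>2 - (a i - y i)\<^sup>2 = ((1 - c) * a i) * (2 * y i - (c + 1) * a i)"
      by (simp add: power2_eq_square algebra_simps)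
    also have "\<dots> \<le> \<bar>(1 - c) * a i\<bar> * \<bar>2 * y i - (c + 1) * a i\<bar>"
      unfolding abs_mult[symmetric] by (rule abs_ge_self)
    also have "\<dots> \<le> ((r - s) * m) * (2 * (r * m + \<bar>y i\<bar>))"
    proof (rule mult_mono)
      have "(1 - c) * \<bar>a i\<bar> \<le> (1 - c) * (r * m)" using ab c by (intro mult_left_mono) auto
      thus "\<bar>(1 - c) * a i\<bar> \<le> (r - s) * m" using c by (simp add: abs_mult mult.assoc[symmetric])
      have "(c + 1) * \<bar>a i\<bar> \<le> 2 * (r * m)" using ab[of i] c by (intro mult_mono) auto
      moreover have "\<bar>2 * y i - (c + 1) * a i\<bar> \<le> 2 * \<bar>y i\<bar> + (c + 1) * \<bar>a i\<bar>"
        using abs_triangle_ineq4[of "2 * y i" "(c + 1) * a i"] c by (simp add: abs_mult)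
      ultimately have "\<bar>2 * y i - (c + 1) * a i\<bar> \<le> 2 * \<bar>y i\<bar> + 2 * (r * m)" by (rule order_trans[OF _ add_left_mono, rotated])
      thus "\<bar>2 * y i - (c + 1) * a i\<bar> \<le> 2 * (r * m + \<bar>y i\<bar>)" by (simp add: distrib_left)
    qed (use assms m in auto)
    finally show "(c * a i - y i)\<^sup>2 - (a i - y i)\<^sup>2 \<le> (r - s) * m * (2 * (r * m + \<bar>y i\<bar>))" .
  qed simp
  also have "\<dots> = (r - s) * m * (2 * (\<Sum>i=1..n. r * m + \<bar>y i\<bar>) / real n)"
    by (simp add: sum_distrib_left)
  finally show ?thesis unfolding m_def .
qed

lemma esq_tendsto_0D:
  assumes "(\<lambda>m. esq (f m) h) \<longlonglongrightarrow> 0" and i: "i \<in> {1..n}"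
  shows "(\<lambda>m. \<iota> (f m) (x i)) \<longlonglongrightarrow> \<iota> h (x i)"
proof -
  have "(\<lambda>m. real n * esq (f m) h) \<longlonglongrightarrow> real n * 0" by (intro tendsto_intros assms)
  hence "(\<lambda>m. real n * esq (f m) h) \<longlonglongrightarrow> 0" by simp
  hence "(\<lambda>m. (\<iota> (f m) (x i) - \<iota> h (x i))\<^sup>2) \<longlonglongrightarrow> 0"
    by (rule Lim_null_comparison[rotated])
       (use emp_sq_term_le[OF i] in \<open>auto intro!: always_eventually\<close>)
  from tendsto_real_sqrt[OF this]
  have "(\<lambda>m. \<iota> (f m) (x i) - \<iota> h (x i)) \<longlonglongrightarrow> 0" by (simp add: tendsto_rabs_zero_iff)
  thus ?thesis by (rule LIM_zero_cancel)
qed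

text \<open>Right-continuity is what the events need, since real radii are approached by rational
  ones from above.\<close>

lemma lse_radius_tendsto:
  assumes r: "r \<ge> 0" and s: "\<And>m. s m > r" "s \<longlonglongrightarrow> r" and i: "i \<in> {1..n}"
  shows "(\<lambda>m. \<iota> (lse (s m)) (x i)) \<longlonglongrightarrow> \<iota> (lse r) (x i)"
proof (rule esq_tendsto_0D[OF _ i])
  have sym: "esq f h = esq h f" for f h unfolding emp_sq_def by (simp add: power2_commute)
  have "(\<lambda>m. (s m - r) * sqrt (diag_norm k) * (2 * (\<Sum>i=1..n. s m * sqrt (diag_norm k) + \<bar>y i\<bar>) / real n)) \<longlonglongrightarrow>
    (r - r) * sqrt (diag_norm k) * (2 * (\<Sum>i=1..n. r * sqrt (diag_norm k) + \<bar>y i\<bar>) / real n)"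
    using n by (intro tendsto_intros s) auto
  hence "(\<lambda>m. (s m - r) * sqrt (diag_norm k) * (2 * (\<Sum>i=1..n. s m * sqrt (diag_norm k) + \<bar>y i\<bar>) / real n)) \<longlonglongrightarrow> 0"
    by simp
  thus "(\<lambda>m. esq (lse (s m)) (lse r)) \<longlonglongrightarrow> 0"
    by (rule Lim_null_comparison[rotated])
       (intro always_eventually allI, simp only: real_norm_def abs_of_nonneg[OF emp_sq_nonneg]
         sym[of "lse (s _)"] lse_radius_continuity[OF r s(1)])
qed

end

section \<open>Measurability of the events\<close>

context measurable_rkhs
begin

definition clip_dev :: "real \<Rightarrow> nat \<Rightarrow> (nat \<Rightarrow> 's) \<Rightarrow> 'h \<Rightarrow> 'h \<Rightarrow> real" where
  "clip_dev C n x f1 f2 = emp_sq n x (\<lambda>z. clip C (\<iota> f1 z) - clip C (\<iota> f2 z))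
     - pop_sq P (\<lambda>z. clip C (\<iota> f1 z) - clip C (\<iota> f2 z))"

lemma abs_clip_dev_le:
  assumes "C \<ge> 0" shows "\<bar>clip_dev C n x f1 f2\<bar> \<le> 4 * C\<^sup>2"
proof -
  have "emp_sq n x (\<lambda>z. clip C (\<iota> f1 z) - clip C (\<iota> f2 z)) \<le> (2 * C)\<^sup>2"
    by (rule emp_sq_le_const) (rule abs_clip_clip_le[OF assms])
  hence "emp_sq n x (\<lambda>z. clip C (\<iota> f1 z) - clip C (\<iota> f2 z)) \<le> 4 * C\<^sup>2"
    by (simp add: power_mult_distrib)
  moreover have "0 \<le> emp_sq n x (\<lambda>z. clip C (\<iota> f1 z) - clip C (\<iota> f2 z))" by (rule emp_sq_nonneg)
  moreover have "0 \<le> pop_sq P (\<lambda>z. clip C (\<iota> f1 z) - clip C (\<iota> f2 z))"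
    unfolding pop_sq_def by simp
  moreover have "pop_sq P (\<lambda>z. clip C (\<iota> f1 z) - clip C (\<iota> f2 z)) \<le> (\<integral>z. 4 * C\<^sup>2 \<partial>P)"
    unfolding pop_sq_def
    by (intro integral_mono integrable_const_bound[of _ "4 * C\<^sup>2"] AE_I2)
       (auto simp: clip_sq_le[OF assms])
  hence "pop_sq P (\<lambda>z. clip C (\<iota> f1 z) - clip C (\<iota> f2 z)) \<le> 4 * C\<^sup>2" by (simp add: prob_space)
  ultimately show ?thesis unfolding clip_dev_def by linarith
qed

lemma tendsto_clip_dev:
  assumes C: "C \<ge> 0" and n: "n \<ge> 1" and f: "f1 \<longlonglongrightarrow> l1" "f2 \<longlonglongrightarrow> l2"
  shows "(\<lambda>m. clip_dev C n x (f1 m) (f2 m)) \<longlonglongrightarrow> clip_dev C n x l1 l2"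
proof -
  have "(\<lambda>m. pop_sq P (\<lambda>z. clip C (\<iota> (f1 m) z) - clip C (\<iota> (f2 m) z))) \<longlonglongrightarrow>
    pop_sq P (\<lambda>z. clip C (\<iota> l1 z) - clip C (\<iota> l2 z))"
    unfolding pop_sq_def
  proof (rule integral_dominated_convergence)
    show "integrable P (\<lambda>_. 4 * C\<^sup>2)" by simp
    show "AE z in P. (\<lambda>m. (clip C (\<iota> (f1 m) z) - clip C (\<iota> (f2 m) z))\<^sup>2) \<longlonglongrightarrow> (clip C (\<iota> l1 z) - clip C (\<iota> l2 z))\<^sup>2"
      by (intro AE_I2 tendsto_intros f)
    show "AE z in P. norm ((clip C (\<iota> (f1 m) z) - clip C (\<iota> (f2 m) z))\<^sup>2) \<le> 4 * C\<^sup>2" for m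
      by (intro AE_I2) (simp add: clip_sq_le[OF C])
  qed measurable
  thus ?thesis unfolding clip_dev_def emp_sq_def using n by (intro tendsto_intros f) auto
qed

text \<open>A supremum of reals controls its terms only when the family is bounded above; clipping
  provides the bound 4 C^2.\<close>

lemma event_A2_sup_iff:
  assumes "C \<ge> 0" "r \<ge> 0"
  shows "(SUP (f1, f2)\<in>cball 0 r \<times> cball 0 r. \<bar>clip_dev C n x f1 f2\<bar>) \<le> b \<longleftrightarrow>
    (\<forall>f1\<in>cball 0 r. \<forall>f2\<in>cball 0 r. \<bar>clip_dev C n x f1 f2\<bar> \<le> b)"
proof -
  have "bdd_above ((\<lambda>(f1, f2). \<bar>clip_dev C n x f1 f2\<bar>) ` (cball 0 r \<times> cball 0 r))"
    by (rule bdd_aboveI[of _ "4 * C\<^sup>2"]) (auto simp: abs_clip_dev_le[OF assms(1)])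
  moreover have "cball (0::'h) r \<times> cball (0::'h) r \<noteq> {}" using assms(2) by auto
  ultimately show ?thesis by (subst cSUP_le_iff) auto
qed

text \<open>Deviation and bound are continuous, so dense points and rational radii suffice. The
  radii decrease to r, which leaves room for dense points approximating functions on the boundary of
  the ball.\<close>

lemma event_A2_iff:
  fixes d :: "nat \<Rightarrow> 'h"
  assumes d: "\<And>h e. e > 0 \<Longrightarrow> \<exists>j. dist (d j) h < e" and C: "C > 0" and n: "n \<ge> 1"
  shows "event_A2 M P \<iota> k C n X t = {\<omega>\<in>space M. \<forall>q::rat. \<forall>j1 j2.
     0 < q \<longrightarrow> norm (d j1) \<le> of_rat q \<longrightarrow> norm (d j2) \<le> of_rat q \<longrightarrow>
     \<bar>clip_dev C n (\<lambda>i. X i \<omega>) (d j1) (d j2)\<bar> \<le>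
       97 * sqrt (diag_norm k) * C * of_rat q * sqrt t / sqrt (real n)
            + 8 * sqrt (diag_norm k) * C * of_rat q * t / (3 * real n)}"
    (is "_ = {\<omega>\<in>space M. \<forall>q j1 j2. _ \<longrightarrow> _ \<longrightarrow> _ \<longrightarrow> _ \<le> ?b (of_rat q)}")
proof -
  have "(\<forall>r\<ge>0. (SUP (f1, f2)\<in>cball 0 r \<times> cball 0 r. \<bar>clip_dev C n x f1 f2\<bar>) \<le> ?b r) \<longleftrightarrow>
    (\<forall>q::rat. \<forall>j1 j2. 0 < q \<longrightarrow> norm (d j1) \<le> of_rat q \<longrightarrow> norm (d j2) \<le> of_rat q \<longrightarrow>
     \<bar>clip_dev C n x (d j1) (d j2)\<bar> \<le> ?b (of_rat q))" (is "?L \<longleftrightarrow> ?R") for x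
  proof
    assume ?L
    show ?R
    proof (intro allI impI)
      fix q :: rat and j1 j2 assume q: "0 < q" "norm (d j1) \<le> of_rat q" "norm (d j2) \<le> of_rat q"
      have q0: "(of_rat q :: real) \<ge> 0" using q by (simp add: zero_le_of_rat_iff)
      show "\<bar>clip_dev C n x (d j1) (d j2)\<bar> \<le> ?b (of_rat q)"
        using \<open>?L\<close>[rule_format, OF q0] q C unfolding event_A2_sup_iff[OF less_imp_le[OF C] q0] by auto
    qed
  next
    assume R: ?R
    show ?L
    proof (intro allI impI)
      fix r :: real assume r: "r \<ge> 0"
      show "(SUP (f1, f2)\<in>cball 0 r \<times> cball 0 r. \<bar>clip_dev C n x f1 f2\<bar>) \<le> ?b r"
        unfolding event_A2_sup_iff[OF less_imp_le[OF C] r]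
      proof (intro ballI)
        fix f1 f2 :: 'h assume f: "f1 \<in> cball 0 r" "f2 \<in> cball 0 r"
        obtain q :: "nat \<Rightarrow> rat" where q: "\<And>m. of_rat (q m) > r" "(\<lambda>m. of_rat (q m) :: real) \<longlonglongrightarrow> r"
          and qj: "\<And>h. h \<in> cball (0::'h) r \<Longrightarrow> \<exists>j. (\<forall>m. norm (d (j m)) \<le> of_rat (q m)) \<and> (\<lambda>m. d (j m)) \<longlonglongrightarrow> h"
          using radius_sequence[OF d r] by blast
        obtain j1 j2 where j: "\<And>m. norm (d (j1 m)) \<le> of_rat (q m)" "(\<lambda>m. d (j1 m)) \<longlonglongrightarrow> f1"
          "\<And>m. norm (d (j2 m)) \<le> of_rat (q m)" "(\<lambda>m. d (j2 m)) \<longlonglongrightarrow> f2"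
          using qj[OF f(1)] qj[OF f(2)] by blast
        have q0: "0 < q m" for m
          using order_le_less_trans[OF r q(1)[of m]] by (simp add: zero_less_of_rat_iff)
        show "\<bar>clip_dev C n x f1 f2\<bar> \<le> ?b r"
        proof (rule LIMSEQ_le)
          show "(\<lambda>m. \<bar>clip_dev C n x (d (j1 m)) (d (j2 m))\<bar>) \<longlonglongrightarrow> \<bar>clip_dev C n x f1 f2\<bar>"
            using C n j by (intro tendsto_rabs tendsto_clip_dev) auto
          show "(\<lambda>m. ?b (of_rat (q m))) \<longlonglongrightarrow> ?b r"
            using n by (intro tendsto_intros q) auto
          show "\<exists>N. \<forall>m\<ge>N. \<bar>clip_dev C n x (d (j1 m)) (d (j2 m))\<bar> \<le> ?b (of_rat (q m))"
            using R q0 j by blast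
        qed
      qed
    qed
  qed
  thus ?thesis unfolding event_A2_def clip_dev_def[symmetric] by simp
qed

end

section \<open>Measurability for a random sample\<close>

locale sample = measurable_rkhs \<iota> k P
  for \<iota> :: "'h::{real_inner,complete_space} \<Rightarrow> 's::topological_space \<Rightarrow>\<^sub>C real" and k and P +
  fixes M :: "'w measure" and n :: nat and X :: "nat \<Rightarrow> 'w \<Rightarrow> 's" and Y :: "nat \<Rightarrow> 'w \<Rightarrow> real"
  assumes n: "n \<ge> 1"
    and X_meas [measurable]: "\<And>i. i \<in> {1..n} \<Longrightarrow> X i \<in> measurable M P"
    and Y_meas [measurable]: "\<And>i. i \<in> {1..n} \<Longrightarrow> Y i \<in> borel_measurable M"
begin

lemma data: "ls_data \<iota> k n" by unfold_locales (rule n)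

lemma eval_X_measurable: "i \<in> {1..n} \<Longrightarrow> (\<lambda>\<omega>. \<iota> h (X i \<omega>)) \<in> borel_measurable M"
  by (rule measurable_compose[OF X_meas eval_measurable])

lemma risk_measurable: "(\<lambda>\<omega>. emp_risk n (\<lambda>i. X i \<omega>) (\<lambda>i. Y i \<omega>) (\<iota> h)) \<in> borel_measurable M"
  unfolding emp_risk_def
  by (intro borel_measurable_divide borel_measurable_sum borel_measurable_power borel_measurable_diff
      eval_X_measurable Y_meas borel_measurable_const)

text \<open>
  The fitted values are limits of those of the first near-minimiser in a countable dense set, by strong
  convexity of the risk in the fitted values.
\<close>

lemma fitted_measurable:
  assumes r: "r \<ge> 0" and i: "i \<in> {1..n}"
  shows "(\<lambda>\<omega>. \<iota> (ls_est \<iota> k n (\<lambda>i. X i \<omega>) (\<lambda>i. Y i \<omega>) r) (X i \<omega>)) \<in> borel_measurable M"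
proof (cases "r = 0")
  case False
  hence r0: "r > 0" using r by simp
  obtain d :: "nat \<Rightarrow> 'h" where d: "\<And>h e. e > 0 \<Longrightarrow> \<exists>j. dist (d j) h < e" by (rule dense_sequence) blast
  define R where "R \<omega> j = emp_risk n (\<lambda>i. X i \<omega>) (\<lambda>i. Y i \<omega>) (\<iota> (d j))" for \<omega> j
  have [measurable]: "(\<lambda>\<omega>. R \<omega> j) \<in> borel_measurable M" for j
    unfolding R_def by (rule risk_measurable)
  \<comment> \<open>Near-optimality is judged within the countable family only, which keeps it a
    measurable condition; \<open>near\<close> shows that this family comes arbitrarily close to any
    risk in the ball.\<close>
  define good where "good m \<omega> j \<longleftrightarrow> norm (d j) \<le> r \<and>
    (\<forall>j'. norm (d j') \<le> r \<longrightarrow> R \<omega> j \<le> R \<omega> j' + 1 / real (Suc m))" for m \<omega> j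
  have [measurable]: "Measurable.pred M (\<lambda>\<omega>. good m \<omega> j)" for m j
    unfolding good_def by measurable
  define J where "J m \<omega> = (LEAST j. good m \<omega> j)" for m \<omega>
  have J_meas [measurable]: "J m \<in> measurable M (count_space UNIV)" for m
    unfolding J_def by measurable
  have near: "\<exists>j. norm (d j) \<le> r \<and> R \<omega> j < emp_risk n (\<lambda>i. X i \<omega>) (\<lambda>i. Y i \<omega>) (\<iota> h) + e"
    if h: "h \<in> cball 0 r" and e: "e > 0" for h e \<omega>
  proof -
    obtain j where j: "\<And>m. norm (d (j m)) \<le> r" "(\<lambda>m. d (j m)) \<longlonglongrightarrow> h"
      using ball_sequence[OF d r0 h] by blast
    have "(\<lambda>m. R \<omega> (j m)) \<longlonglongrightarrow> emp_risk n (\<lambda>i. X i \<omega>) (\<lambda>i. Y i \<omega>) (\<iota> h)"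
      unfolding R_def emp_risk_def using n by (intro tendsto_intros j) auto
    hence "eventually (\<lambda>m. R \<omega> (j m) < emp_risk n (\<lambda>i. X i \<omega>) (\<lambda>i. Y i \<omega>) (\<iota> h) + e) sequentially"
      using e by (intro order_tendstoD) auto
    then obtain m where "R \<omega> (j m) < emp_risk n (\<lambda>i. X i \<omega>) (\<lambda>i. Y i \<omega>) (\<iota> h) + e"
      using eventually_happens'[OF sequentially_bot] by blast
    thus ?thesis using j by blast
  qed
  have lim: "(\<lambda>m. \<iota> (d (J m \<omega>)) (X i \<omega>)) \<longlonglongrightarrow> \<iota> (ls_est \<iota> k n (\<lambda>i. X i \<omega>) (\<lambda>i. Y i \<omega>) r) (X i \<omega>)" for \<omega>
  proof -
    interpret ls_data \<iota> k n "\<lambda>i. X i \<omega>" "\<lambda>i. Y i \<omega>" by (rule data)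
    have "\<exists>j. good m \<omega> j" for m
    proof -
      obtain j where j: "norm (d j) \<le> r" "R \<omega> j < risk (lse r) + 1 / real (Suc m)"
        using near[OF lse_mem[OF r], of "1 / real (Suc m)"] by auto
      have "R \<omega> j \<le> R \<omega> j' + 1 / real (Suc m)" if "norm (d j') \<le> r" for j'
        using j(2) lse_min[OF r, of "d j'"] that unfolding R_def by simp
      thus ?thesis using j(1) unfolding good_def by blast
    qed
    hence Jg: "good m \<omega> (J m \<omega>)" for m unfolding J_def by (rule LeastI_ex)
    have "esq (d (J m \<omega>)) (lse r) \<le> 1 / real (Suc m)" for m
    proof -
      have "R \<omega> (J m \<omega>) \<le> risk (lse r) + 1 / real (Suc m)"
      proof (rule field_le_epsilon)
        fix e :: real assume "e > 0"
        then obtain j where "norm (d j) \<le> r" "R \<omega> j < risk (lse r) + e"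
          using near[OF lse_mem[OF r]] by blast
        thus "R \<omega> (J m \<omega>) \<le> risk (lse r) + 1 / real (Suc m) + e"
          using Jg[of m] unfolding good_def by (smt (verit))
      qed
      moreover have "risk (lse r) + esq (d (J m \<omega>)) (lse r) \<le> R \<omega> (J m \<omega>)"
        using lse_gap[OF r, of "d (J m \<omega>)"] Jg[of m] unfolding good_def R_def by simp
      ultimately show ?thesis by simp
    qed
    hence "(\<lambda>m. esq (d (J m \<omega>)) (lse r)) \<longlonglongrightarrow> 0"
      by (intro Lim_null_comparison[OF _ LIMSEQ_Suc[OF lim_1_over_n]] always_eventually allI)
         (simp only: real_norm_def abs_of_nonneg[OF emp_sq_nonneg])
    thus ?thesis using i by (rule esq_tendsto_0D)
  qed
  show ?thesis
  proof (rule borel_measurable_LIMSEQ_real[OF lim])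
    fix m
    show "(\<lambda>\<omega>. \<iota> (d (J m \<omega>)) (X i \<omega>)) \<in> borel_measurable M"
      by (rule measurable_compose_countable[OF eval_X_measurable[OF i] J_meas])
  qed
qed (simp add: ls_est_def)

lemma event_A2_sets:
  assumes "C > 0" shows "event_A2 M P \<iota> k C n X t \<in> sets M"
proof -
  obtain d :: "nat \<Rightarrow> 'h" where d: "\<And>h e. e > 0 \<Longrightarrow> \<exists>j. dist (d j) h < e" by (rule dense_sequence) blast
  have [measurable]: "(\<lambda>\<omega>. clip_dev C n (\<lambda>i. X i \<omega>) f1 f2) \<in> borel_measurable M" for f1 f2
    unfolding clip_dev_def emp_sq_def
    by (intro borel_measurable_divide borel_measurable_sum borel_measurable_power borel_measurable_diff
      measurable_compose[OF eval_X_measurable clip_measurable] borel_measurable_const)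
  show ?thesis by (subst event_A2_iff[where d = d, OF d assms n]) measurable
qed

lemma event_A1_sets:
  fixes g :: "'s \<Rightarrow>\<^sub>C real"
  shows "event_A1 M \<iota> k g \<sigma> n X Y t \<in> sets M"
proof -
  obtain d :: "nat \<Rightarrow> 'h" where d: "\<And>h e. e > 0 \<Longrightarrow> \<exists>j. dist (d j) h < e" by (rule dense_sequence) blast
  define F where "F \<omega> r h = emp_sq n (\<lambda>i. X i \<omega>) (\<lambda>z. \<iota> (ls_est \<iota> k n (\<lambda>i. X i \<omega>) (\<lambda>i. Y i \<omega>) r) z - \<iota> h z)" for \<omega> r h
  define b where "b r h = 20 * sqrt (diag_norm k) * \<sigma> * r * sqrt t / sqrt (real n) + 4 * (norm (\<iota> h - g))\<^sup>2" for r h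
  have Fm: "(\<lambda>\<omega>. F \<omega> r h) \<in> borel_measurable M" if "r \<ge> 0" for r h
    unfolding F_def emp_sq_def using that
    by (intro borel_measurable_divide borel_measurable_sum borel_measurable_power borel_measurable_diff
      fitted_measurable eval_X_measurable borel_measurable_const)
  \<comment> \<open>For the positive q that matter \<open>max 0\<close> changes nothing. It makes
    the radius nonnegative for every rational, so that each member of the countable family is
    measurable.\<close>
  have "(\<forall>r\<ge>0. \<forall>h\<in>cball 0 r. F \<omega> r h \<le> b r h) \<longleftrightarrow>
    (\<forall>q::rat. \<forall>j. 0 < q \<longrightarrow> norm (d j) \<le> of_rat q \<longrightarrow> F \<omega> (max 0 (of_rat q)) (d j) \<le> b (of_rat q) (d j))" (is "?L \<longleftrightarrow> ?R") for \<omega>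
  proof
    assume L: ?L
    show ?R
    proof (intro allI impI)
      fix q :: rat and j assume q: "0 < q" "norm (d j) \<le> of_rat q"
      hence "(0::real) \<le> of_rat q" by (simp add: zero_le_of_rat_iff)
      thus "F \<omega> (max 0 (of_rat q)) (d j) \<le> b (of_rat q) (d j)" using L q by (simp add: max_def)
    qed
  next
    assume R: ?R
    interpret ls_data \<iota> k n "\<lambda>i. X i \<omega>" "\<lambda>i. Y i \<omega>" by (rule data)
    show ?L
    proof (intro allI impI ballI)
      fix r and h :: 'h assume r: "r \<ge> 0" and h: "h \<in> cball 0 r"
      obtain q :: "nat \<Rightarrow> rat" where q: "\<And>m. of_rat (q m) > r" "(\<lambda>m. of_rat (q m) :: real) \<longlonglongrightarrow> r"
        and qj: "\<And>h. h \<in> cball (0::'h) r \<Longrightarrow> \<exists>j. (\<forall>m. norm (d (j m)) \<le> of_rat (q m)) \<and> (\<lambda>m. d (j m)) \<longlonglongrightarrow> h"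
        using radius_sequence[OF d r] by blast
      obtain j where j: "\<And>m. norm (d (j m)) \<le> of_rat (q m)" "(\<lambda>m. d (j m)) \<longlonglongrightarrow> h"
        using qj[OF h] by blast
      have qpos: "(0::real) < of_rat (q m)" for m using order_le_less_trans[OF r q(1)[of m]] .
      hence q0: "0 < q m" for m by (simp add: zero_less_of_rat_iff)
      show "F \<omega> r h \<le> b r h"
      proof (rule LIMSEQ_le)
        show "(\<lambda>m. F \<omega> (of_rat (q m)) (d (j m))) \<longlonglongrightarrow> F \<omega> r h"
          unfolding F_def emp_sq_def using n
          by (intro tendsto_intros lse_radius_tendsto r q j) auto
        show "(\<lambda>m. b (of_rat (q m)) (d (j m))) \<longlonglongrightarrow> b r h"
          unfolding b_def using n by (intro tendsto_intros q j) auto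
        show "\<exists>N. \<forall>m\<ge>N. F \<omega> (of_rat (q m)) (d (j m)) \<le> b (of_rat (q m)) (d (j m))"
        proof (intro exI allI impI)
          fix m show "F \<omega> (of_rat (q m)) (d (j m)) \<le> b (of_rat (q m)) (d (j m))"
            using R[rule_format, OF q0[of m] j(1)[of m]] unfolding max_absorb2[OF less_imp_le[OF qpos[of m]]] .
        qed
      qed
    qed
  qed
  note iff = this
  have "event_A1 M \<iota> k g \<sigma> n X Y t = {\<omega>\<in>space M. \<forall>r\<ge>0. \<forall>h\<in>cball 0 r. F \<omega> r h \<le> b r h}"
    unfolding event_A1_def F_def b_def ..
  also have "\<dots> = {\<omega>\<in>space M. \<forall>q::rat. \<forall>j. 0 < q \<longrightarrow> norm (d j) \<le> of_rat q \<longrightarrow>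
    F \<omega> (max 0 (of_rat q)) (d j) \<le> b (of_rat q) (d j)}"
    by (simp only: iff)
  also have "\<dots> \<in> sets M"
  proof -
    have [measurable]: "(\<lambda>\<omega>. F \<omega> (max 0 q) h) \<in> borel_measurable M" for q h by (rule Fm) simp
    show ?thesis by measurable
  qed
  finally show ?thesis .
qed

end

section \<open>Probability of the events\<close>

text \<open>
  Levels above \<open>m\<close>, the bound on the unit ball, are capped: there nothing is clipped, and small radii scale
  to the cap.
\<close>

definition clip_param :: "real \<Rightarrow> real \<Rightarrow> (nat \<Rightarrow> 'h::real_normed_vector) \<Rightarrow> rat \<times> nat \<times> nat \<Rightarrow> real \<times> 'h \<times> 'h" where
  "clip_param C m d = (\<lambda>(q, i, j). (min (C / of_rat q) m / m, (1 / of_rat q) *\<^sub>R d i, (1 / of_rat q) *\<^sub>R d j))"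

definition param_set :: "(nat \<Rightarrow> 'h::real_normed_vector) \<Rightarrow> (rat \<times> nat \<times> nat) set" where
  "param_set d = {(q, i, j). 0 < q \<and> norm (d i) \<le> of_rat q \<and> norm (d j) \<le> of_rat q}"

section \<open>The clipped empirical process\<close>

context measurable_rkhs
begin

text \<open>The sign s splits an absolute deviation into two one-sided suprema. The level is stored
  relative to \<open>sqrt (diag_norm k)\<close>, so all three parameters range over unit
  balls.\<close>

definition signed_quot :: "real \<Rightarrow> real \<Rightarrow> real \<times> 'h \<times> 'h \<Rightarrow> 's \<Rightarrow> real" where
  "signed_quot s C \<theta> x = s * (C * clip_quot (fst \<theta> * sqrt (diag_norm k)) (\<iota> (fst (snd \<theta>)) x) (\<iota> (snd (snd \<theta>)) x))"

text \<open>The factor \<open>12\<close> is the Lipschitz constant \<open>4\<close> times the number of coordinates averaged over.\<close>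

definition coord_feat :: "real \<Rightarrow> nat \<Rightarrow> 's \<Rightarrow> real \<times> 'h \<times> 'h" where
  "coord_feat C j x = (12 * C) *\<^sub>R (if j = 0 then (sqrt (diag_norm k), 0, 0) else if j = 1 then (0, feat x, 0) else (0, 0, feat x))"

context
  fixes d :: "nat \<Rightarrow> 'h" and C s :: real
  assumes d: "\<And>h e. e > 0 \<Longrightarrow> \<exists>j. dist (d j) h < e" and C: "C > 0" and s: "\<bar>s\<bar> = 1"
begin

abbreviation "\<kappa> \<equiv> sqrt (diag_norm k)"
abbreviation "\<Theta> \<equiv> clip_param C \<kappa> d ` param_set d"

lemma \<kappa>_pos: "\<kappa> > 0" using diag_pos by simp

lemma param_cases:
  assumes "\<theta> \<in> \<Theta>"
  obtains q i j where "(q::real) > 0" "norm (d i) \<le> q" "norm (d j) \<le> q"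
    "\<theta> = (min (C / q) \<kappa> / \<kappa>, (1 / q) *\<^sub>R d i, (1 / q) *\<^sub>R d j)"
proof -
  obtain q i j where "(0::rat) < q" "norm (d i) \<le> of_rat q" "norm (d j) \<le> of_rat q"
    "\<theta> = clip_param C \<kappa> d (q, i, j)"
    using assms by (auto simp: param_set_def)
  thus ?thesis by (intro that[of "of_rat q" i j]) (auto simp: clip_param_def)
qed

lemma param_bounds:
  assumes "\<theta> \<in> \<Theta>"
  shows "0 < fst \<theta>" "fst \<theta> \<le> 1" "norm (fst (snd \<theta>)) \<le> 1" "norm (snd (snd \<theta>)) \<le> 1"
  using assms
  by (rule param_cases, use \<kappa>_pos C in \<open>auto simp: min_def field_simps\<close>)+

text \<open>Three coordinates of norm at most 1 give the radius \<open>sqrt 3\<close>;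
  \<open>coord_feat\<close> has norm at most 12 C \<kappa>, whose square is 144 C^2
  \<open>diag_norm k\<close>; and \<open>clip_quot_le\<close> with arguments bounded by \<kappa>
  gives 4 C \<kappa>.\<close>

lemma signed_quot_process: "contraction_process P \<Theta> (signed_quot s C) {0, 1, 2} (coord_feat C) (sqrt 3) (144 * C\<^sup>2 * diag_norm k) (4 * C * \<kappa>)"
proof
  show "countable \<Theta>" by (intro countable_image) (rule countableI_type)
  obtain j where "dist (d j) 0 < 1" using d[of 1 0] by auto
  hence "(1, j, j) \<in> param_set d" by (simp add: param_set_def)
  thus "\<Theta> \<noteq> {}" by blast
  show "norm \<theta> \<le> sqrt 3" if t: "\<theta> \<in> \<Theta>" for \<theta>
  proof -
    note b = param_bounds[OF t]
    obtain a f1 f2 where \<theta>: "\<theta> = (a, f1, f2)" by (cases \<theta>)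
    have "a\<^sup>2 \<le> 1" "(norm f1)\<^sup>2 \<le> 1" "(norm f2)\<^sup>2 \<le> 1"
      using b unfolding \<theta> by (auto simp: power_le_one)
    hence "a\<^sup>2 + ((norm f1)\<^sup>2 + (norm f2)\<^sup>2) \<le> 3" by simp
    thus ?thesis unfolding \<theta> by (simp add: norm_Pair)
  qed
  show "signed_quot s C \<theta> \<in> borel_measurable P" for \<theta>
    unfolding signed_quot_def[abs_def] clip_quot_def by measurable
  show "\<bar>signed_quot s C \<theta> x\<bar> \<le> 4 * C * \<kappa>" if t: "\<theta> \<in> \<Theta>" for \<theta> x
  proof -
    note b = param_bounds[OF t]
    have "\<bar>\<iota> f x\<bar> \<le> \<kappa>" if "norm f \<le> 1" for f
      using order_trans[OF abs_eval_le mult_right_mono[OF that less_imp_le[OF \<kappa>_pos]], of x] by simp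
    hence "clip_quot (fst \<theta> * \<kappa>) (\<iota> (fst (snd \<theta>)) x) (\<iota> (snd (snd \<theta>)) x) \<le> 4 * \<kappa>"
      using b \<kappa>_pos by (intro clip_quot_le) auto
    moreover have "clip_quot (fst \<theta> * \<kappa>) (\<iota> (fst (snd \<theta>)) x) (\<iota> (snd (snd \<theta>)) x) \<ge> 0"
      using b \<kappa>_pos by (intro clip_quot_nonneg) auto
    ultimately show ?thesis using s C by (simp add: signed_quot_def abs_mult)
  qed
  show "(\<lambda>x. inner (coord_feat C j x) \<theta>) \<in> borel_measurable P" for j \<theta>
  proof -
    obtain a f1 f2 where \<theta>: "\<theta> = (a, f1, f2)" by (cases \<theta>)
    have "inner (coord_feat C j x) \<theta> = (if j = 0 then 12 * C * (\<kappa> * a) else if j = 1 then 12 * C * \<iota> f1 x else 12 * C * \<iota> f2 x)" for x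
      by (simp add: \<theta> coord_feat_def feat(2) inner_commute)
    thus ?thesis by (cases "j = 0"; cases "j = 1") auto
  qed
  show "(norm (coord_feat C j x))\<^sup>2 \<le> 144 * C\<^sup>2 * diag_norm k" for j x
    using norm_feat_sq_le[of x] diag_pos C
    by (auto simp: coord_feat_def norm_Pair power_mult_distrib intro!: mult_left_mono)
  show "\<bar>signed_quot s C \<theta> x - signed_quot s C \<theta>' x\<bar> \<le>
      (\<Sum>j\<in>{0, 1, 2}. \<bar>inner (coord_feat C j x) (\<theta> - \<theta>')\<bar>) / real (card {0, 1, 2::nat})"
    if t: "\<theta> \<in> \<Theta>" "\<theta>' \<in> \<Theta>" for \<theta> \<theta>' x
  proof -
    obtain a f1 f2 where \<theta>: "\<theta> = (a, f1, f2)" by (cases \<theta>)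
    obtain a' f1' f2' where \<theta>': "\<theta>' = (a', f1', f2')" by (cases \<theta>')
    have a: "a * \<kappa> > 0" "a' * \<kappa> > 0"
      using param_bounds[OF t(1)] param_bounds[OF t(2)] \<kappa>_pos unfolding \<theta> \<theta>' by auto
    \<comment> \<open>The level is changed first, then the two functions at the new level.\<close>
    have "\<bar>clip_quot (a * \<kappa>) (\<iota> f1 x) (\<iota> f2 x) - clip_quot (a' * \<kappa>) (\<iota> f1' x) (\<iota> f2' x)\<bar> \<le>
      4 * \<bar>a * \<kappa> - a' * \<kappa>\<bar> + 4 * (\<bar>\<iota> f1 x - \<iota> f1' x\<bar> + \<bar>\<iota> f2 x - \<iota> f2' x\<bar>)"
      using clip_quot_lipschitz_level[OF a, of "\<iota> f1 x" "\<iota> f2 x"]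
        clip_quot_lipschitz_arg[OF a(2), of "\<iota> f1 x" "\<iota> f2 x" "\<iota> f1' x" "\<iota> f2' x"] by linarith
    hence "C * \<bar>clip_quot (a * \<kappa>) (\<iota> f1 x) (\<iota> f2 x) - clip_quot (a' * \<kappa>) (\<iota> f1' x) (\<iota> f2' x)\<bar> \<le>
      C * (4 * \<bar>a * \<kappa> - a' * \<kappa>\<bar> + 4 * (\<bar>\<iota> f1 x - \<iota> f1' x\<bar> + \<bar>\<iota> f2 x - \<iota> f2' x\<bar>))"
      using C by (intro mult_left_mono) auto
    moreover have "\<bar>signed_quot s C \<theta> x - signed_quot s C \<theta>' x\<bar> =
      C * \<bar>clip_quot (a * \<kappa>) (\<iota> f1 x) (\<iota> f2 x) - clip_quot (a' * \<kappa>) (\<iota> f1' x) (\<iota> f2' x)\<bar>"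
    proof -
      have "\<bar>s * (C * p) - s * (C * r)\<bar> = \<bar>s\<bar> * (C * \<bar>p - r\<bar>)" for p r
        using C by (simp add: right_diff_distrib[symmetric] abs_mult)
      thus ?thesis using s by (simp add: signed_quot_def \<theta> \<theta>')
    qed
    moreover have "\<bar>inner (coord_feat C 0 x) (\<theta> - \<theta>')\<bar> = 12 * C * \<bar>a * \<kappa> - a' * \<kappa>\<bar>"
    proof -
      have "inner (coord_feat C 0 x) (\<theta> - \<theta>') = 12 * C * (a * \<kappa> - a' * \<kappa>)"
        by (simp add: coord_feat_def \<theta> \<theta>' algebra_simps)
      thus ?thesis using C by (simp add: abs_mult)
    qed
    moreover have "\<bar>inner (coord_feat C 1 x) (\<theta> - \<theta>')\<bar> = 12 * C * \<bar>\<iota> f1 x - \<iota> f1' x\<bar>"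
      using C by (simp add: coord_feat_def \<theta> \<theta>' abs_mult feat(2) inner_diff_left inner_commute[of "feat x"])
    moreover have "\<bar>inner (coord_feat C 2 x) (\<theta> - \<theta>')\<bar> = 12 * C * \<bar>\<iota> f2 x - \<iota> f2' x\<bar>"
      using C by (simp add: coord_feat_def \<theta> \<theta>' abs_mult feat(2) inner_diff_left inner_commute[of "feat x"])
    ultimately show ?thesis by (simp add: distrib_left)
  qed
qed auto

text \<open>46 = 42 + 4. The mean is at most 24 sqrt 3 \<le> 42 in units of C \<kappa> sqrt n,
  enlarged by sqrt t \<ge> 1; a deviation of 4 sqrt t such units, with differences bounded by 4 C
  \<kappa>, has McDiarmid exponent - 2t.\<close>

lemma signed_gap_deviation:
  fixes I :: "'i set"
  assumes I: "finite I" "I \<noteq> {}" and t: "t \<ge> 1"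
  shows "measure (PiM I (\<lambda>_. P)) {x \<in> space (PiM I (\<lambda>_. P)).
    contraction_process.gap P \<Theta> (signed_quot s C) I 0 x \<ge> 46 * C * \<kappa> * sqrt (card I) * sqrt t} \<le> exp (- 2 * t)"
proof -
  interpret contraction_process P \<Theta> "signed_quot s C" "{0, 1, 2}" "coord_feat C" "sqrt 3" "144 * C\<^sup>2 * diag_norm k" "4 * C * \<kappa>"
    by (rule signed_quot_process)
  let ?Q = "PiM I (\<lambda>_. P)"
  interpret PI: prob_space ?Q by (rule prob_space_PiM) (rule prob_space_axioms)
  define u where "u = 4 * C * \<kappa> * sqrt (card I) * sqrt t"
  have cI: "real (card I) > 0" using I by (simp add: card_gt_0_iff)
  have u: "u > 0" using C \<kappa>_pos cI t by (simp add: u_def)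
  have E: "(\<integral>x. gap I 0 x \<partial>?Q) \<le> 42 * C * \<kappa> * sqrt (card I) * sqrt t"
  proof -
    have "sqrt 3 * sqrt (4 * (144 * C\<^sup>2 * diag_norm k) * card I) = (24 * sqrt 3) * (C * \<kappa> * sqrt (card I))"
    proof -
      have "sqrt (4 * (144 * C\<^sup>2 * diag_norm k) * card I) = sqrt ((24 * C)\<^sup>2 * (diag_norm k * card I))"
        by (simp add: power_mult_distrib mult_ac)
      also have "\<dots> = 24 * C * (\<kappa> * sqrt (card I))"
        using C by (simp only: real_sqrt_mult real_sqrt_abs abs_of_pos[OF mult_pos_pos[OF _ C]])
      finally show ?thesis by simp
    qed
    also have "\<dots> \<le> 42 * (C * \<kappa> * sqrt (card I))"
    proof (rule mult_right_mono)
      have "sqrt 3 \<le> 7 / 4" by (rule real_le_lsqrt) (auto simp: power2_eq_square)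
      thus "24 * sqrt 3 \<le> 42" by simp
    qed (use C \<kappa>_pos in auto)
    also have "\<dots> \<le> 42 * (C * \<kappa> * sqrt (card I)) * sqrt t"
      using t C \<kappa>_pos mult_left_mono[of 1 "sqrt t" "42 * (C * \<kappa> * sqrt (card I))"] by simp
    finally show ?thesis using expectation_gap_le[OF I(1), of 0] by (simp add: mult_ac)
  qed
  have osc: "gap I 0 (x(i := y)) - gap I 0 x \<le> 4 * C * \<kappa>" if i: "i \<in> I" for x i y
  proof -
    have "gap I 0 (x(i := y)) \<le> gap I 0 x + 4 * C * \<kappa>"
      unfolding gap_def[of I 0 "x(i := y)"]
    proof (rule cSUP_least[OF T(2)])
      fix \<theta> assume t: "\<theta> \<in> \<Theta>"
      have eq: "(\<Sum>j\<in>I - {i}. signed_quot s C \<theta> ((x(i := y)) j) - expectation (signed_quot s C \<theta>)) =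
        (\<Sum>j\<in>I - {i}. signed_quot s C \<theta> (x j) - expectation (signed_quot s C \<theta>))"
        by (intro sum.cong) auto
      have "(\<Sum>j\<in>I. signed_quot s C \<theta> ((x(i := y)) j) - expectation (signed_quot s C \<theta>)) + inner 0 \<theta> =
        (\<Sum>j\<in>I. signed_quot s C \<theta> (x j) - expectation (signed_quot s C \<theta>)) + inner 0 \<theta> +
          (signed_quot s C \<theta> y - signed_quot s C \<theta> (x i))"
        unfolding sum.remove[OF I(1) i] eq by simp
      also have "\<dots> \<le> gap I 0 x + (signed_quot s C \<theta> y - signed_quot s C \<theta> (x i))"
        unfolding gap_def by (intro add_right_mono cSUP_upper[OF t gap_bdd])
      also have "signed_quot s C \<theta> y - signed_quot s C \<theta> (x i) \<le> 4 * C * \<kappa>"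
      proof -
        \<comment> \<open>All values have the sign of s, so two of them differ by at most 4 C
          \<kappa>, not twice that.\<close>
        have nn: "0 \<le> s * signed_quot s C \<theta> z" for z
        proof -
          have "s * s = 1" using s by (metis abs_mult_self_eq mult_1)
          hence "s * signed_quot s C \<theta> z = C * clip_quot (fst \<theta> * \<kappa>) (\<iota> (fst (snd \<theta>)) z) (\<iota> (snd (snd \<theta>)) z)"
            by (simp add: signed_quot_def mult.assoc[symmetric])
          thus ?thesis using C param_bounds(1)[OF t] \<kappa>_pos by (simp add: clip_quot_nonneg)
        qed
        have "s = 1 \<or> s = - 1" using s by linarith
        thus ?thesis using nn[of y] nn[of "x i"] \<psi>_bound[OF t, of y] \<psi>_bound[OF t, of "x i"] by auto
      qed
      finally show "(\<Sum>j\<in>I. signed_quot s C \<theta> ((x(i := y)) j) - expectation (signed_quot s C \<theta>)) + inner 0 \<theta> \<le> gap I 0 x + 4 * C * \<kappa>"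
        by simp
    qed
    thus ?thesis by simp
  qed
  have "measure ?Q {x \<in> space ?Q. gap I 0 x \<ge> 46 * C * \<kappa> * sqrt (card I) * sqrt t} \<le>
    measure ?Q {x \<in> space ?Q. gap I 0 x - (\<integral>x. gap I 0 x \<partial>?Q) \<ge> u}"
    using E by (intro PI.finite_measure_mono) (auto simp: u_def)
  also have "\<dots> \<le> exp (- 2 * u\<^sup>2 / (card I * (4 * C * \<kappa>)\<^sup>2))"
    using C \<kappa>_pos u osc gap_bound[of I 0]
    by (intro mcdiarmid[OF prob_space_axioms I]) auto
  also have "- 2 * u\<^sup>2 / (card I * (4 * C * \<kappa>)\<^sup>2) = - 2 * t"
    using C diag_pos cI t by (simp add: u_def power_mult_distrib)
  finally show ?thesis .
qed

text \<open>The parameter of (q, i, j) reproduces the squared clipped difference up to a factor l.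
  The cap on the level can only make l larger than 1 / r, and a larger l only improves the
  bound.\<close>

lemma gap_controls_deviation:
  assumes n: "n \<ge> 1" and q: "(0::rat) < q" "norm (d i) \<le> of_rat q" "norm (d j) \<le> of_rat q"
    and G: "contraction_process.gap P \<Theta> (signed_quot s C) {1..n} 0 x \<le> G" "G \<ge> 0"
  shows "s * clip_dev C n x (d i) (d j) \<le> of_rat q * G / real n"
proof -
  interpret contraction_process P \<Theta> "signed_quot s C" "{0, 1, 2}" "coord_feat C" "sqrt 3" "144 * C\<^sup>2 * diag_norm k" "4 * C * \<kappa>"
    by (rule signed_quot_process)
  define r :: real where "r = of_rat q"
  have r: "r > 0" "norm (d i) \<le> r" "norm (d j) \<le> r" using q by (auto simp: r_def)
  define \<theta> where "\<theta> = clip_param C \<kappa> d (q, i, j)"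
  have t: "\<theta> \<in> \<Theta>" using q by (auto simp: \<theta>_def param_set_def)
  have \<theta>: "\<theta> = (min (C / r) \<kappa> / \<kappa>, (1 / r) *\<^sub>R d i, (1 / r) *\<^sub>R d j)"
    by (simp add: \<theta>_def clip_param_def r_def)
  define f where "f z = (clip C (\<iota> (d i) z) - clip C (\<iota> (d j) z))\<^sup>2" for z
  \<comment> \<open>Below the cap, scaling gives l = 1 / r exactly. Above it r \<kappa> < C, nothing
    is clipped on either side, and l = C / (r^2 \<kappa>).\<close>
  obtain l where l: "l \<ge> 1 / r" "\<And>z. signed_quot s C \<theta> z = s * (l * f z)"
  proof (cases "C / r \<le> \<kappa>")
    case True
    have "C * clip_quot (C / r) (\<iota> (d i) z / r) (\<iota> (d j) z / r) = 1 / r * f z" for z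
    proof -
      have "clip (C / r) (a / r) = clip C a / r" for a
        using clip_scale[of "1 / r" C a] r by simp
      thus ?thesis using C r
        by (simp add: clip_quot_def f_def diff_divide_distrib[symmetric] power_divide power2_eq_square[of r])
    qed
    thus ?thesis using that[of "1 / r"] True \<kappa>_pos by (simp add: signed_quot_def \<theta> eval_scale)
  next
    case False
    have ab: "\<bar>\<iota> h z\<bar> \<le> r * \<kappa>" if "norm h \<le> r" for h z
      by (rule order_trans[OF abs_eval_le mult_right_mono[OF that less_imp_le[OF \<kappa>_pos]]])
    have rC: "r * \<kappa> \<le> C" using False r by (simp add: field_simps)
    have "C * clip_quot \<kappa> (\<iota> (d i) z / r) (\<iota> (d j) z / r) = C / (r\<^sup>2 * \<kappa>) * f z" for z
    proof -
      have "clip \<kappa> (\<iota> h z / r) = \<iota> h z / r" "clip C (\<iota> h z) = \<iota> h z" if "norm h \<le> r" for h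
      proof -
        have "\<bar>\<iota> h z / r\<bar> \<le> \<kappa>" using ab[OF that, of z] r by (simp add: field_simps)
        thus "clip \<kappa> (\<iota> h z / r) = \<iota> h z / r" by (rule clip_eq)
        show "clip C (\<iota> h z) = \<iota> h z" using ab[OF that, of z] rC by (intro clip_eq) simp
      qed
      thus ?thesis using r
        by (simp add: clip_quot_def f_def diff_divide_distrib[symmetric] power_divide)
    qed
    moreover have "C / (r\<^sup>2 * \<kappa>) \<ge> 1 / r" using r rC \<kappa>_pos by (simp add: field_simps power2_eq_square)
    ultimately show ?thesis using that[of "C / (r\<^sup>2 * \<kappa>)"] False \<kappa>_pos by (simp add: signed_quot_def \<theta> eval_scale)
  qed
  have l0: "l > 0" using l(1) r by (auto intro: less_le_trans[of 0 "1 / r"])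
  have "f \<in> borel_measurable P" unfolding f_def by measurable
  have Ef: "expectation (signed_quot s C \<theta>) = s * (l * expectation f)" unfolding l(2) by simp
  have "(\<Sum>m\<in>{1..n}. signed_quot s C \<theta> (x m) - expectation (signed_quot s C \<theta>)) + inner 0 \<theta> \<le> gap {1..n} 0 x"
    unfolding gap_def by (rule cSUP_upper[OF t gap_bdd])
  also have "\<dots> \<le> G" by (rule G)
  also have "(\<Sum>m\<in>{1..n}. signed_quot s C \<theta> (x m) - expectation (signed_quot s C \<theta>)) + inner 0 \<theta> =
      (l * real n) * (s * clip_dev C n x (d i) (d j))"
  proof -
    have "(\<Sum>m\<in>{1..n}. signed_quot s C \<theta> (x m) - expectation (signed_quot s C \<theta>)) =
      s * l * (\<Sum>m=1..n. f (x m)) - real n * (s * l * expectation f)"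
      unfolding Ef l(2) by (simp add: sum_subtractf sum_distrib_left mult.assoc)
    also have "\<dots> = (l * real n) * (s * clip_dev C n x (d i) (d j))"
    proof -
      have "expectation f = pop_sq P (\<lambda>z. clip C (\<iota> (d i) z) - clip C (\<iota> (d j) z))"
        unfolding pop_sq_def f_def ..
      thus ?thesis using n by (simp add: clip_dev_def emp_sq_def f_def algebra_simps)
    qed
    finally show ?thesis by simp
  qed
  finally have "s * clip_dev C n x (d i) (d j) \<le> G / (l * real n)"
    using l0 n by (simp add: field_simps)
  also have "\<dots> \<le> G / (1 / r * real n)"
    using l r n G l0 by (intro divide_left_mono mult_right_mono mult_pos_pos) auto
  finally show ?thesis by (simp add: r_def mult.commute)
qed

end

end

lemma two_le_exp: "t \<ge> 1 \<Longrightarrow> 2 \<le> exp (t::real)"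
  using exp_ge_add_one_self[of t] by linarith

section \<open>Tail bounds for the two events\<close>

context sample
begin

text \<open>A Chernoff bound for the squared norm S of the noise sum; outside its tail the oracle
  inequality gives all radii and all h simultaneously.\<close>

lemma prob_A1:
  fixes g :: "'s \<Rightarrow>\<^sub>C real"
  assumes rs: "regression_sample M P g n X Y" and g [measurable]: "apply_bcontfun g \<in> borel_measurable P"
    and sg: "\<forall>i\<in>{1..n}. cond_subgaussian M P (X i) (\<lambda>\<omega>. Y i \<omega> - g (X i \<omega>)) (\<sigma>\<^sup>2)"
    and \<sigma>: "\<sigma> > 0" and t: "t \<ge> 1"
  shows "measure M (space M - event_A1 M \<iota> k g \<sigma> n X Y t) \<le> exp (- t)"
proof -
  interpret M: prob_space M using rs by (simp add: regression_sample_def)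
  define I where "I = {1..n}"
  define Q where "Q = distr M (P \<Otimes>\<^sub>M borel) (\<lambda>\<omega>. (X 1 \<omega>, Y 1 \<omega>))"
  have I: "finite I" "I \<noteq> {}" "1 \<in> I" "card I = n" using n by (auto simp: I_def)
  have Xm [measurable]: "X i \<in> measurable M P" and Ym [measurable]: "Y i \<in> borel_measurable M" if "i \<in> I" for i
    using that X_meas Y_meas by (auto simp: I_def)
  have Zm: "(\<lambda>\<omega>. (X i \<omega>, Y i \<omega>)) \<in> measurable M (P \<Otimes>\<^sub>M borel)" if "i \<in> I" for i
    using Xm[OF that] Ym[OF that] by measurable
  interpret Q: prob_space Q unfolding Q_def by (rule M.prob_space_distr[OF Zm[OF I(3)]])
  have sQ: "sets Q = sets (P \<Otimes>\<^sub>M borel)" by (simp add: Q_def)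
  \<comment> \<open>Transfers expectations of the sample to the product of copies of the law Q of
    one pair, on which the induction over observations runs.\<close>
  have law: "distr M (PiM I (\<lambda>_. Q)) (\<lambda>\<omega>. \<lambda>i\<in>I. (X i \<omega>, Y i \<omega>)) = PiM I (\<lambda>_. Q)"
  proof -
    have "M.indep_vars (\<lambda>_. P \<Otimes>\<^sub>M borel) (\<lambda>i \<omega>. (X i \<omega>, Y i \<omega>)) I"
      using rs by (simp add: regression_sample_def I_def)
    hence "distr M (PiM I (\<lambda>_. P \<Otimes>\<^sub>M borel)) (\<lambda>\<omega>. \<lambda>i\<in>I. (X i \<omega>, Y i \<omega>)) =
      PiM I (\<lambda>i. distr M (P \<Otimes>\<^sub>M borel) (\<lambda>\<omega>. (X i \<omega>, Y i \<omega>)))"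
      using M.indep_vars_iff_distr_eq_PiM'[OF I(2), where M' = "\<lambda>_. P \<Otimes>\<^sub>M borel" and X = "\<lambda>i \<omega>. (X i \<omega>, Y i \<omega>)"] Zm by blast
    also have "PiM I (\<lambda>i. distr M (P \<Otimes>\<^sub>M borel) (\<lambda>\<omega>. (X i \<omega>, Y i \<omega>))) = PiM I (\<lambda>_. Q)"
      using rs I(3) unfolding Q_def regression_sample_def I_def by (intro PiM_cong) blast+
    moreover have "distr M (PiM I (\<lambda>_. P \<Otimes>\<^sub>M borel)) (\<lambda>\<omega>. \<lambda>i\<in>I. (X i \<omega>, Y i \<omega>)) =
      distr M (PiM I (\<lambda>_. Q)) (\<lambda>\<omega>. \<lambda>i\<in>I. (X i \<omega>, Y i \<omega>))"
      by (intro distr_cong sets_PiM_cong) (auto simp: sQ)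
    ultimately show ?thesis by simp
  qed
  define e where "e z = snd z - g (fst z)" for z :: "'s \<times> real"
  have "e \<in> borel_measurable (P \<Otimes>\<^sub>M borel)" unfolding e_def[abs_def] by measurable
  hence em: "e \<in> borel_measurable Q" using measurable_cong_sets[OF sQ refl] by blast
  have fm: "fst \<in> measurable Q P" using measurable_cong_sets[OF sQ refl] measurable_fst by blast
  have v: "\<sigma>\<^sup>2 > 0" using \<sigma> by simp
  \<comment> \<open>Half of the admissible range: 2 l \<sigma>^2 \<open>diag_norm k\<close> n = 1/2,
    so the exponential moment of S is at most sqrt 2.\<close>
  define l where "l = 1 / (4 * \<sigma>\<^sup>2 * diag_norm k * n)"
  have n0: "real n > 0" using n by simp
  have l: "l > 0" using v diag_pos n0 by (simp add: l_def)
  have lq: "2 * l * \<sigma>\<^sup>2 * diag_norm k * card I = 1 / 2" using v diag_pos n0 by (simp add: l_def I)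
  have sgQ: "(\<integral>\<^sup>+z. ennreal (exp (a (fst z) * e z)) \<partial>Q) \<le> (\<integral>\<^sup>+z. ennreal (exp (\<sigma>\<^sup>2 * (a (fst z))\<^sup>2 / 2)) \<partial>Q)"
    if a [measurable]: "a \<in> borel_measurable P" and c: "\<And>x. \<bar>a x\<bar> \<le> c" for a c
  proof -
    have m1: "(\<lambda>z. ennreal (exp (a (fst z) * (snd z - g (fst z))))) \<in> borel_measurable (distr M (P \<Otimes>\<^sub>M borel) (\<lambda>\<omega>. (X 1 \<omega>, Y 1 \<omega>)))"
      unfolding measurable_distr_eq1 by measurable
    have m2: "(\<lambda>z. ennreal (exp (\<sigma>\<^sup>2 * (a (fst z))\<^sup>2 / 2))) \<in> borel_measurable (distr M (P \<Otimes>\<^sub>M borel) (\<lambda>\<omega>. (X 1 \<omega>, Y 1 \<omega>)))"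
      unfolding measurable_distr_eq1 by measurable
    have "(\<integral>\<^sup>+z. ennreal (exp (a (fst z) * e z)) \<partial>Q) = (\<integral>\<^sup>+\<omega>. ennreal (exp (a (X 1 \<omega>) * (Y 1 \<omega> - g (X 1 \<omega>)))) \<partial>M)"
      unfolding Q_def e_def by (subst nn_integral_distr[OF Zm[OF I(3)] m1]) simp
    also have "\<dots> \<le> (\<integral>\<^sup>+\<omega>. ennreal (exp (\<sigma>\<^sup>2 * (a (X 1 \<omega>))\<^sup>2 / 2)) \<partial>M)"
    proof (rule cond_subgaussian_bounded[OF M.prob_space_axioms Xm[OF I(3)] _ _ _ a c])
      show "(\<lambda>\<omega>. Y 1 \<omega> - g (X 1 \<omega>)) \<in> borel_measurable M"
        using Xm[OF I(3)] Ym[OF I(3)] by measurable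
      show "cond_subgaussian M P (X 1) (\<lambda>\<omega>. Y 1 \<omega> - g (X 1 \<omega>)) (\<sigma>\<^sup>2)" using sg I(3) by (simp add: I_def)
    qed simp
    also have "\<dots> = (\<integral>\<^sup>+z. ennreal (exp (\<sigma>\<^sup>2 * (a (fst z))\<^sup>2 / 2)) \<partial>Q)"
      unfolding Q_def by (subst nn_integral_distr[OF Zm[OF I(3)] m2]) simp
    finally show ?thesis .
  qed
  define S where "S \<omega> = (norm (\<Sum>i\<in>I. (Y i \<omega> - g (X i \<omega>)) *\<^sub>R feat (X i \<omega>)))\<^sup>2" for \<omega>
  have Sm [measurable]: "S \<in> borel_measurable M"
    using norm_sum_feat_sq_measurable[of I "\<lambda>\<omega> i. Y i \<omega> - g (X i \<omega>)" M "\<lambda>\<omega> i. X i \<omega>" 0] Xm Ym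
    unfolding S_def by simp
  have mgf: "(\<integral>\<^sup>+\<omega>. ennreal (exp (l * S \<omega>)) \<partial>M) \<le> ennreal 2"
  proof -
    let ?F = "\<lambda>z. ennreal (exp (l * (norm (0 + (\<Sum>i\<in>I. e (z i) *\<^sub>R feat (fst (z i)))))\<^sup>2))"
    have [measurable]: "(\<lambda>z. (norm (0 + (\<Sum>i\<in>I. e (z i) *\<^sub>R feat (fst (z i)))))\<^sup>2) \<in> borel_measurable (PiM I (\<lambda>_. Q))"
      by (rule norm_sum_feat_sq_measurable) (use em fm in measurable)
    have Fm: "?F \<in> borel_measurable (distr M (PiM I (\<lambda>_. Q)) (\<lambda>\<omega>. \<lambda>i\<in>I. (X i \<omega>, Y i \<omega>)))"
      unfolding measurable_distr_eq1 by measurable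
    have rm: "(\<lambda>\<omega>. \<lambda>i\<in>I. (X i \<omega>, Y i \<omega>)) \<in> measurable M (PiM I (\<lambda>_. Q))"
      using Zm measurable_cong_sets[OF refl sQ] by (intro measurable_restrict) blast
    have "(\<integral>\<^sup>+\<omega>. ennreal (exp (l * S \<omega>)) \<partial>M) = (\<integral>\<^sup>+\<omega>. ?F (\<lambda>i\<in>I. (X i \<omega>, Y i \<omega>)) \<partial>M)"
      unfolding S_def e_def by (intro nn_integral_cong) simp
    also have "\<dots> = (\<integral>\<^sup>+z. ?F z \<partial>PiM I (\<lambda>_. Q))"
      by (rule nn_integral_distr[OF rm Fm, unfolded law, symmetric])
    also have "\<dots> \<le> ennreal (exp (l / (1 - 2 * l * \<sigma>\<^sup>2 * diag_norm k * card I) * (norm (0::'h))\<^sup>2) / sqrt (1 - 2 * l * \<sigma>\<^sup>2 * diag_norm k * card I))"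
      using lq by (intro subgaussian_feat_sum[OF Q.prob_space_axioms sQ em v l I(1) _ sgQ]) auto
    also have "\<dots> \<le> ennreal 2"
    proof (rule ennreal_leI)
      have "1 / 2 \<le> sqrt (1 / 2 :: real)" by (rule real_le_rsqrt) (simp add: power2_eq_square)
      thus "exp (l / (1 - 2 * l * \<sigma>\<^sup>2 * diag_norm k * card I) * (norm (0::'h))\<^sup>2) / sqrt (1 - 2 * l * \<sigma>\<^sup>2 * diag_norm k * card I) \<le> 2"
        unfolding lq by (simp add: field_simps real_sqrt_divide)
    qed
    finally show ?thesis .
  qed
  \<comment> \<open>The root of b is 5 \<kappa> \<sigma> sqrt (n t) with \<kappa> =
    \<open>sqrt (diag_norm k)\<close>, which times 4 r / n is the 20 of the event. The exponent l b
    = 25 t / 4 exceeds 2t, and exp t \<ge> 2 pays for the prefactor 2.\<close>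
  define b where "b = 25 * diag_norm k * \<sigma>\<^sup>2 * n * t"
  have "emeasure M {\<omega>\<in>space M. b \<le> S \<omega>} \<le> emeasure M {\<omega>\<in>space M. 1 \<le> ennreal (exp (- l * b)) * ennreal (exp (l * S \<omega>))}"
  proof (rule emeasure_mono)
    have "1 \<le> ennreal (exp (- l * b)) * ennreal (exp (l * z))" if "b \<le> z" for z
    proof -
      have "ennreal (exp (- l * b)) * ennreal (exp (l * z)) = ennreal (exp (l * (z - b)))"
        by (simp add: ennreal_mult[symmetric] exp_add[symmetric] algebra_simps)
      thus ?thesis using that l by (simp add: ennreal_1[symmetric] del: ennreal_1)
    qed
    thus "{\<omega>\<in>space M. b \<le> S \<omega>} \<subseteq> {\<omega>\<in>space M. 1 \<le> ennreal (exp (- l * b)) * ennreal (exp (l * S \<omega>))}" by auto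
  qed measurable
  also have "\<dots> \<le> ennreal (exp (- l * b)) * (\<integral>\<^sup>+\<omega>. ennreal (exp (l * S \<omega>)) * indicator (space M) \<omega> \<partial>M)"
    by (rule nn_integral_Markov_inequality) measurable
  also have "(\<integral>\<^sup>+\<omega>. ennreal (exp (l * S \<omega>)) * indicator (space M) \<omega> \<partial>M) = (\<integral>\<^sup>+\<omega>. ennreal (exp (l * S \<omega>)) \<partial>M)"
    by (intro nn_integral_cong) simp
  also have "ennreal (exp (- l * b)) * \<dots> \<le> ennreal (exp (- l * b)) * ennreal 2"
    by (intro mult_left_mono mgf) simp
  also have "\<dots> = ennreal (exp (- l * b) * 2)" by (simp add: ennreal_mult)
  also have "\<dots> \<le> ennreal (exp (- t))"
  proof (rule ennreal_leI)
    have "l * b = 25 / 4 * t" using v diag_pos n0 by (simp add: l_def b_def)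
    hence "exp (- l * b) * 2 \<le> exp (- 2 * t) * 2" using t by simp
    also have "\<dots> \<le> exp (- 2 * t) * exp t" using two_le_exp[OF t] by (intro mult_left_mono) auto
    also have "\<dots> = exp (- t)" by (simp add: exp_add[symmetric])
    finally show "exp (- l * b) * 2 \<le> exp (- t)" .
  qed
  finally have tail: "measure M {\<omega>\<in>space M. b \<le> S \<omega>} \<le> exp (- t)" by (simp add: M.emeasure_eq_measure)
  have "space M - event_A1 M \<iota> k g \<sigma> n X Y t \<subseteq> {\<omega>\<in>space M. b \<le> S \<omega>}"
  proof (rule ccontr)
    assume "\<not> ?thesis"
    then obtain \<omega> where w': "\<omega> \<in> space M" "\<omega> \<notin> event_A1 M \<iota> k g \<sigma> n X Y t"
      "\<omega> \<notin> {\<omega>\<in>space M. b \<le> S \<omega>}" by blast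
    hence w: "\<omega> \<in> space M" "\<omega> \<notin> event_A1 M \<iota> k g \<sigma> n X Y t" "S \<omega> < b" by auto
    interpret ls_data \<iota> k n "\<lambda>i. X i \<omega>" "\<lambda>i. Y i \<omega>" by (rule data)
    have "sqrt (S \<omega>) \<le> sqrt b" using w by simp
    also have "sqrt b = 5 * sqrt (diag_norm k) * \<sigma> * sqrt n * sqrt t"
      using \<sigma> by (simp add: b_def real_sqrt_mult)
    finally have Sb: "norm (\<Sum>i=1..n. (Y i \<omega> - g (X i \<omega>)) *\<^sub>R feat (X i \<omega>)) \<le> 5 * sqrt (diag_norm k) * \<sigma> * sqrt n * sqrt t"
      by (simp add: S_def I_def)
    have "esq (lse r) h \<le> 20 * sqrt (diag_norm k) * \<sigma> * r * sqrt t / sqrt n + 4 * (norm (\<iota> h - g))\<^sup>2"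
      if r: "r \<ge> 0" and h: "h \<in> cball 0 r" for r h
    proof -
      have "esq (lse r) h \<le> 4 * r * norm (\<Sum>i=1..n. (Y i \<omega> - g (X i \<omega>)) *\<^sub>R feat (X i \<omega>)) / n + (norm (\<iota> h - g))\<^sup>2"
        by (rule lse_oracle[OF r h])
      also have "\<dots> \<le> 4 * r * (5 * sqrt (diag_norm k) * \<sigma> * sqrt n * sqrt t) / n + 4 * (norm (\<iota> h - g))\<^sup>2"
        using Sb r by (intro add_mono divide_right_mono mult_left_mono) auto
      also have "4 * r * (5 * sqrt (diag_norm k) * \<sigma> * sqrt n * sqrt t) / n = 20 * sqrt (diag_norm k) * \<sigma> * r * sqrt t * (sqrt n / n)"
        by simp
      also have "sqrt n / n = 1 / sqrt n" using n0 by (simp add: divide_simps)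
      finally show ?thesis by simp
    qed
    hence "\<omega> \<in> event_A1 M \<iota> k g \<sigma> n X Y t" using w(1) by (simp add: event_A1_def)
    thus False using w by simp
  qed
  hence "measure M (space M - event_A1 M \<iota> k g \<sigma> n X Y t) \<le> measure M {\<omega>\<in>space M. b \<le> S \<omega>}"
    by (rule M.finite_measure_mono) measurable
  thus ?thesis using tail by simp
qed

text \<open>Each sign fails with probability at most exp (- 2t); since t \<ge> 1, the two together
  stay below exp (- t).\<close>

lemma prob_A2:
  assumes rs: "regression_sample M P g n X Y" and C: "C > 0" and t: "t \<ge> 1"
  shows "measure M (space M - event_A2 M P \<iota> k C n X t) \<le> exp (- t)"
proof -
  interpret M: prob_space M using rs by (simp add: regression_sample_def)
  define I where "I = {1..n}"
  have I: "finite I" "I \<noteq> {}" "card I = n" using n by (auto simp: I_def)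
  have Xm: "X i \<in> measurable M P" if "i \<in> I" for i using that X_meas by (auto simp: I_def)
  have rm: "(\<lambda>\<omega>. \<lambda>i\<in>I. X i \<omega>) \<in> measurable M (PiM I (\<lambda>_. P))" using Xm by (intro measurable_restrict)
  have law: "distr M (PiM I (\<lambda>_. P)) (\<lambda>\<omega>. \<lambda>i\<in>I. X i \<omega>) = PiM I (\<lambda>_. P)"
  proof -
    have "M.indep_vars (\<lambda>_. P \<Otimes>\<^sub>M borel) (\<lambda>i \<omega>. (X i \<omega>, Y i \<omega>)) I"
      using rs by (simp add: regression_sample_def I_def)
    from M.indep_vars_compose2[OF this, of "\<lambda>_. fst" "\<lambda>_. P"]
    have "M.indep_vars (\<lambda>_. P) X I" by simp
    hence "distr M (PiM I (\<lambda>_. P)) (\<lambda>\<omega>. \<lambda>i\<in>I. X i \<omega>) = PiM I (\<lambda>i. distr M P (X i))"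
      using M.indep_vars_iff_distr_eq_PiM'[OF I(2), where M' = "\<lambda>_. P" and X = X] Xm by blast
    also have "\<dots> = PiM I (\<lambda>_. P)"
      using rs unfolding regression_sample_def I_def by (intro PiM_cong) auto
    finally show ?thesis .
  qed
  obtain d :: "nat \<Rightarrow> 'h" where d: "\<And>h e. e > 0 \<Longrightarrow> \<exists>j. dist (d j) h < e" by (rule dense_sequence) blast
  let ?k = "sqrt (diag_norm k)"
  let ?T = "clip_param C ?k d ` param_set d"
  define G where "G = 46 * C * ?k * sqrt n * sqrt t"
  have G: "G \<ge> 0" using C t diag_pos by (simp add: G_def)
  define gp where "gp s x = contraction_process.gap P ?T (signed_quot s C) I 0 x" for s x
  define B where "B s = {x \<in> space (PiM I (\<lambda>_. P)). G \<le> gp s x}" for s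
  define B' where "B' s = (\<lambda>\<omega>. \<lambda>i\<in>I. X i \<omega>) -` B s \<inter> space M" for s
  have gpm: "gp s \<in> borel_measurable (PiM I (\<lambda>_. P))" if s: "\<bar>s\<bar> = 1" for s
    unfolding gp_def[abs_def]
    using contraction_process.gap_measurable[OF signed_quot_process[OF d C s]] by simp
  have Bm: "B s \<in> sets (PiM I (\<lambda>_. P))" if s: "\<bar>s\<bar> = 1" for s
    unfolding B_def using gpm[OF s] by measurable
  have B'm: "B' s \<in> sets M" if s: "\<bar>s\<bar> = 1" for s
    unfolding B'_def by (rule measurable_sets[OF rm Bm[OF s]])
  have PB: "measure M (B' s) \<le> exp (- 2 * t)" if s: "\<bar>s\<bar> = 1" for s
  proof -
    have "measure M (B' s) = measure (PiM I (\<lambda>_. P)) (B s)"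
      unfolding B'_def using measure_distr[OF rm Bm[OF s]] by (simp add: law)
    also have "\<dots> \<le> exp (- 2 * t)"
      using signed_gap_deviation[OF d C s I(1,2) t] by (simp add: B_def gp_def G_def I mult_ac)
    finally show ?thesis .
  qed
  have sub: "space M - event_A2 M P \<iota> k C n X t \<subseteq> B' 1 \<union> B' (- 1)"
  proof (rule ccontr)
    assume "\<not> ?thesis"
    then obtain \<omega> where w: "\<omega> \<in> space M" "\<omega> \<notin> event_A2 M P \<iota> k C n X t" "\<omega> \<notin> B' 1" "\<omega> \<notin> B' (- 1)" by blast
    let ?x = "\<lambda>i. X i \<omega>"
    \<comment> \<open>The supremum sees only coordinates in I, so restricting the sample to I does
      not change it.\<close>
    have gpX: "gp s (\<lambda>i\<in>I. X i \<omega>) = gp s ?x" if s: "\<bar>s\<bar> = 1" for s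
    proof -
      interpret contraction_process P ?T "signed_quot s C" "{0, 1, 2}" "coord_feat C" "sqrt 3" "144 * C\<^sup>2 * diag_norm k" "4 * C * ?k"
        by (rule signed_quot_process[OF d C s])
      have "(\<Sum>i\<in>I. signed_quot s C \<theta> ((\<lambda>i\<in>I. X i \<omega>) i) - expectation (signed_quot s C \<theta>)) =
        (\<Sum>i\<in>I. signed_quot s C \<theta> (X i \<omega>) - expectation (signed_quot s C \<theta>))" for \<theta>
        by (intro sum.cong) auto
      thus ?thesis unfolding gp_def gap_def by simp
    qed
    have le: "gp s ?x \<le> G" if s: "\<bar>s\<bar> = 1" and "\<omega> \<notin> B' s" for s
      using that(2) w(1) measurable_space[OF rm w(1)] gpX[OF s] by (auto simp: B'_def B_def)
    have "\<bar>clip_dev C n ?x (d i) (d j)\<bar> \<le> 97 * ?k * C * of_rat q * sqrt t / sqrt n + 8 * ?k * C * of_rat q * t / (3 * n)"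
      if q: "(0::rat) < q" "norm (d i) \<le> of_rat q" "norm (d j) \<le> of_rat q" for q i j
    proof -
      have q0: "(0::real) < of_rat q" using q by simp
      have "s * clip_dev C n ?x (d i) (d j) \<le> of_rat q * G / n" if s: "\<bar>s\<bar> = 1" and "\<omega> \<notin> B' s" for s
        using le[OF that] unfolding gp_def I_def
        by (intro gap_controls_deviation[OF d C s n q _ G]) auto
      from this[of 1] this[of "- 1"] w have "\<bar>clip_dev C n ?x (d i) (d j)\<bar> \<le> of_rat q * G / n" by simp
      also have "\<dots> = 46 * ?k * C * of_rat q * sqrt t * (sqrt n / n)" by (simp add: G_def mult_ac)
      also have "sqrt n / n = 1 / sqrt n" using n by (simp add: divide_simps)
      \<comment> \<open>The constant 46 obtained here fits below the 97 that the event
        allows.\<close>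
      also have "46 * ?k * C * of_rat q * sqrt t * (1 / sqrt n) \<le> 97 * ?k * C * of_rat q * sqrt t * (1 / sqrt n)"
        using diag_pos C q0 t by (intro mult_right_mono) auto
      also have "\<dots> \<le> 97 * ?k * C * of_rat q * sqrt t / sqrt n + 8 * ?k * C * of_rat q * t / (3 * n)"
        using diag_pos C q0 t by simp
      finally show ?thesis .
    qed
    hence "\<omega> \<in> event_A2 M P \<iota> k C n X t"
      using w(1) by (subst event_A2_iff[where d = d, OF d C n]) auto
    thus False using w by simp
  qed
  have "measure M (space M - event_A2 M P \<iota> k C n X t) \<le> measure M (B' 1 \<union> B' (- 1))"
    using B'm[of 1] B'm[of "- 1"] by (intro M.finite_measure_mono sub) auto
  also have "\<dots> \<le> measure M (B' 1) + measure M (B' (- 1))"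
    using B'm[of 1] B'm[of "- 1"] by (intro measure_Un_le) auto
  also have "\<dots> \<le> 2 * exp (- 2 * t)" using PB[of 1] PB[of "- 1"] by simp
  also have "\<dots> \<le> exp t * exp (- 2 * t)" using two_le_exp[OF t] by (intro mult_right_mono) auto
  also have "\<dots> = exp (- t)" by (simp add: exp_add[symmetric])
  finally show ?thesis .
qed

lemma prob_events:
  fixes g :: "'s \<Rightarrow>\<^sub>C real"
  assumes rs: "regression_sample M P g n X Y" and g: "apply_bcontfun g \<in> borel_measurable P"
    and sg: "\<forall>i\<in>{1..n}. cond_subgaussian M P (X i) (\<lambda>\<omega>. Y i \<omega> - g (X i \<omega>)) (\<sigma>\<^sup>2)"
    and \<sigma>: "\<sigma> > 0" and C: "C > 0" and t: "t \<ge> 1"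
  shows "measure M (event_A1 M \<iota> k g \<sigma> n X Y t \<inter> event_A2 M P \<iota> k C n X t) \<ge> 1 - 2 * exp (- t)"
proof -
  interpret M: prob_space M using rs by (simp add: regression_sample_def)
  let ?A = "event_A1 M \<iota> k g \<sigma> n X Y t" and ?B = "event_A2 M P \<iota> k C n X t"
  have AB: "?A \<in> sets M" "?B \<in> sets M" using event_A1_sets event_A2_sets[OF C] by auto
  have "measure M (space M - ?A \<inter> ?B) = measure M ((space M - ?A) \<union> (space M - ?B))"
    by (rule arg_cong[where f = "measure M"]) auto
  also have "\<dots> \<le> measure M (space M - ?A) + measure M (space M - ?B)"
    using AB by (intro measure_Un_le) auto
  also have "\<dots> \<le> 2 * exp (- t)" using prob_A1[OF rs g sg \<sigma> t] prob_A2[OF rs C t] by simp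
  finally show ?thesis using M.prob_compl[of "?A \<inter> ?B"] AB by simp
qed

end

section \<open>The adaptive radius\<close>

context ls_data
begin

lemma esq_commute: "esq f h = esq h f"
  unfolding emp_sq_def by (simp add: power2_commute)

lemma esq_triangle: "esq f h \<le> 2 * esq f l + 2 * esq l h"
proof -
  have "esq f h = emp_sq n x (\<lambda>z. (\<iota> f z - \<iota> l z) + (\<iota> l z - \<iota> h z))" by simp
  thus ?thesis using emp_sq_sum_le[of n x "\<lambda>z. \<iota> f z - \<iota> l z" "\<lambda>z. \<iota> l z - \<iota> h z"] by simp
qed

lemma emp_sq_zero [simp]: "emp_sq n x (\<lambda>z. 0) = 0"
  by (simp add: emp_sq_def)

context
  fixes g :: "'s \<Rightarrow>\<^sub>C real" and \<tau> \<nu> \<rho> :: real and R :: "real set"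
  assumes \<tau>: "\<tau> > 0" and \<nu>: "\<nu> > 0" and R: "R \<subseteq> {0..}"
    and oracle_ineq: "\<And>r h. r \<ge> 0 \<Longrightarrow> h \<in> cball 0 r \<Longrightarrow>
      esq (lse r) h \<le> \<tau> * r / (4 * sqrt n) + 4 * (norm (\<iota> h - g))\<^sup>2"
    and min: "gl_minimiser \<iota> k R \<tau> \<nu> n x y \<rho>"
begin

abbreviation "crit \<equiv> gl_crit \<iota> k R \<tau> \<nu> n x y"

text \<open>As r \<le> s, the same h is admissible at both radii, so both estimators are compared
  with it, each distance entering with factor 2.\<close>

lemma lse_pair_le:
  assumes "0 \<le> r" "r \<le> s" "h \<in> cball 0 r"
  shows "esq (lse r) (lse s) \<le> \<tau> * (r + s) / (2 * sqrt n) + 16 * (norm (\<iota> h - g))\<^sup>2"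
proof -
  have "esq (lse r) h \<le> \<tau> * r / (4 * sqrt n) + 4 * (norm (\<iota> h - g))\<^sup>2"
    using assms by (intro oracle_ineq) auto
  moreover have "esq h (lse s) \<le> \<tau> * s / (4 * sqrt n) + 4 * (norm (\<iota> h - g))\<^sup>2"
    using assms by (subst esq_commute, intro oracle_ineq) auto
  moreover have "\<tau> * (r + s) / (2 * sqrt n) = 2 * (\<tau> * r / (4 * sqrt n)) + 2 * (\<tau> * s / (4 * sqrt n))"
    by (simp add: add_divide_distrib algebra_simps)
  ultimately show ?thesis using esq_triangle[of "lse r" "lse s" h] by linarith
qed

text \<open>The penalty is twice the stochastic part of the distance between the two estimators, so
  only the bias survives, uniformly in s.\<close>

lemma crit_term_le:
  assumes "0 \<le> r" "r \<le> s" "h \<in> cball 0 r"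
  shows "esq (lse r) (lse s) - \<tau> * (r + s) / sqrt n \<le> 16 * (norm (\<iota> h - g))\<^sup>2"
proof -
  have "\<tau> * (r + s) / sqrt n = 2 * (\<tau> * (r + s) / (2 * sqrt n))" by simp
  moreover have "\<tau> * (r + s) / (2 * sqrt n) \<ge> 0" using assms \<tau> by simp
  ultimately show ?thesis using lse_pair_le[OF assms] by linarith
qed

lemma crit_le:
  assumes "r \<in> R" "h \<in> cball 0 r"
  shows "crit r \<le> 16 * (norm (\<iota> h - g))\<^sup>2 + 2 * (1 + \<nu>) * \<tau> * r / sqrt n"
  unfolding gl_crit_def using assms R
  by (intro add_right_mono cSUP_least crit_term_le) auto

lemma crit_ge:
  assumes "r \<in> R" "s \<in> R" "r \<le> s"
  shows "esq (lse r) (lse s) - \<tau> * (r + s) / sqrt n + 2 * (1 + \<nu>) * \<tau> * r / sqrt n \<le> crit r"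
  unfolding gl_crit_def
proof (intro add_right_mono cSUP_upper)
  show "bdd_above ((\<lambda>s. esq (lse r) (lse s) - \<tau> * (r + s) / sqrt (real n)) ` {s \<in> R. r \<le> s})"
    \<comment> \<open>The comparison function h = 0 lies in every ball, which bounds the supremum
      even when R is unbounded.\<close>
    using assms R by (intro bdd_aboveI2[of _ _ "16 * (norm (\<iota> 0 - g))\<^sup>2"] crit_term_le) auto
qed (use assms in auto)

text \<open>The term s = \<rho> of the criterion bounds \<rho> itself. For the distance to the
  estimator at r: if \<rho> \<le> r, the criterion at \<rho> contains the term s = r; if \<rho> > r,
  the pair bound applies and its error is controlled by the bound on \<rho>.\<close>

lemma adaptive_radius:
  assumes r: "r \<in> R" and h: "h \<in> cball 0 r"
  defines "e \<equiv> (norm (\<iota> h - g))\<^sup>2 + \<tau> * r / sqrt n" and "c \<equiv> 20 + 2 * \<nu> + 8 / \<nu>"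
  shows "\<rho> \<ge> 0" "\<tau> * max \<rho> r / sqrt n \<le> c * e" "esq (lse \<rho>) h \<le> 3 * c * e"
proof -
  define a b q where "a = \<tau> * r / sqrt n" and "b = \<tau> * \<rho> / sqrt n" and "q = (norm (\<iota> h - g))\<^sup>2"
  have \<rho>R: "\<rho> \<in> R" and cr: "crit \<rho> \<le> crit r" using min r by (auto simp: gl_minimiser_def)
  show \<rho>: "\<rho> \<ge> 0" using \<rho>R R by auto
  have r0: "r \<ge> 0" using r R by auto
  have ab: "a \<ge> 0" "b \<ge> 0" "q \<ge> 0" using \<tau> r0 \<rho> by (auto simp: a_def b_def q_def)
  have up: "crit \<rho> \<le> 16 * q + 2 * a + 2 * (\<nu> * a)"
    using order_trans[OF cr crit_le[OF r h]] by (simp add: a_def q_def algebra_simps add_divide_distrib)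
  \<comment> \<open>At s = \<rho> the distance vanishes and the penalty 2b cancels part of 2 (1 +
    \<nu>) b; what remains is positive because \<nu> > 0.\<close>
  have "2 * (\<nu> * b) \<le> crit \<rho>"
    using crit_ge[OF \<rho>R \<rho>R] by (simp add: b_def algebra_simps add_divide_distrib)
  hence "\<nu> * b \<le> 8 * q + a + \<nu> * a" using up by linarith
  hence "b \<le> (8 * q + a + \<nu> * a) / \<nu>" using \<nu> by (simp add: pos_le_divide_eq mult.commute)
  also have "\<dots> = 8 / \<nu> * q + 1 / \<nu> * a + a" using \<nu> by (simp add: add_divide_distrib)
  finally have bl: "b \<le> 8 / \<nu> * q + 1 / \<nu> * a + a" .
  have nn: "8 / \<nu> * q \<ge> 0" "1 / \<nu> * a \<ge> 0" "1 / \<nu> * q \<ge> 0" "\<nu> * a \<ge> 0" "\<nu> * q \<ge> 0" using \<nu> ab by auto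
  \<comment> \<open>One constant serves all three claims: 8 / \<nu> comes from dividing by \<nu> in
    \<open>bl\<close>, 2 \<nu> from the weight of the criterion at r, and 20 covers the bias term 16
    q.\<close>
  have ce: "c * e = 20 * q + 20 * a + 2 * (\<nu> * q) + 2 * (\<nu> * a) + 8 * (1 / \<nu> * q) + 8 * (1 / \<nu> * a)"
    by (simp add: c_def e_def a_def[symmetric] q_def[symmetric] algebra_simps add_divide_distrib)
  have e8: "8 / \<nu> * q = 8 * (1 / \<nu> * q)" by simp
  show "\<tau> * max \<rho> r / sqrt n \<le> c * e"
  proof -
    have "\<tau> * max \<rho> r / sqrt n = max b a"
      using \<tau> by (simp add: a_def b_def max_def divide_le_cancel)
    also have "\<dots> \<le> c * e" using bl nn ab unfolding ce e8 by (simp add: max_def)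
    finally show ?thesis .
  qed
  have D: "esq (lse \<rho>) (lse r) \<le> c * e"
  proof (cases "\<rho> \<le> r")
    case True
    have "esq (lse \<rho>) (lse r) - (b + a) + (2 * b + 2 * (\<nu> * b)) \<le> crit \<rho>"
      using crit_ge[OF \<rho>R r True] by (simp add: a_def b_def algebra_simps add_divide_distrib)
    moreover have "\<nu> * b \<ge> 0" using \<nu> ab by simp
    ultimately show ?thesis using up nn ab unfolding ce by linarith
  next
    case False
    have "\<tau> * (r + \<rho>) / (2 * sqrt n) = a / 2 + b / 2" by (simp add: a_def b_def algebra_simps add_divide_distrib)
    hence "esq (lse r) (lse \<rho>) \<le> a / 2 + b / 2 + 16 * q"
      using lse_pair_le[OF r0 _ h, of \<rho>] False by (simp add: q_def)
    thus ?thesis using bl nn ab esq_commute[of "lse r" "lse \<rho>"] unfolding ce e8 by linarith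
  qed
  have "esq (lse r) h \<le> a / 4 + 4 * q"
    using oracle_ineq[OF r0 h] by (simp add: a_def q_def mult.commute)
  thus "esq (lse \<rho>) h \<le> 3 * c * e"
    using D esq_triangle[of "lse \<rho>" h "lse r"] nn ab ce by linarith
qed

end

end

text \<open>The scale s is tuned so that the penalty part of the K-functional gives norm at most r,
  that is 2 B s^(\<beta> - 1) = r. The infimum need not be attained; the factor 2 leaves strict room
  for a near-minimiser.\<close>

lemma interpolation_approx:
  fixes \<iota> :: "'h::real_normed_vector \<Rightarrow> 'z::real_normed_vector"
  assumes g: "interp_norm \<beta> \<iota> g \<le> ennreal B" and B: "B > 0" and \<beta>: "0 < \<beta>" "\<beta> < 1" and r: "r > 0"
  obtains h where "h \<in> cball 0 r" "norm (\<iota> h - g) \<le> 2 * B * (r / (2 * B)) powr (- \<beta> / (1 - \<beta>))"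
proof -
  define u where "u = r / (2 * B)"
  have u: "u > 0" using r B by (simp add: u_def)
  define s where "s = u powr (- 1 / (1 - \<beta>))"
  have s: "s > 0" using u by (simp add: s_def)
  have "ennreal (s powr (- \<beta>) * K_functional \<iota> g s) \<le> interp_norm \<beta> \<iota> g"
    unfolding interp_norm_def using s by (intro SUP_upper) auto
  hence "ennreal (s powr (- \<beta>) * K_functional \<iota> g s) \<le> ennreal B" using g by (rule order_trans)
  hence "s powr (- \<beta>) * K_functional \<iota> g s \<le> B" using B by (simp add: ennreal_le_iff)
  hence "s powr \<beta> * (s powr (- \<beta>) * K_functional \<iota> g s) \<le> s powr \<beta> * B" by (intro mult_left_mono) auto
  hence "K_functional \<iota> g s \<le> s powr \<beta> * B" using s by (simp add: mult.assoc[symmetric] powr_add[symmetric])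
  also have "\<dots> < 2 * B * s powr \<beta>" using s B by simp
  finally have "(INF w. norm (g - \<iota> w) + s * norm w) < 2 * B * s powr \<beta>" by (simp add: K_functional_def)
  then obtain h where h: "norm (g - \<iota> h) + s * norm h < 2 * B * s powr \<beta>"
    using cInf_lessD[of "range (\<lambda>w. norm (g - \<iota> w) + s * norm w)"] by auto
  have "s * norm h \<le> 2 * B * s powr \<beta>" using h norm_ge_zero[of "g - \<iota> h"] by linarith
  also have "s powr \<beta> = s * s powr (\<beta> - 1)" using s by (simp add: powr_mult_base)
  finally have "norm h \<le> 2 * B * s powr (\<beta> - 1)" using s by (simp add: field_simps)
  also have "s powr (\<beta> - 1) = u powr 1"
    unfolding s_def powr_powr using \<beta> by (intro arg_cong2[where f = "(powr)"] refl) (simp add: field_simps)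
  also have "2 * B * u powr 1 = r" using r B by (simp add: u_def)
  finally have 1: "h \<in> cball 0 r" by simp
  have "s * norm h \<ge> 0" using s by simp
  hence "norm (\<iota> h - g) \<le> 2 * B * s powr \<beta>" using h by (simp add: norm_minus_commute)
  also have "s powr \<beta> = u powr (- \<beta> / (1 - \<beta>))" unfolding s_def powr_powr by simp
  finally show ?thesis using that[OF 1] by (simp add: u_def)
qed

section \<open>Admissible radii\<close>

lemma radius_grid_finite: "finite (radius_grid a b n)"
proof -
  have "{b * real i | i. int i \<le> \<lceil>a * sqrt (real n) / b\<rceil> - 1} \<subseteq> (\<lambda>i. b * real i) ` {..nat (\<lceil>a * sqrt (real n) / b\<rceil> - 1)}"
    by force
  thus ?thesis unfolding radius_grid_def by (meson finite_Un finite.intros finite_atMost finite_imageI finite_subset)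
qed

lemma radius_grid_nonneg: "a > 0 \<Longrightarrow> b > 0 \<Longrightarrow> radius_grid a b n \<subseteq> {0..}"
  unfolding radius_grid_def by auto

text \<open>r is rounded up to a multiple of b, which costs a factor 1 + b since r \<ge> 1. If that
  multiple is past the end of the grid, the last point a sqrt n lies below it and is at least a r
  since r \<le> sqrt n.\<close>

lemma radius_grid_approx:
  assumes ab: "a > 0" "b > 0" and n: "n \<ge> 1" and r: "1 \<le> r" "r \<le> sqrt n"
  shows "\<exists>s\<in>radius_grid a b n. min 1 a * r \<le> s \<and> s \<le> (1 + b) * r"
proof -
  define i where "i = nat \<lceil>r / b\<rceil>"
  have "0 \<le> r / b" using r ab by simp
  hence c0: "0 \<le> \<lceil>r / b\<rceil>" by linarith
  have ri: "real i = of_int \<lceil>r / b\<rceil>" using c0 by (simp add: i_def)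
  have "r / b \<le> real i" "real i < r / b + 1" unfolding ri by linarith+
  hence bi: "r \<le> b * real i" "b * real i \<le> r + b" using ab by (auto simp: field_simps)
  have rb: "r + b \<le> (1 + b) * r" using r ab by (simp add: distrib_right)
  have m1: "min 1 a * r \<le> 1 * r" "min 1 a * r \<le> a * r" using r by (auto intro!: mult_right_mono)
  show ?thesis
  proof (cases "int i \<le> \<lceil>a * sqrt (real n) / b\<rceil> - 1")
    case True
    hence "b * real i \<in> radius_grid a b n" unfolding radius_grid_def by blast
    thus ?thesis using bi rb m1 by (intro bexI[of _ "b * real i"]) auto
  next
    case False
    hence "\<lceil>a * sqrt (real n) / b\<rceil> \<le> int i" by simp
    hence "a * sqrt (real n) / b \<le> real i" by linarith
    hence "a * sqrt n \<le> b * real i" using ab by (simp add: field_simps)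
    moreover have "a * r \<le> a * sqrt n" using ab r by simp
    moreover have "a * sqrt n \<in> radius_grid a b n" unfolding radius_grid_def by blast
    ultimately show ?thesis using bi rb m1 by (intro bexI[of _ "a * sqrt n"]) auto
  qed
qed

text \<open>\<open>LEAST\<close> on the reals is informative only if a least minimiser exists; a
  finite R has one, otherwise it is assumed.\<close>

lemma r_hat_minimiser:
  assumes "finite R \<and> R \<noteq> {} \<or>
    (\<exists>r. gl_minimiser \<iota> k R \<tau> \<nu> n x y r \<and> (\<forall>r'. gl_minimiser \<iota> k R \<tau> \<nu> n x y r' \<longrightarrow> r \<le> r'))"
  shows "gl_minimiser \<iota> k R \<tau> \<nu> n x y (r_hat \<iota> k R \<tau> \<nu> n x y)"
proof -
  let ?m = "gl_minimiser \<iota> k R \<tau> \<nu> n x y"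
  have "\<exists>r. ?m r \<and> (\<forall>r'. ?m r' \<longrightarrow> r \<le> r')"
  proof (cases "finite R \<and> R \<noteq> {}")
    case True
    have "finite {r. ?m r}" using True by (rule_tac finite_subset[of _ R]) (auto simp: gl_minimiser_def)
    moreover have "{r. ?m r} \<noteq> {}"
      using ex_is_arg_min_if_finite[of R "gl_crit \<iota> k R \<tau> \<nu> n x y"] True
      by (force simp: gl_minimiser_def is_arg_min_linorder)
    ultimately show ?thesis using Min_in[of "{r. ?m r}"] Min_le[of "{r. ?m r}"] by blast
  qed (use assms in blast)
  then obtain r where r: "?m r" "\<And>r'. ?m r' \<Longrightarrow> r \<le> r'" by blast
  hence "r_hat \<iota> k R \<tau> \<nu> n x y = r" unfolding r_hat_def by (intro Least_equality)
  thus ?thesis using r by simp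
qed

section \<open>The risk bound on the events\<close>

context measurable_rkhs
begin

text \<open>As |g| \<le> C, g is its own clipping, so clipping h does not increase its distance to
  g.\<close>

lemma pop_sq_clip_bound:
  fixes g :: "'s \<Rightarrow>\<^sub>C real"
  assumes g: "apply_bcontfun g \<in> borel_measurable P" "norm g \<le> C" and C: "C > 0"
  shows "pop_sq P (\<lambda>z. clip C (\<iota> f z) - g z) \<le>
    2 * pop_sq P (\<lambda>z. clip C (\<iota> f z) - clip C (\<iota> h z)) + 2 * (norm (\<iota> h - g))\<^sup>2"
proof -
  note [measurable] = g(1)
  have gb: "\<bar>g z\<bar> \<le> C" for z using norm_bounded[of g z] g(2) by simp
  have i1: "integrable P (\<lambda>z. (clip C (\<iota> f z) - clip C (\<iota> h z))\<^sup>2)"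
    using C by (intro integrable_const_bound[of _ "4 * C\<^sup>2"] AE_I2) (auto simp: clip_sq_le)
  have "clip C (g z) = g z" for z using gb by (rule clip_eq)
  hence cg: "(\<lambda>z. clip C (\<iota> f z) - g z) = (\<lambda>z. clip C (\<iota> f z) - clip C (g z))" by simp
  have [measurable]: "(\<lambda>z. clip C (g z)) \<in> borel_measurable P" by measurable
  have i2: "integrable P (\<lambda>z. (clip C (\<iota> f z) - clip C (g z))\<^sup>2)"
    using C by (intro integrable_const_bound[of _ "4 * C\<^sup>2"] AE_I2) (auto simp: clip_sq_le)
  have "pop_sq P (\<lambda>z. clip C (\<iota> f z) - g z) \<le> (\<integral>z. 2 * (clip C (\<iota> f z) - clip C (\<iota> h z))\<^sup>2 + 2 * (norm (\<iota> h - g))\<^sup>2 \<partial>P)"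
    unfolding pop_sq_def cg
  proof (rule integral_mono)
    fix z
    have "\<bar>clip C (\<iota> h z) - clip C (g z)\<bar> \<le> norm (\<iota> h - g)"
      using abs_clip_diff_le[of C "\<iota> h z" "g z"] norm_bounded[of "\<iota> h - g" z] by simp
    hence "(clip C (\<iota> h z) - clip C (g z))\<^sup>2 \<le> (norm (\<iota> h - g))\<^sup>2" by (simp add: abs_le_square_iff[symmetric])
    moreover have "(p + q)\<^sup>2 \<le> 2 * p\<^sup>2 + 2 * q\<^sup>2" for p q :: real
      using zero_le_power2[of "p - q"] by (simp add: power2_eq_square algebra_simps)
    from this[of "clip C (\<iota> f z) - clip C (\<iota> h z)" "clip C (\<iota> h z) - clip C (g z)"]
    have "(clip C (\<iota> f z) - clip C (g z))\<^sup>2 \<le> 2 * (clip C (\<iota> f z) - clip C (\<iota> h z))\<^sup>2 + 2 * (clip C (\<iota> h z) - clip C (g z))\<^sup>2"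
      by simp
    ultimately show "(clip C (\<iota> f z) - clip C (g z))\<^sup>2 \<le> 2 * (clip C (\<iota> f z) - clip C (\<iota> h z))\<^sup>2 + 2 * (norm (\<iota> h - g))\<^sup>2"
      by linarith
  qed (use i1 i2 in auto)
  also have "\<dots> = 2 * pop_sq P (\<lambda>z. clip C (\<iota> f z) - clip C (\<iota> h z)) + 2 * (norm (\<iota> h - g))\<^sup>2"
    using i1 by (simp add: pop_sq_def prob_space)
  finally show ?thesis .
qed

text \<open>A deterministic statement on the events: \<open>event_A1\<close> feeds the radius
  selection, and \<open>event_A2\<close> carries the empirical distance of the clipped functions
  over to P.\<close>

lemma adaptive_estimator_bound:
  fixes g :: "'s \<Rightarrow>\<^sub>C real" and n :: nat and \<tau> \<nu> \<sigma> C t r \<rho> :: real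
  assumes g: "apply_bcontfun g \<in> borel_measurable P" "norm g \<le> C" and C: "C > 0" and n: "n \<ge> 1"
    and \<sigma>: "\<sigma> > 0" and \<tau>: "\<tau> > 0" and \<nu>: "\<nu> > 0" and R: "R \<subseteq> {0..}"
    and t: "t = (\<tau> / (80 * sqrt (diag_norm k) * \<sigma>))\<^sup>2"
    and w: "\<omega> \<in> event_A1 M \<iota> k g \<sigma> n X Y t" "\<omega> \<in> event_A2 M P \<iota> k C n X t"
    and min: "gl_minimiser \<iota> k R \<tau> \<nu> n (\<lambda>i. X i \<omega>) (\<lambda>i. Y i \<omega>) \<rho>"
    and r: "r \<in> R" and h: "h \<in> cball 0 r"
  defines "c1 \<equiv> 97 * C / (80 * \<sigma>)" and "c2 \<equiv> 8 * C / (19200 * sqrt (diag_norm k) * \<sigma>\<^sup>2)"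
    and "c \<equiv> 20 + 2 * \<nu> + 8 / \<nu>"
  shows "pop_sq P (\<lambda>z. clip C (\<iota> (ls_est \<iota> k n (\<lambda>i. X i \<omega>) (\<lambda>i. Y i \<omega>) \<rho>) z) - g z) \<le>
    c * (8 + 2 * c1 + 2 * c2 * (\<tau> / sqrt n)) * ((norm (\<iota> h - g))\<^sup>2 + \<tau> * r / sqrt n)"
proof -
  interpret ls_data \<iota> k n "\<lambda>i. X i \<omega>" "\<lambda>i. Y i \<omega>" by unfold_locales (rule n)
  let ?\<kappa> = "sqrt (diag_norm k)"
  define e where "e = (norm (\<iota> h - g))\<^sup>2 + \<tau> * r / sqrt n"
  \<comment> \<open>A common radius for the estimator and h. It is random through \<rho>, which is
    harmless because \<open>event_A2\<close> holds for all radii at once.\<close>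
  define m where "m = max \<rho> r"
  have \<kappa>: "?\<kappa> > 0" using diag_pos by simp
  have n0: "real n > 0" using n by simp
  \<comment> \<open>This converts the stochastic term of \<open>event_A1\<close> to (20 / 80) \<tau>
    r / sqrt n, the quarter assumed in the selection argument.\<close>
  have st: "sqrt t = \<tau> / (80 * ?\<kappa> * \<sigma>)" unfolding t using \<tau> \<sigma> \<kappa> by simp
  have oracle_ineq: "esq (lse r) h \<le> \<tau> * r / (4 * sqrt n) + 4 * (norm (\<iota> h - g))\<^sup>2"
    if "r \<ge> 0" "h \<in> cball 0 r" for r h
  proof -
    have "20 * ?\<kappa> * \<sigma> * r * sqrt t / sqrt n = \<tau> * r / (4 * sqrt n)"
      unfolding st using \<sigma> \<kappa> by (simp add: field_simps)
    moreover have "esq (lse r) h \<le> 20 * ?\<kappa> * \<sigma> * r * sqrt t / sqrt n + 4 * (norm (\<iota> h - g))\<^sup>2"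
      using w(1) that unfolding event_A1_def by blast
    ultimately show ?thesis by simp
  qed
  note ar = adaptive_radius[OF \<tau> \<nu> R oracle_ineq min r h, folded c_def e_def m_def]
  have r0: "r \<ge> 0" using r R by auto
  have m0: "m \<ge> 0" "\<rho> \<le> m" "r \<le> m" using r0 by (auto simp: m_def)
  have l: "lse \<rho> \<in> cball 0 m" "h \<in> cball 0 m"
    using lse_mem[OF ar(1)] h m0 by auto
  have e0: "e \<ge> 0" using \<tau> r0 by (simp add: e_def)
  have c: "c \<ge> 20" using \<nu> by (simp add: c_def)
  have c12: "c1 > 0" "c2 > 0" using C \<sigma> \<kappa> by (auto simp: c1_def c2_def)
  have dev: "\<bar>clip_dev C n (\<lambda>i. X i \<omega>) (lse \<rho>) h\<bar> \<le> 97 * ?\<kappa> * C * m * sqrt t / sqrt n + 8 * ?\<kappa> * C * m * t / (3 * n)"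
  proof -
    have "(SUP (f1, f2)\<in>cball 0 m \<times> cball 0 m. \<bar>clip_dev C n (\<lambda>i. X i \<omega>) f1 f2\<bar>) \<le>
      97 * ?\<kappa> * C * m * sqrt t / sqrt n + 8 * ?\<kappa> * C * m * t / (3 * n)"
      using w(2) m0(1) unfolding event_A2_def clip_dev_def by simp
    from bspec[OF bspec[OF event_A2_sup_iff[OF less_imp_le[OF C] m0(1), THEN iffD1, OF this] l(1)] l(2)]
    show ?thesis .
  qed
  have dev1: "97 * ?\<kappa> * C * m * sqrt t / sqrt n = c1 * (\<tau> * m / sqrt n)"
    unfolding st using \<kappa> \<sigma> by (simp add: c1_def field_simps)
  \<comment> \<open>Here 19200 = 3 * 80^2.\<close>
  have dev2: "8 * ?\<kappa> * C * m * t / (3 * n) = c2 * (\<tau> / sqrt n) * (\<tau> * m / sqrt n)"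
    unfolding t using \<kappa> \<sigma> n0 by (simp add: c2_def field_simps power2_eq_square)
  have "pop_sq P (\<lambda>z. clip C (\<iota> (lse \<rho>) z) - clip C (\<iota> h z)) \<le>
    emp_sq n (\<lambda>i. X i \<omega>) (\<lambda>z. clip C (\<iota> (lse \<rho>) z) - clip C (\<iota> h z)) +
      (c1 + c2 * (\<tau> / sqrt n)) * (\<tau> * m / sqrt n)"
    using dev unfolding dev1 dev2 clip_dev_def distrib_right by linarith
  also have "\<dots> \<le> 3 * c * e + (c1 + c2 * (\<tau> / sqrt n)) * (c * e)"
  proof (intro add_mono mult_left_mono ar(2))
    have "emp_sq n (\<lambda>i. X i \<omega>) (\<lambda>z. clip C (\<iota> (lse \<rho>) z) - clip C (\<iota> h z)) \<le> esq (lse \<rho>) h"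
      by (rule emp_sq_mono) (rule abs_clip_diff_le)
    thus "emp_sq n (\<lambda>i. X i \<omega>) (\<lambda>z. clip C (\<iota> (lse \<rho>) z) - clip C (\<iota> h z)) \<le> 3 * c * e" using ar(3) by simp
    show "0 \<le> c1 + c2 * (\<tau> / sqrt n)" using c12 \<tau> by (intro add_nonneg_nonneg mult_nonneg_nonneg) auto
  qed
  finally have pop: "pop_sq P (\<lambda>z. clip C (\<iota> (lse \<rho>) z) - clip C (\<iota> h z)) \<le>
     3 * c * e + (c1 + c2 * (\<tau> / sqrt n)) * (c * e)" .
  have "(norm (\<iota> h - g))\<^sup>2 \<le> e" using \<tau> r0 by (simp add: e_def)
  also have "e \<le> c * e" using mult_right_mono[of 1 c e] c e0 by simp
  finally have "pop_sq P (\<lambda>z. clip C (\<iota> (lse \<rho>) z) - g z) \<le> 2 * (3 * c * e + (c1 + c2 * (\<tau> / sqrt n)) * (c * e)) + 2 * (c * e)"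
    by (intro order_trans[OF pop_sq_clip_bound[OF g C, of "lse \<rho>" h]] add_mono mult_left_mono pop) auto
  also have "\<dots> = c * (8 + 2 * c1 + 2 * c2 * (\<tau> / sqrt n)) * e" by (simp add: algebra_simps)
  finally show ?thesis by (simp add: e_def)
qed

end

text \<open>The comparison constants do not depend on n; this is what makes the final constants free
  of n for the grid.\<close>

lemma radius_choice:
  fixes R :: "nat \<Rightarrow> real set"
  assumes R: "(\<forall>n. R n = {0..}) \<or> (\<exists>a>0. \<exists>b>0. \<forall>n. R n = radius_grid a b n)"
  obtains c0 c1 :: real where "c0 > 0" "c1 > 0" "\<And>n. R n \<subseteq> {0..}"
    "\<And>n r. n \<ge> 1 \<Longrightarrow> 1 \<le> r \<Longrightarrow> r \<le> sqrt n \<Longrightarrow> \<exists>s\<in>R n. c0 * r \<le> s \<and> s \<le> c1 * r"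
  using R
proof
  assume "\<forall>n. R n = {0..}"
  thus ?thesis by (intro that[of 1 1]) auto
next
  assume "\<exists>a>0. \<exists>b>0. \<forall>n. R n = radius_grid a b n"
  then obtain a b where ab: "a > 0" "b > 0" "\<And>n. R n = radius_grid a b n" by blast
  show ?thesis
  proof (rule that)
    show "min 1 a > 0" "1 + b > 0" using ab by auto
    show "R n \<subseteq> {0..}" for n using radius_grid_nonneg[OF ab(1,2)] ab(3) by simp
    show "\<exists>s\<in>R n. min 1 a * r \<le> s \<and> s \<le> (1 + b) * r" if "n \<ge> 1" "1 \<le> r" "r \<le> sqrt n" for n r
      using radius_grid_approx[OF ab(1,2) that] ab(3) by simp
  qed
qed

theorem corollary4:
  fixes P :: "'s::topological_space measure"
    and \<iota> :: "'h::{real_inner,complete_space} \<Rightarrow> 's \<Rightarrow>\<^sub>C real"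
    and k :: "'s \<Rightarrow> 's \<Rightarrow> real"
    and g :: "'s \<Rightarrow>\<^sub>C real"
    and C \<sigma> \<beta> B \<nu> :: real
    and R :: "nat \<Rightarrow> real set"
  assumes P: "prob_space P" "space P = UNIV"
    and g_meas: "apply_bcontfun g \<in> borel_measurable P"
    and g_bound: "norm g \<le> C" "C > 0"
    and sigma: "\<sigma> > 0"
    and H: "rkhs \<iota> k" "separable_space (euclidean :: 'h topology)"
    and k: "bounded (range (case_prod k))" "case_prod k \<in> borel_measurable (P \<Otimes>\<^sub>M P)"
      "diag_norm k > 0"
    and dense: "closure (range \<iota>) = UNIV"
    and beta: "0 < \<beta>" "\<beta> < 1"
    and B: "B > 0"
    and g_interp: "g \<in> interp_space \<beta> \<iota>" "interp_norm \<beta> \<iota> g \<le> ennreal B"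
    and nu: "\<nu> > 0"
    and R: "(\<forall>n. R n = {0..}) \<or> (\<exists>a>0. \<exists>b>0. \<forall>n. R n = radius_grid a b n)"
  shows "\<exists>D\<^sub>1>0. \<exists>D\<^sub>2>0.
    \<forall>(n::nat) (M :: 'w measure) (X :: nat \<Rightarrow> 'w \<Rightarrow> 's) (Y :: nat \<Rightarrow> 'w \<Rightarrow> real) (\<tau>::real) (t::real).
      n \<ge> 1 \<longrightarrow>
      regression_sample M P g n X Y \<longrightarrow>
      (\<forall>i\<in>{1..n}. cond_subgaussian M P (X i) (\<lambda>\<omega>. Y i \<omega> - g (X i \<omega>)) (\<sigma>\<^sup>2)) \<longrightarrow>
      \<tau> \<ge> 80 * sqrt (diag_norm k) * \<sigma> \<longrightarrow>
      t = (\<tau> / (80 * sqrt (diag_norm k) * \<sigma>))\<^sup>2 \<longrightarrow>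
      (R n = {0..} \<longrightarrow> r_hat_random_variable M \<iota> k (R n) \<tau> \<nu> n X Y) \<longrightarrow>
      event_A1 M \<iota> k g \<sigma> n X Y t \<inter> event_A2 M P \<iota> k C n X t \<in> sets M \<and>
      measure M (event_A1 M \<iota> k g \<sigma> n X Y t \<inter> event_A2 M P \<iota> k C n X t) \<ge> 1 - 2 * exp (- t) \<and>
      (\<forall>\<omega>\<in>event_A1 M \<iota> k g \<sigma> n X Y t \<inter> event_A2 M P \<iota> k C n X t.
         pop_sq P (\<lambda>z. clip C (\<iota> (ls_est \<iota> k n (\<lambda>i. X i \<omega>) (\<lambda>i. Y i \<omega>)
             (r_hat \<iota> k (R n) \<tau> \<nu> n (\<lambda>i. X i \<omega>) (\<lambda>i. Y i \<omega>))) z) - g z)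
           \<le> D\<^sub>1 * \<tau> * real n powr (- \<beta> / (1 + \<beta>))
             + D\<^sub>2 * \<tau>\<^sup>2 * real n powr (- (1 + 3 * \<beta>) / (2 * (1 + \<beta>))))"
proof -
  interpret prob_space P by (rule P)
  interpret measurable_rkhs \<iota> k P
    by unfold_locales (use H k P in auto)
  obtain c0 c1 where c01: "c0 > 0" "c1 > 0" and Rn: "\<And>n. R n \<subseteq> {0..}"
    and choice: "\<And>n r. n \<ge> 1 \<Longrightarrow> 1 \<le> r \<Longrightarrow> r \<le> sqrt n \<Longrightarrow> \<exists>s\<in>R n. c0 * r \<le> s \<and> s \<le> c1 * r"
    using radius_choice[OF R] by blast
  let ?\<kappa> = "sqrt (diag_norm k)"
  have \<kappa>: "?\<kappa> > 0" using k(3) by simp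
  define b1 where "b1 = 97 * C / (80 * \<sigma>)"
  define b2 where "b2 = 8 * C / (19200 * ?\<kappa> * \<sigma>\<^sup>2)"
  define c where "c = 20 + 2 * \<nu> + 8 / \<nu>"
  \<comment> \<open>The squared bias bound at radius c0 times the balancing power of n, with that
    power taken out.\<close>
  define E where "E = 4 * B\<^sup>2 * (c0 / (2 * B)) powr (- 2 * \<beta> / (1 - \<beta>))"
  define F where "F = E / (80 * ?\<kappa> * \<sigma>) + c1"
  have pos: "b1 > 0" "b2 > 0" "c > 0" "E > 0" "F > 0"
    using g_bound sigma \<kappa> nu c01 B
    by (auto simp: b1_def b2_def c_def E_def F_def intro!: add_pos_pos divide_pos_pos)
  define D1 where "D1 = c * (8 + 2 * b1) * F"
  define D2 where "D2 = 2 * c * b2 * F"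
  have D: "D1 > 0" "D2 > 0" using pos by (auto simp: D1_def D2_def)
  show ?thesis
  proof (rule exI[of _ D1], rule conjI[OF D(1)], rule exI[of _ D2], rule conjI[OF D(2)], intro conjI allI impI)
    fix n :: nat and M :: "'w measure" and X :: "nat \<Rightarrow> 'w \<Rightarrow> 's" and Y :: "nat \<Rightarrow> 'w \<Rightarrow> real" and \<tau> t :: real
    assume n: "n \<ge> 1" and rs: "regression_sample M P g n X Y"
      and sg: "\<forall>i\<in>{1..n}. cond_subgaussian M P (X i) (\<lambda>\<omega>. Y i \<omega> - g (X i \<omega>)) (\<sigma>\<^sup>2)"
      and \<tau>: "\<tau> \<ge> 80 * ?\<kappa> * \<sigma>" and t: "t = (\<tau> / (80 * ?\<kappa> * \<sigma>))\<^sup>2"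
      and rv: "R n = {0..} \<longrightarrow> r_hat_random_variable M \<iota> k (R n) \<tau> \<nu> n X Y"
    have Zm: "(\<lambda>\<omega>. (X i \<omega>, Y i \<omega>)) \<in> measurable M (P \<Otimes>\<^sub>M borel)" if i: "i \<in> {1..n}" for i
    proof -
      interpret M: prob_space M using rs by (simp add: regression_sample_def)
      have "M.indep_vars (\<lambda>_. P \<Otimes>\<^sub>M borel) (\<lambda>i \<omega>. (X i \<omega>, Y i \<omega>)) {1..n}"
        using rs by (simp add: regression_sample_def)
      thus ?thesis using i unfolding M.indep_vars_def by fast
    qed
    interpret sample \<iota> k P M n X Y
    proof
      show "X i \<in> measurable M P" "Y i \<in> borel_measurable M" if "i \<in> {1..n}" for i
        using measurable_compose[OF Zm[OF that] measurable_fst] measurable_compose[OF Zm[OF that] measurable_snd]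
        by simp_all
    qed (rule n)
    have s80: "80 * ?\<kappa> * \<sigma> > 0" using \<kappa> sigma by simp
    have \<tau>0: "\<tau> > 0" using \<tau> s80 by linarith
    have t1: "t \<ge> 1"
    proof -
      have "1 \<le> \<tau> / (80 * ?\<kappa> * \<sigma>)" using \<tau> s80 by (simp add: le_divide_eq)
      thus ?thesis unfolding t by (rule one_le_power)
    qed
    show "event_A1 M \<iota> k g \<sigma> n X Y t \<inter> event_A2 M P \<iota> k C n X t \<in> sets M"
      using event_A1_sets event_A2_sets[OF g_bound(2)] by blast
    show "1 - 2 * exp (- t) \<le> measure M (event_A1 M \<iota> k g \<sigma> n X Y t \<inter> event_A2 M P \<iota> k C n X t)"
      by (rule prob_events[OF rs g_meas sg sigma g_bound(2) t1])
    show "\<forall>\<omega>\<in>event_A1 M \<iota> k g \<sigma> n X Y t \<inter> event_A2 M P \<iota> k C n X t.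
         pop_sq P (\<lambda>z. clip C (\<iota> (ls_est \<iota> k n (\<lambda>i. X i \<omega>) (\<lambda>i. Y i \<omega>)
             (r_hat \<iota> k (R n) \<tau> \<nu> n (\<lambda>i. X i \<omega>) (\<lambda>i. Y i \<omega>))) z) - g z)
           \<le> D1 * \<tau> * real n powr (- \<beta> / (1 + \<beta>))
             + D2 * \<tau>\<^sup>2 * real n powr (- (1 + 3 * \<beta>) / (2 * (1 + \<beta>)))"
    proof
      fix \<omega> assume w: "\<omega> \<in> event_A1 M \<iota> k g \<sigma> n X Y t \<inter> event_A2 M P \<iota> k C n X t"
      hence w1: "\<omega> \<in> event_A1 M \<iota> k g \<sigma> n X Y t" "\<omega> \<in> event_A2 M P \<iota> k C n X t" "\<omega> \<in> space M"
        by (auto simp: event_A1_def)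
      define \<rho> where "\<rho> = r_hat \<iota> k (R n) \<tau> \<nu> n (\<lambda>i. X i \<omega>) (\<lambda>i. Y i \<omega>)"
      let ?m = "gl_minimiser \<iota> k (R n) \<tau> \<nu> n (\<lambda>i. X i \<omega>) (\<lambda>i. Y i \<omega>)"
      have "finite (R n) \<and> R n \<noteq> {} \<or> (\<exists>r. ?m r \<and> (\<forall>r'. ?m r' \<longrightarrow> r \<le> r'))"
      proof (cases "R n = {0..}")
        case True
        hence "r_hat_random_variable M \<iota> k (R n) \<tau> \<nu> n X Y" using rv by blast
        hence "\<exists>r. ?m r \<and> (\<forall>r'. ?m r' \<longrightarrow> r \<le> r')"
          using w1(3) unfolding r_hat_random_variable_def by blast
        thus ?thesis ..
      next
        case False
        then obtain a b where "R n = radius_grid a b n" using R by blast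
        hence "finite (R n) \<and> R n \<noteq> {}" using radius_grid_finite[of a b n] by (auto simp: radius_grid_def)
        thus ?thesis ..
      qed
      hence min: "?m \<rho>" unfolding \<rho>_def by (rule r_hat_minimiser)
      have n0: "real n \<ge> 1" "real n > 0" using n by auto
      \<comment> \<open>The balancing radius; its exponent lies between 0 and 1/2, so it falls in
        the range [1, sqrt n] that the grid can resolve.\<close>
      define rs where "rs = real n powr ((1 - \<beta>) / (2 * (1 + \<beta>)))"
      have rs1: "rs \<ge> 1" unfolding rs_def using n0 beta by (intro ge_one_powr_ge_zero) auto
      have "rs \<le> real n powr (1 / 2)"
        unfolding rs_def using n0 beta by (intro powr_mono) (auto simp: field_simps)
      hence rs2: "rs \<le> sqrt n" using n0 by (simp add: powr_half_sqrt)
      obtain r where r: "r \<in> R n" "c0 * rs \<le> r" "r \<le> c1 * rs" using choice[OF n rs1 rs2] by blast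
      have r0: "r > 0" using r(2) c01 rs1 by (auto intro: less_le_trans[of 0 "c0 * rs"])
      obtain h where h: "h \<in> cball 0 r" "norm (\<iota> h - g) \<le> 2 * B * (r / (2 * B)) powr (- \<beta> / (1 - \<beta>))"
        using interpolation_approx[OF g_interp(2) B beta r0] by blast
      have half: "real n powr (- 1 / 2) = 1 / sqrt n"
      proof -
        have "real n powr (- (1 / 2)) = 1 / sqrt n"
          using n0 by (simp only: powr_minus_divide powr_half_sqrt)
        thus ?thesis by (simp only: minus_divide_left)
      qed
      define N where "N = real n powr (- \<beta> / (1 + \<beta>))"
      have N: "N > 0" using n0 by (simp add: N_def)
      have bias: "(norm (\<iota> h - g))\<^sup>2 \<le> E * N"
      proof -
        have "(norm (\<iota> h - g))\<^sup>2 \<le> (2 * B * (r / (2 * B)) powr (- \<beta> / (1 - \<beta>)))\<^sup>2"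
          using h(2) by (intro power_mono) auto
        also have "\<dots> = 4 * B\<^sup>2 * (r / (2 * B)) powr (- 2 * \<beta> / (1 - \<beta>))"
          by (simp add: power_mult_distrib power2_eq_square powr_add[symmetric])
        also have "\<dots> \<le> 4 * B\<^sup>2 * (c0 / (2 * B) * rs) powr (- 2 * \<beta> / (1 - \<beta>))"
        proof (intro mult_left_mono powr_mono2')
          show "- 2 * \<beta> / (1 - \<beta>) \<le> 0" using beta by (simp add: divide_nonpos_pos)
          show "0 < c0 / (2 * B) * rs" using c01 B rs1 by simp
          show "c0 / (2 * B) * rs \<le> r / (2 * B)" using r(2) B by (simp add: field_simps)
        qed simp
        also have "(c0 / (2 * B) * rs) powr (- 2 * \<beta> / (1 - \<beta>)) =
          (c0 / (2 * B)) powr (- 2 * \<beta> / (1 - \<beta>)) * rs powr (- 2 * \<beta> / (1 - \<beta>))"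
          by (rule powr_mult)
        \<comment> \<open>The exponents multiply to - \<beta> / (1 + \<beta>), the same power as
          that of rs / sqrt n in \<open>var\<close>.\<close>
        also have "rs powr (- 2 * \<beta> / (1 - \<beta>)) = N"
        proof -
          have gen: "q / (2 * p) * (- 2 * b / q) = - b / p" if "q \<noteq> 0" "p \<noteq> 0" for p q b :: real
            using that by (simp add: field_simps)
          have "(1 - \<beta>) / (2 * (1 + \<beta>)) * (- 2 * \<beta> / (1 - \<beta>)) = - \<beta> / (1 + \<beta>)"
            by (rule gen) (use beta in auto)
          thus ?thesis by (simp only: rs_def N_def powr_powr)
        qed
        finally show ?thesis by (simp add: E_def)
      qed
      have var: "\<tau> * r / sqrt n \<le> c1 * \<tau> * N"
      proof -
        have "\<tau> * r / sqrt n \<le> \<tau> * (c1 * rs) / sqrt n"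
          using r(3) \<tau>0 by (intro divide_right_mono mult_left_mono) auto
        also have "\<dots> = c1 * \<tau> * (rs * real n powr (- 1 / 2))"
          unfolding half by simp
        also have "rs * real n powr (- 1 / 2) = N"
          unfolding rs_def N_def powr_add[symmetric] using beta
          by (intro arg_cong2[where f = "(powr)"] refl) (simp add: field_simps)
        finally show ?thesis .
      qed
      have sum: "(norm (\<iota> h - g))\<^sup>2 + \<tau> * r / sqrt n \<le> F * \<tau> * N"
      proof -
        \<comment> \<open>The bias carries no \<tau>; the lower bound on \<tau> lets it be written
          as a multiple of \<tau>.\<close>
        have "E * N \<le> (E / (80 * ?\<kappa> * \<sigma>)) * \<tau> * N"
        proof (rule mult_right_mono)
          have "E * 1 \<le> E * (\<tau> / (80 * ?\<kappa> * \<sigma>))"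
            using \<tau> s80 pos by (intro mult_left_mono) (auto simp: le_divide_eq)
          thus "E \<le> E / (80 * ?\<kappa> * \<sigma>) * \<tau>" by simp
        qed (use N in simp)
        thus ?thesis using bias var by (simp add: F_def distrib_right)
      qed
      have "pop_sq P (\<lambda>z. clip C (\<iota> (ls_est \<iota> k n (\<lambda>i. X i \<omega>) (\<lambda>i. Y i \<omega>) \<rho>) z) - g z) \<le>
        c * (8 + 2 * b1 + 2 * b2 * (\<tau> / sqrt n)) * ((norm (\<iota> h - g))\<^sup>2 + \<tau> * r / sqrt n)"
        unfolding c_def b1_def b2_def
        by (rule adaptive_estimator_bound[OF g_meas g_bound n sigma \<tau>0 nu Rn t w1(1,2) min r(1) h(1)])
      also have "\<dots> \<le> c * (8 + 2 * b1 + 2 * b2 * (\<tau> / sqrt n)) * (F * \<tau> * N)"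
        using sum pos \<tau>0 by (intro mult_left_mono) auto
      also have "\<dots> = D1 * \<tau> * N + D2 * \<tau>\<^sup>2 * (real n powr (- 1 / 2) * N)"
        unfolding half by (simp add: D1_def D2_def power2_eq_square algebra_simps)
      \<comment> \<open>The second rate is the first times n^(-1/2), from the t / n term of
        \<open>event_A2\<close>.\<close>
      also have "real n powr (- 1 / 2) * N = real n powr (- (1 + 3 * \<beta>) / (2 * (1 + \<beta>)))"
        unfolding N_def powr_add[symmetric] using beta
        by (intro arg_cong2[where f = "(powr)"] refl) (simp add: field_simps)
      finally show "pop_sq P (\<lambda>z. clip C (\<iota> (ls_est \<iota> k n (\<lambda>i. X i \<omega>) (\<lambda>i. Y i \<omega>)
             (r_hat \<iota> k (R n) \<tau> \<nu> n (\<lambda>i. X i \<omega>) (\<lambda>i. Y i \<omega>))) z) - g z)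
           \<le> D1 * \<tau> * real n powr (- \<beta> / (1 + \<beta>))
             + D2 * \<tau>\<^sup>2 * real n powr (- (1 + 3 * \<beta>) / (2 * (1 + \<beta>)))"
        by (simp add: \<rho>_def N_def)
    qed
  qed
qed

end
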